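(* Let $n\ge6$ and $1\le p\le n-4$, and consider the class $\mathcal U(n,p)$ of unicyclic graphs with $n$ vertices and exactly $p$ pendant vertices. Among graphs in $\mathcal U(n,p)$: (i) if $p=1$, then $U_{n,4,n-2}(n-4,0)$ is the unique graph with maximum reverse degree distance; (ii) if $p=2$, then $U_{n,4,n-2}$ is the unique graph with maximum reverse degree distance; (iii) if $p=3$ and $n=7$, then $U_{7,3,4}$ is the unique graph with maximum reverse degree distance; (iv) if $p=3$ and $n>7$ is odd, then $U^k_{n,4,n-3}\big(\frac{n-5}{2},\frac{n-5}{2}\big)$ for $k=0,1$ are the unique graphs with maximum reverse degree distance; (v) if $p=3$ and $n\ge6$ is even, or $4\le p\le n-4$, then: $U_{n,4,n-p}$ is the unique graph with maximum reverse degree distance if $\lfloor\frac{n-p-1}{2}\rfloor>\frac{n+4}{6}$; $U_{n,3,n-p}$ and $U_{n,4,n-p}$ are the unique graphs with maximum reverse degree distance if $\lfloor\frac{n-p-1}{2}\rfloor=\frac{n+4}{6}$; $U_{n,3,n-p}$ is the unique graph with maximum reverse degree distance if $\lfloor\frac{n-p-1}{2}\rfloor<\frac{n+4}{6}$.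
   Context: All graphs are finite, simple and connected; uniqueness is up to isomorphism. For a graph $G$, $d_G(x,y)$ is the distance, $D_G(x)=\sum_{y}d_G(x,y)$, $d_G(x)$ the degree, and $D'(G)=\sum_{x}d_G(x)D_G(x)$ the degree distance. The reverse degree distance of a graph $G$ with $n$ vertices, $e$ edges and diameter $d$ is ${}^rD'(G)=2(n-1)ed-D'(G)$. A unicyclic graph is a connected graph with exactly one cycle; a pendant vertex is a vertex of degree one. Attaching a path $P_s$ ($s\ge1$) to $w$ means adding new vertices $w_1,\dots,w_s$ with edges $ww_1,w_1w_2,\dots,w_{s-1}w_s$ (nothing for $s=0$); attaching $h$ pendant vertices to $w$ means adding $h$ new vertices each joined only to $w$. For integers $n,m,d$ let $h=n-d-\lfloor\frac{m+1}{2}\rfloor$. For integers $a\ge b\ge0$ with $a\ge1$, $a+b=d-\lfloor\frac m2\rfloor$, and $0\le k\le\lfloor\frac m4\rfloor$, $U^k_{n,m,d}(a,b)$ is the graph obtained from the cycle $C_m=v_0v_1\cdots v_{m-1}v_0$ by attaching a path $P_a$ to $v_0$, a path $P_b$ to $v_{\lfloor m/2\rfloor}$, and $h$ pendant vertices to $v_k$; $U_{n,m,d}(a,b)=U^0_{n,m,d}(a,b)$. Let $\alpha=\frac{h\lfloor m/2\rfloor}{n-d-\frac12}$, let $\gamma,\theta$ be nonnegative integers with $\gamma+\theta=d-\lfloor\frac m2\rfloor$ such that $\gamma-\theta$ is as large as possible subject to $\gamma-\theta\le\alpha+1$, and $U_{n,m,d}=U_{n,m,d}(\gamma,\theta)$.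 *)

theory Defs
  imports "Graph_Theory.Graph_Theory"
begin

(* Finite simple graphs are the pair_graph instances of 'a pair_pre_digraph: each edge xy is
   represented by the two arcs (x,y) and (y,x). *)

definition undirected_edges :: "('a \<times> 'a) set \<Rightarrow> 'a set set" where
  "undirected_edges A = (\<lambda>(x, y). {x, y}) ` A"

definition degree :: "'a pair_pre_digraph \<Rightarrow> 'a \<Rightarrow> nat" where
  "degree G x = out_degree (with_proj G) x"

definition gdist :: "'a pair_pre_digraph \<Rightarrow> 'a \<Rightarrow> 'a \<Rightarrow> nat" where
  "gdist G x y = (LEAST k. \<exists>p. pre_digraph.awalk (with_proj G) x p y \<and> length p = k)"

lemma (in pair_wf_digraph) unit_cost_shortest_path_eq_gdist:
  assumes "reachable G u v"
  shows "\<mu> (\<lambda>_. 1) u v = ereal (real (gdist G u v))"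
proof -
  have cost: "awalk_cost (\<lambda>_. 1) p = real (length p)" for p :: "('a \<times> 'a) list"
    by (induction p) (auto simp: awalk_cost_def)
  obtain q where q: "awalk u q v"
    using assms reachable_awalk by auto
  have "\<exists>p. awalk u p v \<and> length p = gdist G u v"
    unfolding gdist_def by (rule LeastI_ex) (use q in blast)
  then obtain p where p: "awalk u p v" "length p = gdist G u v" by blast
  have least: "gdist G u v \<le> length r" if "awalk u r v" for r
    unfolding gdist_def by (rule Least_le) (use that in blast)
  show ?thesis
    unfolding \<mu>_def
  proof (rule antisym)
    show "(INF r\<in>{r. awalk u r v}. ereal (awalk_cost (\<lambda>_. 1) r)) \<le> ereal (real (gdist G u v))"
      by (rule INF_lower2[of p]) (use p cost in auto)
    show "ereal (real (gdist G u v)) \<le> (INF r\<in>{r. awalk u r v}. ereal (awalk_cost (\<lambda>_. 1) r))"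
      by (rule INF_greatest) (use least cost in auto)
  qed
qed

definition diameter :: "'a pair_pre_digraph \<Rightarrow> nat" where
  "diameter G = Max {gdist G x y |x y. x \<in> pverts G \<and> y \<in> pverts G}"

definition vertex_dist_sum :: "'a pair_pre_digraph \<Rightarrow> 'a \<Rightarrow> nat" where
  "vertex_dist_sum G x = (\<Sum>y\<in>pverts G. gdist G x y)"

definition degree_distance :: "'a pair_pre_digraph \<Rightarrow> nat" where
  "degree_distance G = (\<Sum>x\<in>pverts G. degree G x * vertex_dist_sum G x)"

definition reverse_degree_distance :: "'a pair_pre_digraph \<Rightarrow> int" where
  "reverse_degree_distance G =
     2 * (int (card (pverts G)) - 1) * int (card (undirected_edges (parcs G))) * int (diameter G)
     - int (degree_distance G)"

(* A cycle is identified with its set of undirected edges, so that start vertex and orientation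
   do not matter.  The bound on the length excludes the closed walks x, y, x, which the library
   counts as cycles of the symmetric digraph. *)
definition cycle_edge_sets :: "'a pair_pre_digraph \<Rightarrow> 'a set set set" where
  "cycle_edge_sets G =
     {undirected_edges (set p) |p. pre_digraph.cycle (with_proj G) p \<and> 3 \<le> length p}"

definition unicyclic :: "'a pair_pre_digraph \<Rightarrow> bool" where
  "unicyclic G \<longleftrightarrow> pair_graph G \<and> Digraph_Component.connected (with_proj G) \<and>
     (\<exists>!C. C \<in> cycle_edge_sets G)"

definition pendant_vertices :: "'a pair_pre_digraph \<Rightarrow> 'a set" where
  "pendant_vertices G = {x \<in> pverts G. degree G x = 1}"

definition unicyclic_class :: "nat \<Rightarrow> nat \<Rightarrow> 'a pair_pre_digraph set" where
  "unicyclic_class n p =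
     {G. unicyclic G \<and> card (pverts G) = n \<and> card (pendant_vertices G) = p}"

definition max_graphs :: "nat \<Rightarrow> nat \<Rightarrow> 'a pair_pre_digraph set" where
  "max_graphs n p = {G \<in> unicyclic_class n p.
     \<forall>G'\<in>(unicyclic_class n p :: 'a pair_pre_digraph set).
       reverse_degree_distance G' \<le> reverse_degree_distance G}"

(* The vertex types differ: the extremal graphs below live on a fixed infinite type, while the
   graph class is taken over an arbitrary one. *)
definition iso_copies :: "'b pair_pre_digraph \<Rightarrow> 'a pair_pre_digraph set" where
  "iso_copies H = {G. digraph_iso (with_proj G) (with_proj H)}"

datatype uvert = Cyc nat | PathA nat | PathB nat | Pend nat

definition cycle_graph :: "nat \<Rightarrow> uvert pair_pre_digraph" where
  "cycle_graph m =
     \<lparr> pverts = Cyc ` {..<m}, parcs = symcl ((\<lambda>i. (Cyc i, Cyc (Suc i mod m))) ` {..<m}) \<rparr>"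

(* In the two operations below the function c names the new vertices; it has to be injective and
   avoid the vertices of G. *)
definition attach_path ::
    "(nat \<Rightarrow> 'a) \<Rightarrow> nat \<Rightarrow> 'a \<Rightarrow> 'a pair_pre_digraph \<Rightarrow> 'a pair_pre_digraph" where
  "attach_path c s w G =
     \<lparr> pverts = pverts G \<union> c ` {1..s},
       parcs = parcs G \<union> symcl ((\<lambda>i. (if i = 1 then w else c (i - 1), c i)) ` {1..s}) \<rparr>"

definition attach_pendants ::
    "(nat \<Rightarrow> 'a) \<Rightarrow> nat \<Rightarrow> 'a \<Rightarrow> 'a pair_pre_digraph \<Rightarrow> 'a pair_pre_digraph" where
  "attach_pendants c h w G =
     \<lparr> pverts = pverts G \<union> c ` {1..h},
       parcs = parcs G \<union> symcl ((\<lambda>i. (w, c i)) ` {1..h}) \<rparr>"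

(* Truncated subtraction: only meaningful if d + (m + 1) div 2 \<le> n. *)
definition num_pendants :: "nat \<Rightarrow> nat \<Rightarrow> nat \<Rightarrow> nat" where
  "num_pendants n m d = n - d - (m + 1) div 2"

(* Intended for 3 \<le> m, d + (m + 1) div 2 \<le> n, b \<le> a, 1 \<le> a, a + b + m div 2 = d, k \<le> m div 4. *)
definition U_graph ::
    "nat \<Rightarrow> nat \<Rightarrow> nat \<Rightarrow> nat \<Rightarrow> nat \<Rightarrow> nat \<Rightarrow> uvert pair_pre_digraph" where
  "U_graph n m d k a b =
     attach_pendants Pend (num_pendants n m d) (Cyc k)
       (attach_path PathB b (Cyc (m div 2))
         (attach_path PathA a (Cyc 0) (cycle_graph m)))"

definition alpha :: "nat \<Rightarrow> nat \<Rightarrow> nat \<Rightarrow> real" where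
  "alpha n m d = real (num_pendants n m d) * real (m div 2) / (real n - real d - 1 / 2)"

definition gamma_theta :: "nat \<Rightarrow> nat \<Rightarrow> nat \<Rightarrow> nat \<times> nat" where
  "gamma_theta n m d =
     (ARG_MAX (\<lambda>(\<gamma>, \<theta>). int \<gamma> - int \<theta>) (\<gamma>, \<theta>).
        \<gamma> + \<theta> = d - m div 2 \<and> real \<gamma> - real \<theta> \<le> alpha n m d + 1)"

definition U_opt :: "nat \<Rightarrow> nat \<Rightarrow> nat \<Rightarrow> uvert pair_pre_digraph" where
  "U_opt n m d = (case gamma_theta n m d of (\<gamma>, \<theta>) \<Rightarrow> U_graph n m d 0 \<gamma> \<theta>)"

end

theory Submission
  imports Defs
begin

text \<open>Let \<open>G\<close> be unicyclic with \<open>n\<close> vertices, \<open>p\<close> of them pendant, and diameter \<open>d\<close>. Charging each arc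
  to a shortest-path tree gives \<open>D'(G) \<ge> 2 S - n (n - 1) + 2 n\<close>, where \<open>S\<close> is the sum of all distances
  over ordered pairs.

  Let \<open>p \<ge> 2\<close>. Counting the vertices and edges off a diametral path yields \<open>d \<le> n - p\<close>. If
  \<open>d = n - p\<close>, exactly one vertex off the path is not pendant; it has two neighbours on the path, at
  distance one or two, so the cycle is a triangle or a square. The degree distance then splits into a term
  for the position of the cycle, a term for each pendant vertex, and the distances between the
  attachment points of the pendant vertices, which are minimised separately; parity of \<open>d\<close> decides
  where the minimum lies. If \<open>d < n - p\<close>, the bound on \<open>D'(G)\<close>, with \<open>S\<close> estimated by nothing
  more than the triangle inequality along the path, already shows that \<open>G\<close> is worse than the best graph
  with a triangle and diameter \<open>d + 1\<close>, and the latter improves with \<open>d\<close>: up to lower-order terms the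
  gap is \<open>(d - 2 h)\<^sup>2 / 2\<close> with \<open>h = n - d - 2\<close>.

  If \<open>p = 1\<close>, a maximal path starting at the pendant vertex shows that \<open>G\<close> is a cycle with a path
  attached. Its reverse degree distance is explicit, and it grows when the cycle is shortened by two.\<close>

section \<open>Distances, spanning trees and unicyclic graphs\<close>

text \<open>The class ranges over an arbitrary vertex type, possibly too small for n vertices, while
  the extremal graphs live on a type of their own. Both are described by numberings of one edge list
  on {..<n}: an isomorphism class becomes the set of graphs with such a numbering, and uniqueness an
  equality of sets that may both be empty.

  The irregular cases come from squares at even d. Write h for the number of pendant vertices other
  than the two ends of the diametral path. A square placed centrally on the path spoils the central
  position for the pendant vertices; moving it one step away raises twice the degree distance by 12
  and lowers it by 8 h. So the central square wins for h \<le> 1, and for h = 1 two attachment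
  points tie, which gives the pair of graphs at p = 3. In the remaining cases twice the difference
  between square and triangle is linear in n and d, and its sign gives the threshold (n + 4) / 6.

  One pendant vertex needs its own argument because d = n - p would force both ends of the path to
  be pendant.

  Values are scaled by 2, 3 or 6 throughout, so that all comparisons stay among integers.\<close>

locale connected_graph = pair_graph G for G :: "'a pair_pre_digraph" +
  assumes connected: "Digraph_Component.connected (with_proj G)"
begin

lemma arc_sym: "(x, y) \<in> parcs G \<Longrightarrow> (y, x) \<in> parcs G"
  using arcs_symmetric .

lemma arc_ends:
  assumes "(x, y) \<in> parcs G" shows "x \<in> pverts G" "y \<in> pverts G" "x \<noteq> y"
  using assms in_arcsD1 in_arcsD2 no_loops' by auto

lemma pverts_nonempty: "pverts G \<noteq> {}"
  using connected unfolding connected_conv by simp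

lemma walk_ex:
  assumes "u \<in> pverts G" "v \<in> pverts G"
  shows "\<exists>p. awalk u p v"
proof -
  have "strongly_connected (with_proj G)"
    using symmetric_connected_imp_strongly_connected connected sym_arcs by blast
  then have "reachable (with_proj G) u v" using assms by (auto simp: strongly_connected_def)
  then show ?thesis by (simp add: reachable_awalk)
qed

lemma gdist_le_length: "awalk u p v \<Longrightarrow> gdist G u v \<le> length p"
  unfolding gdist_def by (rule Least_le) blast

lemma shortest_walk_ex:
  assumes "u \<in> pverts G" "v \<in> pverts G"
  shows "\<exists>p. awalk u p v \<and> length p = gdist G u v"
  unfolding gdist_def by (rule LeastI_ex) (use walk_ex[OF assms] in blast)

lemma gdist_self [simp]: "u \<in> pverts G \<Longrightarrow> gdist G u u = 0"
  using gdist_le_length[of u "[]" u] by (simp add: awalk_Nil_iff)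

lemma gdist_eq_0_iff:
  assumes "u \<in> pverts G" "v \<in> pverts G"
  shows "gdist G u v = 0 \<longleftrightarrow> u = v"
  using shortest_walk_ex[OF assms] assms by (auto simp: awalk_Nil_iff)

lemma gdist_triangle:
  assumes "u \<in> pverts G" "v \<in> pverts G" "w \<in> pverts G"
  shows "gdist G u w \<le> gdist G u v + gdist G v w"
proof -
  obtain p q where "awalk u p v" "length p = gdist G u v" "awalk v q w" "length q = gdist G v w"
    using shortest_walk_ex assms by meson
  then show ?thesis using gdist_le_length[of u "p @ q" w] by auto
qed

lemma gdist_sym:
  assumes "u \<in> pverts G" "v \<in> pverts G"
  shows "gdist G u v = gdist G v u"
proof -
  have len: "length (rev_path p) = length p" for p :: "('a \<times> 'a) list"
    by (induction p) auto
  have "gdist G u v \<le> gdist G v u" if uv: "u \<in> pverts G" "v \<in> pverts G" for u v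
  proof -
    obtain p where "awalk v p u" "length p = gdist G v u"
      using shortest_walk_ex[OF uv(2) uv(1)] by blast
    then show ?thesis
      using gdist_le_length[of u "rev_path p" v] by (simp add: len)
  qed
  then show ?thesis using assms by (simp add: antisym)
qed

lemma gdist_arc:
  assumes "(x, y) \<in> parcs G" shows "gdist G x y = 1"
proof -
  have "awalk x [(x, y)] y"
    using assms arc_ends[OF assms] by (simp add: awalk_Cons_iff awalk_Nil_iff)
  from gdist_le_length[OF this] show ?thesis
    using gdist_eq_0_iff arc_ends[OF assms] by fastforce
qed

lemma gdist_step:
  assumes "(x, y) \<in> parcs G" "v \<in> pverts G"
  shows "gdist G v y \<le> gdist G v x + 1"
  using gdist_triangle[of v x y] gdist_arc[OF assms(1)] arc_ends[OF assms(1)] assms(2) by simp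

lemma gdist_pred:
  assumes "u \<in> pverts G" "v \<in> pverts G" "u \<noteq> v"
  shows "\<exists>w. (w, v) \<in> parcs G \<and> gdist G u v = gdist G u w + 1"
proof -
  obtain p where p: "awalk u p v" "length p = gdist G u v"
    using shortest_walk_ex assms by blast
  then have "p \<noteq> []" using assms by (auto simp: awalk_Nil_iff)
  then obtain q a where qa: "p = q @ [a]" by (metis rev_exhaust)
  then have "awalk u q (fst a)" "a \<in> parcs G" "snd a = v"
    using p(1) by (auto simp: awalk_Cons_iff awalk_Nil_iff)
  then have "(fst a, v) \<in> parcs G" "gdist G u (fst a) \<le> length q"
    using gdist_le_length by auto
  moreover have "gdist G u v \<le> gdist G u (fst a) + 1"
    using gdist_step calculation(1) assms by blast
  ultimately show ?thesis using p(2) qa by (intro exI[of _ "fst a"]) simp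
qed

lemma gdist_1_arc:
  assumes "u \<in> pverts G" "v \<in> pverts G" "gdist G u v = 1"
  shows "(u, v) \<in> parcs G"
proof -
  have "u \<noteq> v" using assms by auto
  then obtain w where w: "(w, v) \<in> parcs G" "gdist G u v = gdist G u w + 1"
    using gdist_pred assms by blast
  then have "gdist G u w = 0" using assms by simp
  then show ?thesis using w(1) gdist_eq_0_iff[of u w] arc_ends[OF w(1)] assms by auto
qed

text \<open>A certificate for distance formulas that avoids any look at walks: \<open>pred\<close>
  bounds the distance by \<open>f\<close> through induction on \<open>f\<close>, and
  \<open>lip\<close> bounds \<open>f\<close> by the distance through induction on the distance. Both
  explicit graph families below get their distances this way.\<close>

lemma gdist_eqI:
  assumes v: "v \<in> pverts G" and 0: "f v = 0"
    and lip: "\<And>x y. (x, y) \<in> parcs G \<Longrightarrow> f y \<le> f x + 1"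
    and pred: "\<And>x. x \<in> pverts G \<Longrightarrow> x \<noteq> v \<Longrightarrow> \<exists>y. (y, x) \<in> parcs G \<and> f x = f y + (1 :: nat)"
    and u: "u \<in> pverts G"
  shows "gdist G v u = f u"
proof (rule antisym)
  show "gdist G v u \<le> f u" using u
  proof (induction "f u" arbitrary: u rule: less_induct)
    case less
    show ?case
    proof (cases "u = v")
      case False
      then obtain y where y: "(y, u) \<in> parcs G" "f u = f y + 1" using pred less.prems by blast
      then show ?thesis
        using less.hyps[of y] arc_ends[OF y(1)] gdist_step[OF y(1) v] by simp
    qed (use v in auto)
  qed
  show "f u \<le> gdist G v u" using u
  proof (induction "gdist G v u" arbitrary: u rule: less_induct)
    case less
    show ?case
    proof (cases "u = v")
      case False
      then obtain y where y: "(y, u) \<in> parcs G" "gdist G v u = gdist G v y + 1"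
        using gdist_pred v less.prems by metis
      then show ?thesis
        using less.hyps[of y] arc_ends[OF y(1)] lip[OF y(1)] by simp
    qed (use 0 in auto)
  qed
qed

lemma degree_card: "degree G x = card {a \<in> parcs G. fst a = x}"
  unfolding degree_def out_degree_def out_arcs_def by simp

lemma degree_card_neighbours: "degree G x = card {y. (x, y) \<in> parcs G}"
proof -
  have "{a \<in> parcs G. fst a = x} = Pair x ` {y. (x, y) \<in> parcs G}" by auto
  then show ?thesis unfolding degree_card by (simp add: card_image inj_on_def)
qed

text \<open>Each vertex is counted once per outgoing arc. In the resulting sum over arcs those of a
  spanning tree can be split off.\<close>

lemma sum_degree_mult:
  fixes f :: "'a \<Rightarrow> nat"
  shows "(\<Sum>x\<in>pverts G. degree G x * f x) = (\<Sum>a\<in>parcs G. f (fst a))"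
proof -
  have "(\<Sum>x\<in>pverts G. degree G x * f x)
      = (\<Sum>x\<in>pverts G. \<Sum>a\<in>{a \<in> parcs G. fst a = x}. f (fst a))"
    by (rule sum.cong) (auto simp: degree_card)
  also have "\<dots> = (\<Sum>a\<in>parcs G. f (fst a))"
    by (rule sum.group) (use pair_finite_arcs pair_finite_verts arc_ends(1) in auto)
  finally show ?thesis .
qed

lemma card_undirected_edges: "2 * card (undirected_edges (parcs G)) = card (parcs G)"
proof -
  have "card (parcs G) = (\<Sum>e\<in>undirected_edges (parcs G). card {a \<in> parcs G. {fst a, snd a} = e})"
    using sum.group[of "parcs G" "undirected_edges (parcs G)" "\<lambda>a. {fst a, snd a}" "\<lambda>_. 1 :: nat"]
    by (simp add: undirected_edges_def pair_finite_arcs case_prod_beta)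
  also have "\<dots> = (\<Sum>e\<in>undirected_edges (parcs G). 2)"
  proof (rule sum.cong)
    fix e assume "e \<in> undirected_edges (parcs G)"
    then obtain x y where e: "e = {x, y}" "(x, y) \<in> parcs G"
      by (auto simp: undirected_edges_def)
    then have "{a \<in> parcs G. {fst a, snd a} = e} = {(x, y), (y, x)}"
      using arc_sym by (auto simp: doubleton_eq_iff)
    then show "card {a \<in> parcs G. {fst a, snd a} = e} = 2"
      using arc_ends(3)[OF e(2)] by simp
  qed simp
  finally show ?thesis by simp
qed

text \<open>With the root outermost, a different shortest-path tree can be used for every
  root.\<close>

lemma degree_distance_eq:
  "degree_distance G = (\<Sum>v\<in>pverts G. \<Sum>a\<in>parcs G. gdist G v (fst a))"
proof -
  have "degree_distance G = (\<Sum>a\<in>parcs G. \<Sum>v\<in>pverts G. gdist G (fst a) v)"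
    unfolding degree_distance_def sum_degree_mult vertex_dist_sum_def ..
  also have "\<dots> = (\<Sum>v\<in>pverts G. \<Sum>a\<in>parcs G. gdist G (fst a) v)"
    by (rule sum.swap)
  also have "\<dots> = (\<Sum>v\<in>pverts G. \<Sum>a\<in>parcs G. gdist G v (fst a))"
    by (intro sum.cong refl gdist_sym) (auto simp: arc_fst_in_verts)
  finally show ?thesis .
qed

section \<open>Shortest-path trees and cycles\<close>

definition parent :: "'a \<Rightarrow> 'a \<Rightarrow> 'a" where
  "parent r v = (SOME w. (w, v) \<in> parcs G \<and> gdist G r v = gdist G r w + 1)"

lemma parent:
  assumes "r \<in> pverts G" "v \<in> pverts G - {r}"
  shows "(parent r v, v) \<in> parcs G" "gdist G r v = gdist G r (parent r v) + 1"
proof -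
  have "\<exists>w. (w, v) \<in> parcs G \<and> gdist G r v = gdist G r w + 1"
    using gdist_pred[of r v] assms by blast
  from someI_ex[OF this]
  show "(parent r v, v) \<in> parcs G" "gdist G r v = gdist G r (parent r v) + 1"
    unfolding parent_def by blast+
qed

text \<open>Both orientations are included because an undirected edge is a pair of arcs.\<close>

definition tree_arcs :: "'a \<Rightarrow> ('a \<times> 'a) set" where
  "tree_arcs r = (\<lambda>v. (v, parent r v)) ` (pverts G - {r}) \<union> (\<lambda>v. (parent r v, v)) ` (pverts G - {r})"

lemma tree_arcs_sym: "(x, y) \<in> tree_arcs r \<Longrightarrow> (y, x) \<in> tree_arcs r"
  unfolding tree_arcs_def by auto

lemma tree_arcs_subset:
  assumes "r \<in> pverts G" shows "tree_arcs r \<subseteq> parcs G"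
  using parent(1)[OF assms] unfolding tree_arcs_def by (auto intro: arc_sym)

lemma sum_tree_arcs:
  fixes f :: "'a \<times> 'a \<Rightarrow> nat"
  assumes r: "r \<in> pverts G"
  shows "sum f (tree_arcs r) = (\<Sum>v\<in>pverts G - {r}. f (v, parent r v) + f (parent r v, v))"
proof -
  let ?W = "pverts G - {r}"
  \<comment> \<open>The distance from the root falls along arcs of the first kind and rises along
    those of the second, so no arc is of both kinds.\<close>
  have "(\<lambda>v. (v, parent r v)) ` ?W \<inter> (\<lambda>v. (parent r v, v)) ` ?W = {}"
  proof (rule equals0I, elim IntE imageE)
    fix a v w
    assume vw: "v \<in> ?W" "w \<in> ?W" and a: "a = (v, parent r v)" "a = (parent r w, w)"
    have "gdist G r (fst a) = gdist G r (snd a) + 1"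
      using parent(2)[OF r vw(1)] by (simp only: a(1) fst_conv snd_conv)
    moreover have "gdist G r (snd a) = gdist G r (fst a) + 1"
      using parent(2)[OF r vw(2)] by (simp only: a(2) fst_conv snd_conv)
    ultimately show False by linarith
  qed
  then have "sum f (tree_arcs r)
      = sum f ((\<lambda>v. (v, parent r v)) ` ?W) + sum f ((\<lambda>v. (parent r v, v)) ` ?W)"
    unfolding tree_arcs_def using pair_finite_verts by (intro sum.union_disjoint) auto
  also have "\<dots> = (\<Sum>v\<in>?W. f (v, parent r v)) + (\<Sum>v\<in>?W. f (parent r v, v))"
    by (simp add: sum.reindex inj_on_def)
  finally show ?thesis by (simp add: sum.distrib)
qed

lemma card_tree_arcs:
  assumes "r \<in> pverts G" shows "card (tree_arcs r) = 2 * (card (pverts G) - 1)"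
  using sum_tree_arcs[OF assms, of "\<lambda>_. 1"] assms pair_finite_verts by simp

lemma finite_tree_arcs: "finite (tree_arcs r)"
  unfolding tree_arcs_def using pair_finite_verts by simp

text \<open>Acyclicity of the tree in the form in which it is used. Among the child ends of the
  edges in \<open>F\<close> take one farthest from \<open>r\<close>; a second edge of
  \<open>F\<close> at it would lead to a child still farther away.\<close>

lemma tree_edges_leaf:
  assumes r: "r \<in> pverts G" and F: "F \<subseteq> undirected_edges (tree_arcs r)" "F \<noteq> {}"
  shows "\<exists>y. card {e \<in> F. y \<in> e} = 1"
proof -
  have edge: "\<exists>v\<in>pverts G - {r}. e = {v, parent r v}" if "e \<in> F" for e
    using that F(1) unfolding tree_arcs_def undirected_edges_def by fastforce
  define S where "S = {v \<in> pverts G - {r}. {v, parent r v} \<in> F}"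
  have "finite S" "S \<noteq> {}" using pair_finite_verts edge F(2) unfolding S_def by auto
  then have "Max (gdist G r ` S) \<in> gdist G r ` S" by simp
  then obtain v where v: "v \<in> S" "gdist G r v = Max (gdist G r ` S)" by auto
  then have vmax: "gdist G r w \<le> gdist G r v" if "w \<in> S" for w
    using that \<open>finite S\<close> by simp
  have "e = {v, parent r v}" if e: "e \<in> F" "v \<in> e" for e
  proof -
    obtain w where w: "w \<in> pverts G - {r}" "e = {w, parent r w}" using edge e(1) by blast
    then have "w \<in> S" using e unfolding S_def by auto
    then have "v \<noteq> parent r w" using vmax[of w] parent(2)[OF r w(1)] by auto
    then show ?thesis using w e(2) by auto
  qed
  then have "{e \<in> F. v \<in> e} = {{v, parent r v}}" using v(1) unfolding S_def by auto
  then show ?thesis by (intro exI[of _ v]) simp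
qed

lemma tree_walk_ex:
  assumes r: "r \<in> pverts G" and "v \<in> pverts G"
  shows "\<exists>p. awalk r p v \<and> set p \<subseteq> tree_arcs r"
  using assms(2)
proof (induction "gdist G r v" arbitrary: v rule: less_induct)
  case less
  show ?case
  proof (cases "v = r")
    case True
    then show ?thesis using r by (intro exI[of _ "[]"]) (simp add: awalk_Nil_iff)
  next
    case False
    let ?w = "parent r v"
    have w: "(?w, v) \<in> parcs G" "gdist G r v = gdist G r ?w + 1"
      using parent[OF r] False less.prems by auto
    then obtain p where "awalk r p ?w" "set p \<subseteq> tree_arcs r"
      using less.hyps[of ?w] arc_ends[OF w(1)] by auto
    moreover have "awalk ?w [(?w, v)] v"
      using w(1) arc_ends[OF w(1)] by (simp add: awalk_Cons_iff awalk_Nil_iff)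
    moreover have "(?w, v) \<in> tree_arcs r"
      unfolding tree_arcs_def using False less.prems by auto
    ultimately show ?thesis by (intro exI[of _ "p @ [(?w, v)]"]) auto
  qed
qed

text \<open>The path from b to a inside the tree is closed by the arc (a, b). The inclusion makes
  {a, b} the only edge of the cycle that can lie outside the tree, so different non-tree edges have
  different cycles.\<close>

lemma fundamental_cycle_ex:
  assumes r: "r \<in> pverts G" and ab: "(a, b) \<in> parcs G - tree_arcs r"
  shows "\<exists>C\<in>cycle_edge_sets G. {a, b} \<in> C \<and> C \<subseteq> insert {a, b} (undirected_edges (tree_arcs r))"
proof -
  have ends: "a \<in> pverts G" "b \<in> pverts G" "a \<noteq> b" using ab arc_ends by auto
  have rev: "set (rev_path p) = (\<lambda>(x, y). (y, x)) ` set p" for p :: "('a \<times> 'a) list"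
    by (induction p) (auto simp: case_prod_beta)
  obtain p where p: "awalk r p b" "set p \<subseteq> tree_arcs r" using tree_walk_ex r ends by blast
  obtain q where q: "awalk r q a" "set q \<subseteq> tree_arcs r" using tree_walk_ex r ends by blast
  have w: "awalk b (rev_path p @ q) a" using p q by auto
  have sub: "set (rev_path p @ q) \<subseteq> tree_arcs r"
    using p(2) q(2) by (auto simp: rev intro: tree_arcs_sym)
  define s where "s = awalk_to_apath (rev_path p @ q)"
  have s: "apath b s a" "set s \<subseteq> tree_arcs r"
    using apath_awalk_to_apath[OF w] awalk_to_apath_subset[OF w] sub unfolding s_def by auto
  have "s \<noteq> []" using s(1) ends by (auto simp: apath_Nil_iff)
  \<comment> \<open>A path of one arc would be (b, a), a tree arc, contrary to the choice of (a, b).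
    This excludes the closed walk a, b, a.\<close>
  moreover have "length s \<noteq> 1"
  proof
    assume "length s = 1"
    then obtain c where "s = [c]" by (auto simp: length_Suc_conv)
    then have "s = [(b, a)]" using s(1) by (cases c) (auto simp: apath_Cons_iff apath_Nil_iff)
    then show False using s(2) ab by (auto dest: tree_arcs_sym)
  qed
  ultimately have len: "3 \<le> length ((a, b) # s)" by (cases s; cases "tl s") auto
  have "cycle ((a, b) # s)"
    unfolding cycle_def
  proof (intro exI[of _ a] conjI)
    show "awalk a ((a, b) # s) a"
      using s(1) ab ends by (auto simp: apath_def awalk_Cons_iff)
    show "distinct (tl (pawalk_verts a ((a, b) # s)))"
      using s(1) by (simp add: apath_def)
  qed simp
  then have "undirected_edges (set ((a, b) # s)) \<in> cycle_edge_sets G"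
    unfolding cycle_edge_sets_def using len by blast
  moreover have "undirected_edges (set ((a, b) # s)) \<subseteq> insert {a, b} (undirected_edges (tree_arcs r))"
    using s(2) unfolding undirected_edges_def by auto
  ultimately show ?thesis by (intro bexI) (auto simp: undirected_edges_def)
qed

text \<open>Parity of the degrees is the only feature of the shape of a cycle that is needed later.
  The vertices are numbered cyclically as \<open>v i\<close>; a vertex on the cycle lies on the
  edges towards its two cyclic neighbours and on no others.\<close>

lemma cycle_edges_degree:
  assumes "C \<in> cycle_edge_sets G"
  shows "C \<noteq> {}" "finite C" "C \<subseteq> undirected_edges (parcs G)" "even (card {e \<in> C. x \<in> e})"
proof -
  obtain p where p: "C = undirected_edges (set p)" "cycle p" "3 \<le> length p"
    using assms unfolding cycle_edge_sets_def by auto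
  then obtain u where u: "awalk u p u" "distinct (tl (awalk_verts u p))"
    unfolding cycle_def by auto
  define m where "m = length p"
  have m: "3 \<le> m" using p(3) m_def by simp
  have vs1: "awalk_verts u p = u # map snd p"
    using awalk_verts_conv'[of u p u] u(1) p(3) by (cases p) (auto simp: awalk_def)
  have vs2: "awalk_verts u p = map fst p @ [snd (last p)]"
    using awalk_verts_conv[of u p] p(3) by auto
  have last: "snd (last p) = u" using awlast_of_awalk[OF u(1)] unfolding vs2 by simp
  \<comment> \<open>The vertex list reads both as \<open>u\<close> followed by the heads and as the
    tails followed by \<open>u\<close>; comparing the two gives the cyclic successor.\<close>
  have nth: "snd (p ! i) = fst (p ! (Suc i mod m))" if "i < m" for i
  proof -
    have eq: "u # map snd p = map fst p @ [u]"
      using trans[OF vs1[symmetric] vs2] by (simp only: last)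
    have "snd (p ! i) = (u # map snd p) ! Suc i" using that m_def by simp
    also have "\<dots> = (map fst p @ [u]) ! Suc i" unfolding eq ..
    also have "\<dots> = fst (p ! (Suc i mod m))"
    proof (cases "Suc i = m")
      case True
      moreover have "fst (p ! 0) = u"
      proof -
        have "(map fst p @ [u]) ! 0 = u" unfolding eq[symmetric] by (rule nth_Cons_0)
        then show ?thesis using m m_def by (simp add: nth_append split: if_splits)
      qed
      ultimately show ?thesis by (simp add: nth_append m_def)
    next
      case False
      then show ?thesis using that by (simp add: nth_append m_def)
    qed
    finally show ?thesis .
  qed
  define v where "v i = fst (p ! i)" for i
  have "distinct (map snd p)" using u(2) vs1 by simp
  then have inj_snd: "inj_on (\<lambda>i. snd (p ! i)) {..<m}"
    by (auto simp: inj_on_def m_def distinct_conv_nth)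
  have inj: "inj_on v {..<m}"
  proof (rule inj_onI)
    fix i j assume ij: "i \<in> {..<m}" "j \<in> {..<m}" "v i = v j"
    define i' j' where "i' = (i + m - 1) mod m" and "j' = (j + m - 1) mod m"
    have s: "Suc i' mod m = i" "Suc j' mod m = j" "i' < m" "j' < m"
      using ij m unfolding i'_def j'_def by (auto simp: mod_Suc_eq)
    then have "snd (p ! i') = snd (p ! j')" using nth ij(3) unfolding v_def by simp
    then have "i' = j'" using inj_snd s by (auto simp: inj_on_def)
    then show "i = j" using s by metis
  qed
  have set_p: "set p = (\<lambda>i. (v i, v (Suc i mod m))) ` {..<m}"
  proof -
    have "set p = (\<lambda>i. p ! i) ` {..<m}" by (auto simp: set_conv_nth m_def)
    also have "\<dots> = (\<lambda>i. (v i, v (Suc i mod m))) ` {..<m}"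
      by (rule image_cong) (auto simp: v_def nth prod_eq_iff)
    finally show ?thesis .
  qed
  then have C: "C = (\<lambda>i. {v i, v (Suc i mod m)}) ` {..<m}"
    using p(1) by (auto simp: undirected_edges_def image_image)
  show "C \<noteq> {}" "finite C" using C m by (auto simp: lessThan_empty_iff)
  show "C \<subseteq> undirected_edges (parcs G)"
    using u(1) p(1) by (auto simp: undirected_edges_def awalk_def)
  show "even (card {e \<in> C. x \<in> e})"
  proof (cases "x \<in> v ` {..<m}")
    case False
    then have "{e \<in> C. x \<in> e} = {}" using C m by auto
    then show ?thesis by (simp only: card.empty even_zero)
  next
    case True
    then obtain i where i: "i < m" "x = v i" by auto
    define j where "j = (i + m - 1) mod m"
    have j: "j < m" "Suc j mod m = i" using i m unfolding j_def by (auto simp: mod_Suc_eq)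
    have "{e \<in> C. x \<in> e} = {{v i, v (Suc i mod m)}, {v j, v i}}"
    proof -
      have "k = i \<or> k = j" if k: "k < m" "x \<in> {v k, v (Suc k mod m)}" for k
      proof -
        have "k = i \<or> Suc k mod m = i"
          using k i m inj_onD[OF inj, of i k] inj_onD[OF inj, of i "Suc k mod m"] by fastforce
        moreover have "k = j" if "Suc k mod m = i"
          using that j k(1) i(1) by (simp add: mod_Suc split: if_splits)
        ultimately show ?thesis by blast
      qed
      then have "{e \<in> C. x \<in> e} \<subseteq> {{v i, v (Suc i mod m)}, {v j, v (Suc j mod m)}}"
        unfolding C by blast
      moreover have "{{v i, v (Suc i mod m)}, {v j, v (Suc j mod m)}} \<subseteq> {e \<in> C. x \<in> e}"
        unfolding C using i j by auto
      ultimately show ?thesis using j(2) by auto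
    qed
    \<comment> \<open>Here the length matters: with only two arcs the two cyclic neighbours would
      coincide.\<close>
    moreover have "{v i, v (Suc i mod m)} \<noteq> {v j, v i}"
    proof
      assume "{v i, v (Suc i mod m)} = {v j, v i}"
      then have "v (Suc i mod m) = v j" by (metis doubleton_eq_iff)
      then have "Suc i mod m = j" using inj_onD[OF inj] j(1) m by fastforce
      then show False using i j m by (auto simp: mod_Suc split: if_splits)
    qed
    ultimately show ?thesis by simp
  qed
qed

text \<open>All degrees in the symmetric difference of two cycles are even, so it cannot consist of tree
  edges only.\<close>

lemma cycle_edge_sets_eq:
  assumes r: "r \<in> pverts G" and C: "C \<in> cycle_edge_sets G" "D \<in> cycle_edge_sets G"
    and sub: "undirected_edges (parcs G) \<subseteq> insert e (undirected_edges (tree_arcs r))"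
  shows "C = D"
proof -
  note C' = cycle_edges_degree[OF C(1)] and D' = cycle_edges_degree[OF C(2)]
  \<comment> \<open>Every cycle uses \<open>e\<close>, since tree edges alone would leave a vertex
    of degree one. Hence \<open>e\<close> drops out of the symmetric difference.\<close>
  have mem: "e \<in> X" if X: "X \<in> cycle_edge_sets G" for X
  proof (rule ccontr)
    assume "e \<notin> X"
    then have "X \<subseteq> undirected_edges (tree_arcs r)"
      using cycle_edges_degree(3)[OF X] sub by auto
    then obtain y where "card {e \<in> X. y \<in> e} = 1"
      using tree_edges_leaf[OF r] cycle_edges_degree(1)[OF X] by blast
    then show False using cycle_edges_degree(4)[OF X, of y] by simp
  qed
  have "(C - D) \<union> (D - C) = {}"
  proof (rule ccontr)
    let ?F = "(C - D) \<union> (D - C)"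
    assume "?F \<noteq> {}"
    moreover have "?F \<subseteq> undirected_edges (tree_arcs r)"
      using C'(3) D'(3) sub mem[OF C(1)] mem[OF C(2)] by auto
    ultimately obtain y where y: "card {e \<in> ?F. y \<in> e} = 1"
      using tree_edges_leaf[OF r] by metis
    let ?c = "{e \<in> C. y \<in> e}" and ?d = "{e \<in> D. y \<in> e}"
    have fin: "finite ?c" "finite ?d" using C'(2) D'(2) by auto
    have "{e \<in> ?F. y \<in> e} = (?c - ?d) \<union> (?d - ?c)" by auto
    then have "card {e \<in> ?F. y \<in> e} = card (?c - ?d) + card (?d - ?c)"
      using fin by (subst card_Un_disjoint[symmetric]) auto
    moreover have "card ?c = card (?c \<inter> ?d) + card (?c - ?d)"
      using fin by (subst card_Un_disjoint[symmetric]) (auto intro: arg_cong[of _ _ card])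
    moreover have "card ?d = card (?c \<inter> ?d) + card (?d - ?c)"
      using fin by (subst card_Un_disjoint[symmetric]) (auto intro: arg_cong[of _ _ card])
    ultimately show False using y C'(4)[of y] D'(4)[of y] by presburger
  qed
  then show ?thesis by auto
qed

text \<open>Each edge outside a spanning tree lies on its own fundamental cycle, so a unique cycle
  means exactly one such edge. From here on the cycle condition is replaced by this count of
  arcs.\<close>

lemma unicyclic_iff: "unicyclic G \<longleftrightarrow> card (parcs G) = 2 * card (pverts G)"
proof -
  obtain r where r: "r \<in> pverts G" using pverts_nonempty by auto
  let ?N = "parcs G - tree_arcs r"
  have n: "card (pverts G) > 0" using r pair_finite_verts by (auto simp: card_gt_0_iff)
  have cardN: "card (parcs G) = 2 * (card (pverts G) - 1) + card ?N"
    using card_tree_arcs[OF r] card_Diff_subset[OF finite_tree_arcs tree_arcs_subset[OF r]]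
      card_mono[OF pair_finite_arcs tree_arcs_subset[OF r]] by linarith
  have finN: "finite ?N" using pair_finite_arcs by simp
  have und: "undirected_edges (parcs G) = undirected_edges ?N \<union> undirected_edges (tree_arcs r)"
    using tree_arcs_subset[OF r] unfolding undirected_edges_def by auto
  show ?thesis
  proof
    assume "unicyclic G"
    then obtain C where C: "C \<in> cycle_edge_sets G" and uniq: "\<And>D. D \<in> cycle_edge_sets G \<Longrightarrow> D = C"
      unfolding unicyclic_def by blast
    have "?N \<noteq> {}"
    proof
      assume "?N = {}"
      then have "undirected_edges (parcs G) \<subseteq> undirected_edges (tree_arcs r)"
        using und by (metis image_empty sup_bot_left undirected_edges_def order_refl)
      then obtain y where "card {e \<in> C. y \<in> e} = 1"
        using tree_edges_leaf[OF r, of C] cycle_edges_degree(1,3)[OF C] by blast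
      then show False using cycle_edges_degree(4)[OF C, of y] by simp
    qed
    then obtain a b where ab: "(a, b) \<in> ?N" by auto
    obtain D where D: "D \<in> cycle_edge_sets G" "{a, b} \<in> D"
        "D \<subseteq> insert {a, b} (undirected_edges (tree_arcs r))"
      using fundamental_cycle_ex[OF r ab] by blast
    have "?N = {(a, b), (b, a)}"
    proof -
      have "(x, y) = (a, b) \<or> (x, y) = (b, a)" if xy: "(x, y) \<in> ?N" for x y
      proof -
        obtain D' where D': "D' \<in> cycle_edge_sets G" "{x, y} \<in> D'"
          using fundamental_cycle_ex[OF r xy] by blast
        then have "{x, y} \<in> D" using D uniq by blast
        moreover have "{x, y} \<notin> undirected_edges (tree_arcs r)"
          using xy unfolding undirected_edges_def
          by (auto simp: doubleton_eq_iff dest: tree_arcs_sym)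
        ultimately have "{x, y} = {a, b}" using D(3) by auto
        then show ?thesis by (auto simp: doubleton_eq_iff)
      qed
      moreover have "(b, a) \<in> ?N" using ab by (auto intro: arc_sym dest: tree_arcs_sym)
      ultimately show ?thesis using ab by auto
    qed
    then have "card ?N = 2" using arc_ends(3)[of a b] ab by (metis DiffD1 Pair_inject card_2_iff)
    then show "card (parcs G) = 2 * card (pverts G)" using cardN n by simp
  next
    assume "card (parcs G) = 2 * card (pverts G)"
    then have c2: "card ?N = 2" using cardN n by simp
    then obtain a b where ab: "(a, b) \<in> ?N" by (metis card.empty equals0I old.prod.exhaust zero_neq_numeral)
    then have "{(a, b), (b, a)} \<subseteq> ?N" "card {(a, b), (b, a)} = 2"
      using arc_ends(3)[of a b] by (auto intro: arc_sym dest: tree_arcs_sym)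
    then have "?N = {(a, b), (b, a)}" using c2 finN by (metis card_subset_eq)
    then have sub: "undirected_edges (parcs G) \<subseteq> insert {a, b} (undirected_edges (tree_arcs r))"
      using und by (auto simp: undirected_edges_def)
    show "unicyclic G"
      unfolding unicyclic_def
      using fundamental_cycle_ex[OF r ab] cycle_edge_sets_eq[OF r _ _ sub] connected
      by (auto intro: pair_graph)
  qed
qed

text \<open>Fix a root. The tree edge at a child v contributes the distances of v and of its parent,
  twice the distance of v minus 1; over all children this is twice the transmission of the root
  minus n - 1. The two remaining arcs have tails other than the root and add at least 2. The claim
  is the sum over all roots.\<close>

lemma degree_distance_ge:
  assumes "card (parcs G) = 2 * card (pverts G)"
  shows "2 * (\<Sum>u\<in>pverts G. \<Sum>v\<in>pverts G. gdist G u v) + 3 * card (pverts G)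
    \<le> degree_distance G + card (pverts G) * card (pverts G)"
proof -
  let ?n = "card (pverts G)"
  have each: "2 * (\<Sum>v\<in>pverts G. gdist G r v) + 3 \<le> (\<Sum>a\<in>parcs G. gdist G r (fst a)) + ?n"
    if r: "r \<in> pverts G" for r
  proof -
    let ?N = "parcs G - tree_arcs r" and ?W = "pverts G - {r}"
    have n: "?n > 0" using r pair_finite_verts by (auto simp: card_gt_0_iff)
    have "card ?N = 2"
      using assms card_tree_arcs[OF r] tree_arcs_subset[OF r] finite_tree_arcs n
      by (simp add: card_Diff_subset)
    moreover have "(1::nat) \<le> gdist G r (fst a)" if a: "a \<in> ?N" for a
    proof -
      obtain x y where xy: "a = (x, y)" by (cases a)
      \<comment> \<open>Every arc leaving the root is a tree arc, because a neighbour of the root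
        has the root as its parent.\<close>
      have "x \<noteq> r"
      proof
        assume "x = r"
        then have y: "y \<in> pverts G - {r}" and d: "gdist G r y = 1"
          using a xy arc_ends[of x y] gdist_arc by auto
        have "gdist G r (parent r y) = 0" using parent(2)[OF r y] d by simp
        then have "parent r y = r"
          using gdist_eq_0_iff[OF r] arc_ends[OF parent(1)[OF r y]] by simp
        then have "a \<in> tree_arcs r" unfolding tree_arcs_def using xy \<open>x = r\<close> y by force
        then show False using a by simp
      qed
      then have "gdist G r x \<noteq> 0" using gdist_eq_0_iff[OF r, of x] a xy arc_ends[of x y] by auto
      then show ?thesis using xy by simp
    qed
    ultimately have N: "2 \<le> (\<Sum>a\<in>?N. gdist G r (fst a))"
      using sum_mono[of ?N "\<lambda>_. 1" "\<lambda>a. gdist G r (fst a)"] by simp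
    have "(\<Sum>a\<in>tree_arcs r. gdist G r (fst a)) + card ?W
        = (\<Sum>v\<in>?W. gdist G r v + gdist G r (parent r v) + 1)"
      by (simp only: sum_tree_arcs[OF r] sum.distrib fst_conv sum_constant of_nat_id mult_1_right)
    also have "\<dots> = (\<Sum>v\<in>?W. 2 * gdist G r v)"
      using parent(2)[OF r] by (intro sum.cong) auto
    also have "\<dots> = 2 * (\<Sum>v\<in>pverts G. gdist G r v)"
      using r pair_finite_verts by (simp add: sum.remove[of "pverts G" r] sum_distrib_left)
    finally have "(\<Sum>a\<in>tree_arcs r. gdist G r (fst a)) + card ?W = 2 * (\<Sum>v\<in>pverts G. gdist G r v)" .
    moreover have "(\<Sum>a\<in>parcs G. gdist G r (fst a))
        = (\<Sum>a\<in>?N. gdist G r (fst a)) + (\<Sum>a\<in>tree_arcs r. gdist G r (fst a))"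
      using tree_arcs_subset[OF r] pair_finite_arcs by (rule sum.subset_diff)
    moreover have "card ?W = ?n - 1" using r by simp
    ultimately show ?thesis using N n by linarith
  qed
  have "(\<Sum>r\<in>pverts G. 2 * (\<Sum>v\<in>pverts G. gdist G r v) + 3)
      \<le> (\<Sum>r\<in>pverts G. (\<Sum>a\<in>parcs G. gdist G r (fst a)) + ?n)"
    by (intro sum_mono each)
  then show ?thesis
    unfolding degree_distance_eq by (simp add: sum.distrib sum_distrib_left mult.commute)
qed

end

section \<open>Labelled graphs and isomorphic copies\<close>

text \<open>\<open>f\<close> names the vertices of an abstract graph on {..<n}. Since
  \<open>E\<close> does not mention the vertex type, any two graphs with layouts of the same
  \<open>E\<close> are isomorphic by construction.\<close>

definition layout :: "(nat \<Rightarrow> 'a) \<Rightarrow> nat \<Rightarrow> (nat \<times> nat) set \<Rightarrow> 'a pair_pre_digraph \<Rightarrow> bool" where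
  "layout f n E G \<longleftrightarrow>
     inj_on f {..<n} \<and> pverts G = f ` {..<n} \<and> parcs G = map_prod f f ` symcl E"

text \<open>Listing edges upwards excludes loops and double listing; a smaller neighbour for every j
  > 0 gives connectedness by descent to 0.\<close>

definition ascending :: "nat \<Rightarrow> (nat \<times> nat) set \<Rightarrow> bool" where
  "ascending n E \<longleftrightarrow> (\<forall>(i, j)\<in>E. i < j \<and> j < n) \<and> (\<forall>j. 0 < j \<and> j < n \<longrightarrow> (\<exists>i. (i, j) \<in> E)) \<and> 0 < n"

lemma symcl_iff: "(x, y) \<in> symcl E \<longleftrightarrow> (x, y) \<in> E \<or> (y, x) \<in> E"
  unfolding symcl_def by auto

lemma ascending_bounds:
  assumes "ascending n E" "(i, j) \<in> symcl E" shows "i < n" "j < n" "i \<noteq> j"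
  using assms unfolding ascending_def symcl_iff by fastforce+

lemma layout_arc_iff:
  assumes "layout f n E G" "ascending n E" "i < n" "j < n"
  shows "(f i, f j) \<in> parcs G \<longleftrightarrow> (i, j) \<in> symcl E"
proof
  assume "(f i, f j) \<in> parcs G"
  then obtain k l where kl: "(k, l) \<in> symcl E" "f i = f k" "f j = f l"
    using assms(1) unfolding layout_def by auto
  have "k < n" "l < n" using ascending_bounds[OF assms(2) kl(1)] by auto
  then have "i = k" "j = l" using kl assms by (auto simp: layout_def inj_on_def)
  then show "(i, j) \<in> symcl E" using kl by simp
next
  assume "(i, j) \<in> symcl E"
  then show "(f i, f j) \<in> parcs G" using assms(1) unfolding layout_def by force
qed

lemma layout_pair_graph:
  assumes l: "layout f n E G" and a: "ascending n E"
  shows "pair_graph G"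
proof -
  have fin: "finite E"
    by (rule finite_subset[of _ "{..<n} \<times> {..<n}"]) (use a in \<open>auto simp: ascending_def\<close>)
  have arc: "\<exists>i j. a = (f i, f j) \<and> (i, j) \<in> symcl E" if "a \<in> parcs G" for a
    using that l unfolding layout_def by auto
  have "symmetric (with_proj G)"
    unfolding symmetric_def using l by (auto simp: layout_def symcl_iff intro!: symI)
  moreover have "fst a \<noteq> snd a" if a': "a \<in> parcs G" for a
  proof -
    obtain i j where ij: "a = (f i, f j)" "(i, j) \<in> symcl E" using arc[OF a'] by auto
    then show ?thesis
      using l ascending_bounds[OF a ij(2)] inj_on_eq_iff[of f "{..<n}" i j] by (auto simp: layout_def)
  qed
  moreover have "fst a \<in> pverts G" "snd a \<in> pverts G" if a': "a \<in> parcs G" for a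
  proof -
    obtain i j where "a = (f i, f j)" "(i, j) \<in> symcl E" using arc[OF a'] by auto
    then show "fst a \<in> pverts G" "snd a \<in> pverts G"
      using l ascending_bounds[OF a] by (auto simp: layout_def)
  qed
  moreover have "finite (pverts G)" "finite (parcs G)"
    using l fin unfolding layout_def symcl_def by auto
  ultimately show ?thesis by unfold_locales auto
qed

lemma layout_connected_graph:
  assumes l: "layout f n E G" and a: "ascending n E"
  shows "connected_graph G"
proof -
  interpret pair_graph G using layout_pair_graph[OF assms] .
  have root: "(f 0, f j) \<in> rtrancl_on (pverts G) (symcl (parcs G))" if "j < n" for j
    using that
  proof (induction j rule: less_induct)
    case (less j)
    show ?case
    proof (cases "j = 0")
      case True
      then show ?thesis using less.prems l by (auto simp: layout_def)
    next
      case False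
      then obtain i where i: "(i, j) \<in> E" using a less.prems by (auto simp: ascending_def)
      then have ij: "i < j" using a by (auto simp: ascending_def)
      have "(f i, f j) \<in> symcl (parcs G)"
        using layout_arc_iff[OF l a, of i j] i ij less.prems by (simp add: symcl_iff)
      then show ?thesis using less.IH[OF ij] ij less.prems l
        by (auto simp: layout_def intro: rtrancl_on_into_rtrancl_on)
    qed
  qed
  have "sym (rtrancl_on (pverts G) (symcl (parcs G)))"
    by (rule rtrancl_on_sym) (auto intro!: symI simp: symcl_iff)
  then have conn: "(f i, f j) \<in> rtrancl_on (pverts G) (symcl (parcs G))" if "i < n" "j < n" for i j
    using root[OF that(1)] root[OF that(2)] by (meson rtrancl_on_trans symD)
  have "Digraph_Component.connected (with_proj G)"
    unfolding connected_conv using a l conn by (auto simp: ascending_def layout_def)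
  then show ?thesis by unfold_locales
qed

lemma layout_card_pverts: "layout f n E G \<Longrightarrow> card (pverts G) = n"
  unfolding layout_def by (simp add: card_image)

lemma layout_sum_arcs:
  fixes g :: "'a \<times> 'a \<Rightarrow> nat"
  assumes l: "layout f n E G" and a: "ascending n E"
  shows "sum g (parcs G) = (\<Sum>(i, j)\<in>E. g (f i, f j) + g (f j, f i))"
proof -
  have fin: "finite E"
    by (rule finite_subset[of _ "{..<n} \<times> {..<n}"]) (use a in \<open>auto simp: ascending_def\<close>)
  have "i < j" if "(i, j) \<in> E" for i j
    using a that by (auto simp: ascending_def)
  then have "(j, i) \<notin> E" if "(i, j) \<in> E" for i j
    using that less_asym by blast
  then have disj: "E \<inter> prod.swap ` E = {}" by auto
  have inj: "inj_on (map_prod f f) (symcl E)"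
    by (rule inj_on_subset[of _ "{..<n} \<times> {..<n}"])
      (use l ascending_bounds[OF a] in \<open>auto simp: layout_def intro: map_prod_inj_on\<close>)
  have "sum g (parcs G) = sum (g \<circ> map_prod f f) (symcl E)"
    using l inj by (simp add: layout_def sum.reindex)
  also have "symcl E = E \<union> prod.swap ` E" unfolding symcl_def by (auto simp: prod.swap_def case_prod_beta)
  also have "sum (g \<circ> map_prod f f) (E \<union> prod.swap ` E)
      = sum (g \<circ> map_prod f f) E + sum (g \<circ> map_prod f f) (prod.swap ` E)"
    using fin disj by (intro sum.union_disjoint) auto
  also have "sum (g \<circ> map_prod f f) (prod.swap ` E) = (\<Sum>e\<in>E. g (map_prod f f (prod.swap e)))"
    by (subst sum.reindex) auto
  finally show ?thesis by (simp add: sum.distrib case_prod_beta map_prod_def)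
qed

lemma layout_card_parcs:
  assumes "layout f n E G" "ascending n E"
  shows "card (parcs G) = 2 * card E"
  using layout_sum_arcs[OF assms, of "\<lambda>_. 1"] by (simp add: case_prod_beta)

lemma layout_degree:
  assumes l: "layout f n E G" and a: "ascending n E" and i: "i < n"
  shows "degree G (f i) = card {j. (i, j) \<in> symcl E}"
proof -
  interpret connected_graph G using layout_connected_graph[OF l a] .
  have "{y. (f i, y) \<in> parcs G} = f ` {j. (i, j) \<in> symcl E}"
  proof (intro set_eqI iffI)
    fix y assume y: "y \<in> {y. (f i, y) \<in> parcs G}"
    then have "y \<in> pverts G" using arc_ends(2) by auto
    then obtain j where "j < n" "y = f j" using l by (auto simp: layout_def)
    then show "y \<in> f ` {j. (i, j) \<in> symcl E}" using y layout_arc_iff[OF l a i] by auto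
  next
    fix y assume "y \<in> f ` {j. (i, j) \<in> symcl E}"
    then show "y \<in> {y. (f i, y) \<in> parcs G}"
      using layout_arc_iff[OF l a i] ascending_bounds[OF a] by auto
  qed
  moreover have "inj_on f {j. (i, j) \<in> symcl E}"
    by (rule inj_on_subset[of _ "{..<n}"]) (use l ascending_bounds[OF a] in \<open>auto simp: layout_def\<close>)
  ultimately show ?thesis unfolding degree_card_neighbours by (simp add: card_image)
qed

text \<open>The distance certificate transferred to labels. The condition \<open>lip\<close> is
  two-sided because \<open>E\<close> lists each edge in one direction only.\<close>

lemma layout_gdist:
  assumes l: "layout f n E G" and a: "ascending n E" and i: "i < n" and j: "j < n"
    and 0: "\<delta> i = 0"
    and lip: "\<And>u w. (u, w) \<in> E \<Longrightarrow> \<delta> w \<le> \<delta> u + 1 \<and> \<delta> u \<le> \<delta> w + 1"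
    and pred: "\<And>u. u < n \<Longrightarrow> u \<noteq> i \<Longrightarrow> \<exists>w. ((w, u) \<in> E \<or> (u, w) \<in> E) \<and> \<delta> u = \<delta> w + 1"
  shows "gdist G (f i) (f j) = \<delta> j"
proof -
  interpret connected_graph G using layout_connected_graph[OF l a] .
  define g where "g = the_inv_into {..<n} f"
  have g: "g (f k) = k" if "k < n" for k
    using that l unfolding g_def layout_def by (simp add: the_inv_into_f_f)
  have "gdist G (f i) (f j) = \<delta> (g (f j))"
  proof (rule gdist_eqI)
    show "f i \<in> pverts G" "f j \<in> pverts G" using i j l by (auto simp: layout_def)
    show "\<delta> (g (f i)) = 0" using g[OF i] 0 by simp
  next
    fix x y assume xy: "(x, y) \<in> parcs G"
    then obtain k m where km: "x = f k" "y = f m" "(k, m) \<in> symcl E"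
      using l by (auto simp: layout_def)
    then show "\<delta> (g y) \<le> \<delta> (g x) + 1"
      using lip g ascending_bounds[OF a km(3)] by (auto simp: symcl_iff)
  next
    fix x assume "x \<in> pverts G" "x \<noteq> f i"
    then obtain k where k: "k < n" "x = f k" "k \<noteq> i" using l by (auto simp: layout_def)
    obtain w where w: "(w, k) \<in> E \<or> (k, w) \<in> E" "\<delta> k = \<delta> w + 1" using pred k by blast
    then have wk: "(w, k) \<in> symcl E" by (simp add: symcl_iff)
    note b = ascending_bounds[OF a wk]
    have "(f w, x) \<in> parcs G" using layout_arc_iff[OF l a b(1,2)] wk k by simp
    then show "\<exists>y. (y, x) \<in> parcs G \<and> \<delta> (g x) = \<delta> (g y) + 1"
      using w(2) g b k by auto
  qed
  then show ?thesis using g[OF j] by simp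
qed

lemma layout_degree_distance:
  assumes l: "layout f n E G" and a: "ascending n E"
    and d: "\<And>i j. i < n \<Longrightarrow> j < n \<Longrightarrow> gdist G (f i) (f j) = \<delta> i j"
  shows "degree_distance G = (\<Sum>(i, j)\<in>E. (\<Sum>k<n. \<delta> i k) + (\<Sum>k<n. \<delta> j k))"
proof -
  interpret connected_graph G using layout_connected_graph[OF l a] .
  have D: "vertex_dist_sum G (f i) = (\<Sum>k<n. \<delta> i k)" if "i < n" for i
    unfolding vertex_dist_sum_def using l d that by (simp add: layout_def sum.reindex)
  have "degree_distance G = (\<Sum>a\<in>parcs G. vertex_dist_sum G (fst a))"
    unfolding degree_distance_def by (rule sum_degree_mult)
  also have "\<dots> = (\<Sum>(i, j)\<in>E. vertex_dist_sum G (f i) + vertex_dist_sum G (f j))"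
    by (simp add: layout_sum_arcs[OF l a])
  also have "\<dots> = (\<Sum>(i, j)\<in>E. (\<Sum>k<n. \<delta> i k) + (\<Sum>k<n. \<delta> j k))"
    by (rule sum.cong) (use D a in \<open>fastforce simp: ascending_def\<close>)+
  finally show ?thesis .
qed

lemma (in connected_graph) gdist_le_diameter:
  assumes "u \<in> pverts G" "v \<in> pverts G" shows "gdist G u v \<le> diameter G"
proof -
  have "{gdist G x y |x y. x \<in> pverts G \<and> y \<in> pverts G} = (\<lambda>(x, y). gdist G x y) ` (pverts G \<times> pverts G)"
    by auto
  then show ?thesis
    unfolding diameter_def using assms pair_finite_verts by (intro Max_ge) auto
qed

lemma (in connected_graph) diameter_attained:
  "\<exists>u\<in>pverts G. \<exists>v\<in>pverts G. gdist G u v = diameter G"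
proof -
  have eq: "{gdist G x y |x y. x \<in> pverts G \<and> y \<in> pverts G} = (\<lambda>(x, y). gdist G x y) ` (pverts G \<times> pverts G)"
    by auto
  have "diameter G \<in> (\<lambda>(x, y). gdist G x y) ` (pverts G \<times> pverts G)"
    unfolding diameter_def eq using pverts_nonempty pair_finite_verts by (intro Max_in) auto
  then obtain u v where "u \<in> pverts G" "v \<in> pverts G" "gdist G u v = diameter G" by auto
  then show ?thesis by blast
qed

lemma layout_unicyclic:
  assumes "layout f n E G" "ascending n E"
  shows "unicyclic G \<longleftrightarrow> card E = n"
proof -
  interpret connected_graph G using layout_connected_graph[OF assms] .
  show ?thesis
    using layout_card_parcs[OF assms] layout_card_pverts[OF assms(1)] unicyclic_iff by simp
qed

text \<open>A numbering composed with an isomorphism is again a numbering, and two numberings of the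
  same \<open>E\<close> compose to an isomorphism. All later work on isomorphism classes is thereby
  work on numberings.\<close>

lemma iso_copies_layout:
  assumes l: "layout f n E H" and a: "ascending n E"
  shows "iso_copies H = {G. \<exists>g. layout g n E G}"
proof (intro set_eqI iffI)
  fix G assume "G \<in> iso_copies H"
  then obtain hom where hom: "pre_digraph.digraph_isomorphism (with_proj G) hom"
      "with_proj H = app_iso hom (with_proj G)"
    by (auto simp: iso_copies_def digraph_iso_def)
  define h where "h = iso_verts hom"
  have inj: "inj_on h (pverts G)" and wf: "wf_digraph (with_proj G)"
    using hom(1) by (auto simp: pre_digraph.digraph_isomorphism_def h_def)
  have verts: "pverts H = h ` pverts G" and arcs: "parcs H = iso_arcs hom ` parcs G"
    and th: "iso_tail hom = fst" "iso_head hom = snd"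
    using hom(2) by (auto simp: app_iso_def with_proj_def h_def)
  have "iso_arcs hom x = map_prod h h x" if "x \<in> parcs G" for x
    using hom(1) that th by (auto simp: pre_digraph.digraph_isomorphism_def h_def prod_eq_iff)
  then have arcs: "parcs H = map_prod h h ` parcs G" using arcs by auto
  define k where "k = the_inv_into (pverts G) h"
  have kh: "k (h x) = x" if "x \<in> pverts G" for x
    unfolding k_def using inj that by (simp add: the_inv_into_f_f)
  have "pverts G = k ` pverts H" using verts kh by (simp add: image_image)
  moreover have "parcs G = map_prod k k ` parcs H"
  proof -
    have "map_prod k k (map_prod h h x) = x" if "x \<in> parcs G" for x
    proof -
      have "fst x \<in> pverts G" "snd x \<in> pverts G"
        using wf_digraph.wellformed[OF wf, of x] that by auto
      then show ?thesis using kh by (cases x) auto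
    qed
    then show ?thesis using arcs by (simp add: image_image)
  qed
  moreover have "inj_on k (pverts H)" unfolding verts using kh by (auto simp: inj_on_def)
  ultimately have "layout (k \<circ> f) n E G"
    using l unfolding layout_def
    by (simp add: image_image comp_inj_on prod.map_comp)
  then show "G \<in> {G. \<exists>g. layout g n E G}" by auto
next
  fix G assume "G \<in> {G. \<exists>g. layout g n E G}"
  then obtain g where g: "layout g n E G" by auto
  interpret pair_graph G using layout_pair_graph[OF g a] .
  define h where "h = f \<circ> the_inv_into {..<n} g"
  have hg: "h (g i) = f i" if "i < n" for i
    using g that by (simp add: h_def layout_def the_inv_into_f_f)
  have inj: "inj_on h (pverts G)"
    using g l hg by (auto simp: layout_def inj_on_def)
  have verts: "pverts H = h ` pverts G"
    using g l hg by (auto simp: layout_def image_image)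
  have arcs: "parcs H = map_prod h h ` parcs G"
  proof -
    have "map_prod h h (map_prod g g x) = map_prod f f x" if "x \<in> symcl E" for x
      using that ascending_bounds[OF a] hg by (cases x) auto
    then show ?thesis using g l by (auto simp: layout_def image_image)
  qed
  let ?hom = "\<lparr>iso_verts = h, iso_arcs = map_prod h h, iso_head = snd, iso_tail = fst\<rparr>"
  have "inj_on (map_prod h h) (parcs G)"
    by (rule inj_on_subset[of _ "pverts G \<times> pverts G"])
      (use inj arc_fst_in_verts arc_snd_in_verts in \<open>force intro: map_prod_inj_on\<close>)+
  then have "digraph_isomorphism ?hom"
    unfolding digraph_isomorphism_def using inj by (auto intro: wf_digraph)
  moreover have "with_proj H = app_iso ?hom (with_proj G)"
    using verts arcs by (simp add: app_iso_def with_proj_def)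
  ultimately show "G \<in> iso_copies H" by (auto simp: iso_copies_def digraph_iso_def)
qed

lemma layout_exists:
  assumes "inj_on f {..<n}" shows "\<exists>G. layout f n E G"
  using assms unfolding layout_def
  by (intro exI[of _ "\<lparr>pverts = f ` {..<n}, parcs = map_prod f f ` symcl E\<rparr>"]) simp

section \<open>A path with one ear and pendant vertices\<close>

definition adiff :: "nat \<Rightarrow> nat \<Rightarrow> nat" where
  "adiff i j = (i - j) + (j - i)"

lemma int_adiff: "int (adiff i j) = \<bar>int i - int j\<bar>"
  unfolding adiff_def by linarith

lemma adiff_Suc: "adiff (Suc i) j \<le> adiff i j + 1" "adiff i j \<le> adiff (Suc i) j + 1"
  "adiff i (Suc j) \<le> adiff i j + 1" "adiff i j \<le> adiff i (Suc j) + 1"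
  unfolding adiff_def by linarith+

text \<open>The transmission of vertex i in a path with d + 1 vertices.\<close>

definition path_sum :: "nat \<Rightarrow> nat \<Rightarrow> int" where
  "path_sum d i = (\<Sum>l\<le>d. int (adiff i l))"

text \<open>The square isolates the displacement of i from the centre of the path. Its minimum, 0 or
  1 by the parity of d, is the source of the parity distinctions below.\<close>

lemma path_sum_eq:
  assumes "i \<le> d"
  shows "4 * path_sum d i = (2 * int i - int d)\<^sup>2 + (int d)\<^sup>2 + 2 * int d"
  using assms
proof (induction d)
  case (Suc d)
  show ?case
  proof (cases "i = Suc d")
    case True
    have "2 * (\<Sum>l\<le>m. int m - int l) = int m * (int m + 1)" for m
      by (induction m) (auto simp: sum_subtractf algebra_simps)
    moreover have "path_sum (Suc d) i = (\<Sum>l\<le>Suc d. int (Suc d) - int l)"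
      unfolding path_sum_def True by (intro sum.cong) (auto simp: int_adiff)
    ultimately have "2 * path_sum (Suc d) i = int (Suc d) * (int (Suc d) + 1)" by metis
    then show ?thesis unfolding True by (simp add: power2_eq_square algebra_simps)
  next
    case False
    have "path_sum (Suc d) i = path_sum d i + (int (Suc d) - int i)"
      using Suc.prems unfolding path_sum_def by (simp add: int_adiff)
    then show ?thesis using Suc False by (simp add: power2_eq_square algebra_simps)
  qed
qed (simp add: path_sum_def adiff_def)

text \<open>The left-hand sum runs over ordered pairs: twice the Wiener index of the path.\<close>

lemma sum_path_sum: "3 * (\<Sum>i\<le>d. path_sum d i) = int d * (int d + 1) * (int d + 2)"
proof (induction d)
  case (Suc d)
  have s: "2 * path_sum (Suc d) (Suc d) = int (Suc d) * (int (Suc d) + 1)"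
    using path_sum_eq[of "Suc d" "Suc d"] by (simp add: power2_eq_square algebra_simps)
  have "(\<Sum>i\<le>d. int (adiff i (Suc d))) = path_sum (Suc d) (Suc d)"
    unfolding path_sum_def by (simp add: adiff_def add.commute)
  moreover have "(\<Sum>i\<le>d. path_sum (Suc d) i) = (\<Sum>i\<le>d. path_sum d i + int (adiff i (Suc d)))"
    by (intro sum.cong) (auto simp: path_sum_def)
  ultimately have "(\<Sum>i\<le>Suc d. path_sum (Suc d) i) = (\<Sum>i\<le>d. path_sum d i) + 2 * path_sum (Suc d) (Suc d)"
    by (simp add: sum.distrib)
  then show ?case using Suc s by (simp add: algebra_simps)
qed (simp add: path_sum_def adiff_def)

lemma sum_path_edges:
  fixes g :: "nat \<Rightarrow> int"
  shows "(\<Sum>i<d. g i + g (Suc i)) = 2 * (\<Sum>i\<le>d. g i) - g 0 - g d"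
  by (induction d) auto

text \<open>A path \<open>0, \<dots>, d\<close>, one further vertex \<open>d + 1\<close> joined to \<open>a\<close> and \<open>b\<close>, and pendant vertices
  \<open>j \<ge> d + 2\<close> attached at \<open>c j\<close>.\<close>

definition base_edges :: "nat \<Rightarrow> nat \<Rightarrow> nat \<Rightarrow> (nat \<times> nat) set" where
  "base_edges d a b = (\<lambda>i. (i, Suc i)) ` {..<d} \<union> {(a, d + 1), (b, d + 1)}"

definition ear_edges :: "nat \<Rightarrow> nat \<Rightarrow> nat \<Rightarrow> nat \<Rightarrow> (nat \<Rightarrow> nat) \<Rightarrow> (nat \<times> nat) set" where
  "ear_edges n d a b c = base_edges d a b \<union> (\<lambda>j. (c j, j)) ` {d + 2..<n}"

text \<open>The conditions describe a diametral path with pendant ends: neither end carries the ear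
  or a pendant vertex, and b \<le> a + 2 keeps the ear from shortening the path. The cycle is a
  triangle for b = a + 1 and a square for b = a + 2. A pendant vertex may also hang at the ear
  vertex d + 1.\<close>

locale ear =
  fixes n d a b :: nat and c :: "nat \<Rightarrow> nat"
  assumes a: "1 \<le> a" "a < b" "b \<le> a + 2" "b < d" and n: "d + 2 \<le> n"
    and c: "\<And>j. d + 2 \<le> j \<Longrightarrow> j < n \<Longrightarrow> 1 \<le> c j \<and> c j \<noteq> d \<and> c j \<le> d + 1"
begin

abbreviation "E \<equiv> ear_edges n d a b c"
abbreviation "B \<equiv> base_edges d a b"
abbreviation "J \<equiv> {d + 2..<n}"

text \<open>Distances in the base graph on 0, ..., d + 1. The last branch is meant for i = j = d +
  1.\<close>

definition bd :: "nat \<Rightarrow> nat \<Rightarrow> nat" where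
  "bd i j = (if i \<le> d then if j \<le> d then adiff i j else 1 + min (adiff i a) (adiff i b)
             else if j \<le> d then 1 + min (adiff j a) (adiff j b) else 0)"

definition foot :: "nat \<Rightarrow> nat" where
  "foot i = (if i \<le> d + 1 then i else c i)"

text \<open>The diagonal is separate because the formula through the feet would put a pendant vertex
  at distance 2 from itself.\<close>

definition ed :: "nat \<Rightarrow> nat \<Rightarrow> nat" where
  "ed i j = (if i = j then 0
     else bd (foot i) (foot j) + (if i \<le> d + 1 then 0 else 1) + (if j \<le> d + 1 then 0 else 1))"

section \<open>Verification of the distances\<close>

lemma bd_self [simp]: "bd i i = 0"
  unfolding bd_def adiff_def by auto

lemma bd_sym: "bd i j = bd j i"
  unfolding bd_def adiff_def by auto

lemma bd_eq_0: "i \<le> d + 1 \<Longrightarrow> j \<le> d + 1 \<Longrightarrow> bd i j = 0 \<longleftrightarrow> i = j"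
  unfolding bd_def adiff_def by auto

lemma ed_base: "j \<le> d + 1 \<Longrightarrow> ed i j = bd (foot i) j + (if i \<le> d + 1 then 0 else 1)"
  unfolding ed_def foot_def by auto

lemma ed_pendant: "d + 2 \<le> j \<Longrightarrow> j < n \<Longrightarrow> i \<noteq> j \<Longrightarrow> ed i j = ed i (c j) + 1"
  using c[of j] unfolding ed_def foot_def by auto

lemma ed_sym: "ed i j = ed j i"
  unfolding ed_def using bd_sym by auto

lemma base_edge_cases:
  assumes "(u, w) \<in> B"
  obtains "w = Suc u" "u < d" | "u = a" "w = d + 1" | "u = b" "w = d + 1"
  using assms unfolding base_edges_def by auto

lemma bd_lip:
  assumes "(u, w) \<in> B" "p \<le> d + 1"
  shows "bd p w \<le> bd p u + 1" "bd p u \<le> bd p w + 1"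
proof -
  have "bd p w \<le> bd p u + 1 \<and> bd p u \<le> bd p w + 1"
    using assms(1)
  proof (cases rule: base_edge_cases)
    case 1
    then show ?thesis
      using adiff_Suc(1,2)[of u a] adiff_Suc(1,2)[of u b] adiff_Suc(3,4)[of p u]
      by (cases "p \<le> d") (simp_all add: bd_def, linarith)
  next
    case 2
    \<comment> \<open>As b - a \<le> 2, reaching a along the path is never longer than reaching it
      through b and the ear.\<close>
    have "adiff p a \<le> adiff p b + 2" "adiff a a = 0" unfolding adiff_def using a by linarith+
    then show ?thesis using 2 a assms(2) by (cases "p \<le> d") (auto simp: bd_def min_def)
  next
    case 3
    have "adiff p b \<le> adiff p a + 2" "adiff b b = 0" unfolding adiff_def using a by linarith+
    then show ?thesis using 3 a assms(2) by (cases "p \<le> d") (auto simp: bd_def min_def)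
  qed
  then show "bd p w \<le> bd p u + 1" "bd p u \<le> bd p w + 1" by auto
qed

lemma bd_pred:
  assumes "p \<le> d + 1" "u \<le> d + 1" "p \<noteq> u"
  shows "\<exists>w\<le>d + 1. ((w, u) \<in> B \<or> (u, w) \<in> B) \<and> bd p u = bd p w + 1"
proof -
  have e: "(i, Suc i) \<in> B" if "i < d" for i using that unfolding base_edges_def by auto
  have x: "(a, d + 1) \<in> B" "(b, d + 1) \<in> B" unfolding base_edges_def by auto
  show ?thesis
  proof (cases "p \<le> d")
    case p: True
    show ?thesis
    proof (cases "u \<le> d")
      case u: True
      show ?thesis
      proof (cases "u < p")
        case True
        then show ?thesis using p u e[of u] by (intro exI[of _ "Suc u"]) (auto simp: bd_def adiff_def)
      next
        case False
        then show ?thesis using p u assms e[of "u - 1"]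
          by (intro exI[of _ "u - 1"]) (auto simp: bd_def adiff_def)
      qed
    next
      case False
      then have u: "u = d + 1" using assms by simp
      show ?thesis
      proof (cases "adiff p a \<le> adiff p b")
        case True
        then show ?thesis using p u x a by (intro exI[of _ a]) (simp add: bd_def)
      next
        case False
        then show ?thesis using p u x a by (intro exI[of _ b]) (simp add: bd_def)
      qed
    qed
  next
    case False
    then have p: "p = d + 1" and u: "u \<le> d" using assms by auto
    consider "u = a" | "u = b" | "u < a" | "u > b" | "u = a + 1" "b = a + 2" using a by linarith
    then show ?thesis
    proof cases
      case 1
      then show ?thesis using p x a by (intro exI[of _ "d + 1"]) (auto simp: bd_def adiff_def)
    next
      case 2
      then show ?thesis using p x a by (intro exI[of _ "d + 1"]) (auto simp: bd_def adiff_def)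
    next
      case 3
      then show ?thesis using p u a e[of u] by (intro exI[of _ "Suc u"]) (auto simp: bd_def adiff_def)
    next
      case 4
      then show ?thesis using p u a e[of "u - 1"]
        by (intro exI[of _ "u - 1"]) (auto simp: bd_def adiff_def)
    next
      case 5
      then have "(a, u) \<in> B" using e[of a] a by simp
      moreover have "bd p u = bd p a + 1" unfolding bd_def adiff_def using 5 p a by auto
      ultimately show ?thesis using a by (intro exI[of _ a]) auto
    qed
  qed
qed

lemma ascending_E: "ascending n E"
proof -
  have "i < j \<and> j < n" if "(i, j) \<in> E" for i j
    using that a n c unfolding ear_edges_def base_edges_def by fastforce
  moreover have "\<exists>i. (i, j) \<in> E" if "0 < j" "j < n" for j
  proof -
    have "j \<le> d \<or> j = d + 1 \<or> j \<in> J" using that by auto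
    then consider "j \<le> d" | "j = d + 1" | "j \<in> J" by blast
    then show ?thesis
    proof cases
      case 1
      then have "(j - 1, j) \<in> E" using that unfolding ear_edges_def base_edges_def
        by (auto intro!: image_eqI[of _ _ "j - 1"])
      then show ?thesis by blast
    next
      case 3
      then have "(c j, j) \<in> E" unfolding ear_edges_def by auto
      then show ?thesis by blast
    qed (auto simp: ear_edges_def base_edges_def)
  qed
  ultimately show ?thesis using n unfolding ascending_def by auto
qed

lemma finite_B: "finite B" unfolding base_edges_def by simp

lemma sum_B:
  fixes g :: "nat \<Rightarrow> int"
  shows "(\<Sum>(u, w)\<in>B. g u + g w)
    = 2 * (\<Sum>i\<le>d. g i) - g 0 - g d + g a + g b + 2 * g (d + 1)"
proof -
  let ?f = "\<lambda>(u, w). g u + g w"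
  have "sum ?f B = sum ?f ((\<lambda>i. (i, Suc i)) ` {..<d}) + sum ?f {(a, d + 1), (b, d + 1)}"
    unfolding base_edges_def by (intro sum.union_disjoint) auto
  also have "sum ?f ((\<lambda>i. (i, Suc i)) ` {..<d}) = (\<Sum>i<d. g i + g (Suc i))"
    by (subst sum.reindex) (auto simp: inj_on_def)
  also have "sum ?f {(a, d + 1), (b, d + 1)} = g a + g b + 2 * g (d + 1)"
    using a by simp
  finally show ?thesis by (simp add: sum_path_edges)
qed

lemma card_B: "card B = d + 2"
proof -
  have "card B = card ((\<lambda>i. (i, Suc i)) ` {..<d}) + card {(a, d + 1), (b, d + 1)}"
    unfolding base_edges_def by (intro card_Un_disjoint) auto
  then show ?thesis using a by (simp add: card_image inj_on_def)
qed

lemma sum_E: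
  fixes g :: "nat \<times> nat \<Rightarrow> 'b::comm_monoid_add"
  shows "sum g E = sum g B + (\<Sum>j\<in>J. g (c j, j))"
proof -
  have "sum g E = sum g B + sum g ((\<lambda>j. (c j, j)) ` J)"
    unfolding ear_edges_def using finite_B
    by (intro sum.union_disjoint) (auto simp: base_edges_def)
  also have "sum g ((\<lambda>j. (c j, j)) ` J) = (\<Sum>j\<in>J. g (c j, j))"
    by (subst sum.reindex) (auto simp: inj_on_def)
  finally show ?thesis .
qed

lemma card_E: "card E = n"
  using sum_E[of "\<lambda>_. 1 :: nat"] card_B n by simp

lemma gdist_ear:
  assumes l: "layout f n E G" and ij: "i < n" "j < n"
  shows "gdist G (f i) (f j) = ed i j"
proof (rule layout_gdist[OF l ascending_E ij])
  show "ed i i = 0" by (simp add: ed_def)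
  have foot_i: "foot i \<le> d + 1" using c[of i] ij unfolding foot_def by auto
  fix u w assume uw: "(u, w) \<in> E"
  show "ed i w \<le> ed i u + 1 \<and> ed i u \<le> ed i w + 1"
  proof (cases "(u, w) \<in> B")
    case True
    then have "u \<le> d + 1" "w \<le> d + 1" using a by (auto elim: base_edge_cases)
    then show ?thesis using bd_lip[OF True foot_i] by (simp add: ed_base)
  next
    case False
    then have w: "w \<in> J" "u = c w" using uw unfolding ear_edges_def by auto
    show ?thesis
    proof (cases "i = w")
      case True
      then show ?thesis using w c[of w] by (auto simp: ed_def foot_def)
    next
      case False
      then show ?thesis using w ed_pendant[of w i] by auto
    qed
  qed
next
  have foot_i: "foot i \<le> d + 1" using c[of i] ij unfolding foot_def by auto
  fix u assume u: "u < n" "u \<noteq> i"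
  show "\<exists>w. ((w, u) \<in> E \<or> (u, w) \<in> E) \<and> ed i u = ed i w + 1"
  proof (cases "u \<le> d + 1")
    case False
    then show ?thesis using u ed_pendant[of u i] unfolding ear_edges_def
      by (intro exI[of _ "c u"]) auto
  next
    case ub: True
    show ?thesis
    proof (cases "foot i = u")
      case True
      then have i: "i \<in> J" "c i = u" using u ij unfolding foot_def by (auto split: if_splits)
      then show ?thesis using ub unfolding ear_edges_def
        by (intro exI[of _ i]) (auto simp: ed_def foot_def)
    next
      case False
      obtain w where w: "w \<le> d + 1" "(w, u) \<in> B \<or> (u, w) \<in> B" "bd (foot i) u = bd (foot i) w + 1"
        using bd_pred[OF foot_i ub False] by blast
      then have "ed i u = ed i w + 1" using ub by (simp add: ed_base)
      then show ?thesis using w(2) unfolding ear_edges_def by blast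
    qed
  qed
qed

text \<open>\<open>\<tau>\<close> is the transmission in the base graph, \<open>\<rho>\<close> the
  same sum weighted with base degrees, \<open>\<phi> i\<close> the part of the cost of a pendant
  vertex at i that depends on i alone, and \<open>K\<close> the degree distance of the base
  graph.\<close>

definition \<tau> :: "nat \<Rightarrow> int" where "\<tau> i = (\<Sum>k\<le>d + 1. int (bd i k))"
definition \<rho> :: "nat \<Rightarrow> int" where "\<rho> i = (\<Sum>(u, w)\<in>B. int (bd u i) + int (bd w i))"
definition \<phi> :: "nat \<Rightarrow> int" where "\<phi> i = 2 * \<tau> i + \<rho> i"
definition K :: int where "K = (\<Sum>(u, w)\<in>B. \<tau> u + \<tau> w)"

lemma transmission_base:
  assumes "i \<le> d + 1"
  shows "(\<Sum>k<n. int (ed i k)) = \<tau> i + (\<Sum>j\<in>J. int (bd i (c j)) + 1)"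
proof -
  have split: "{..<n} = {..d + 1} \<union> J" using n by auto
  have "(\<Sum>k<n. int (ed i k)) = (\<Sum>k\<le>d + 1. int (ed i k)) + (\<Sum>j\<in>J. int (ed i j))"
    unfolding split by (intro sum.union_disjoint) auto
  moreover have "(\<Sum>k\<le>d + 1. int (ed i k)) = \<tau> i"
    unfolding \<tau>_def using assms by (intro sum.cong) (auto simp: ed_base foot_def)
  moreover have "(\<Sum>j\<in>J. int (ed i j)) = (\<Sum>j\<in>J. int (bd i (c j)) + 1)"
    using assms c by (intro sum.cong refl) (auto simp: ed_def foot_def)
  ultimately show ?thesis by simp
qed

text \<open>Passing from the foot to the pendant vertex adds one to the distance to each of the n -
  2 other vertices; the distance between the two is 1 from either side.\<close>

lemma transmission_pendant:
  assumes "j \<in> J"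
  shows "(\<Sum>k<n. int (ed j k)) = (\<Sum>k<n. int (ed (c j) k)) + int n - 2"
proof -
  have j: "j < n" "d + 2 \<le> j" using assms by auto
  have 1: "ed j k = ed (c j) k + 1" if "k \<noteq> j" for k
    using ed_pendant[of j k] that j ed_sym by metis
  have 2: "ed (c j) j = 1" using c[of j] j by (auto simp: ed_def foot_def)
  have "(\<Sum>k<n. int (ed j k)) = (\<Sum>k\<in>{..<n} - {j}. int (ed j k))"
    using j by (subst sum.remove[of _ j]) (auto simp: ed_def)
  also have "\<dots> = (\<Sum>k\<in>{..<n} - {j}. int (ed (c j) k) + 1)"
    by (intro sum.cong) (auto simp: 1)
  also have "\<dots> = (\<Sum>k\<in>{..<n} - {j}. int (ed (c j) k)) + int (n - 1)"
    using j by (simp add: sum.distrib)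
  also have "(\<Sum>k\<in>{..<n} - {j}. int (ed (c j) k)) = (\<Sum>k<n. int (ed (c j) k)) - 1"
    using j 2 by (subst (2) sum.remove[of _ j]) auto
  finally show ?thesis using j by simp
qed

text \<open>The degree distance is the sum over edges of the transmissions of both ends. Base edges
  see a pendant vertex through \<open>\<rho>\<close>; a pendant edge sees the base through 2
  \<open>\<tau>\<close> and the other pendant vertices through \<open>bd\<close>. Positions thus
  enter through \<open>K\<close>, through each foot separately, and through the distances between
  feet, which vanish when all feet coincide.\<close>

lemma degree_distance_ear:
  assumes l: "layout f n E G"
  defines "h \<equiv> int n - int d - 2"
  shows "int (degree_distance G) = K + (\<Sum>j\<in>J. \<phi> (c j))
    + 2 * (\<Sum>j\<in>J. \<Sum>j'\<in>J. int (bd (c j) (c j'))) + h * (2 * (int d + 2) + int n - 2) + 2 * h * h"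
proof -
  let ?D = "\<lambda>i. \<Sum>k<n. int (ed i k)"
  have h: "int (card J) = h" using n unfolding h_def by simp
  have "degree_distance G = (\<Sum>(i, j)\<in>E. (\<Sum>k<n. ed i k) + (\<Sum>k<n. ed j k))"
    by (rule layout_degree_distance[OF l ascending_E]) (rule gdist_ear[OF l])
  then have "int (degree_distance G) = (\<Sum>(i, j)\<in>E. ?D i + ?D j)"
    by (simp add: case_prod_beta)
  also have "\<dots> = (\<Sum>(i, j)\<in>B. ?D i + ?D j) + (\<Sum>j\<in>J. ?D (c j) + ?D j)"
    by (subst sum_E) simp
  also have "(\<Sum>j\<in>J. ?D (c j) + ?D j)
      = (\<Sum>j\<in>J. 2 * \<tau> (c j) + (2 * (\<Sum>j'\<in>J. int (bd (c j) (c j'))) + (2 * h + int n - 2)))"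
  proof (rule sum.cong)
    fix j assume j: "j \<in> J"
    then have "c j \<le> d + 1" using c by auto
    then show "?D (c j) + ?D j = 2 * \<tau> (c j) + (2 * (\<Sum>j'\<in>J. int (bd (c j) (c j'))) + (2 * h + int n - 2))"
      using h by (simp add: transmission_pendant[OF j] transmission_base sum.distrib)
  qed simp
  also have "(\<Sum>(i, j)\<in>B. ?D i + ?D j)
      = (\<Sum>(u, w)\<in>B. (\<tau> u + \<tau> w) + (\<Sum>j\<in>J. int (bd u (c j)) + int (bd w (c j)) + 2))"
  proof (rule sum.cong)
    fix e assume "e \<in> B"
    then obtain u w where "e = (u, w)" "u \<le> d + 1" "w \<le> d + 1"
      using a by (cases e) (auto elim: base_edge_cases)
    then show "(case e of (i, j) \<Rightarrow> ?D i + ?D j)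
      = (case e of (u, w) \<Rightarrow> (\<tau> u + \<tau> w) + (\<Sum>j\<in>J. int (bd u (c j)) + int (bd w (c j)) + 2))"
      by (simp add: transmission_base sum.distrib)
  qed simp
  also have "\<dots> = K + (\<Sum>e\<in>B. \<Sum>j\<in>J. int (bd (fst e) (c j)) + int (bd (snd e) (c j)) + 2)"
    unfolding K_def by (simp add: case_prod_beta sum.distrib)
  also have "(\<Sum>e\<in>B. \<Sum>j\<in>J. int (bd (fst e) (c j)) + int (bd (snd e) (c j)) + 2)
      = (\<Sum>j\<in>J. \<Sum>e\<in>B. int (bd (fst e) (c j)) + int (bd (snd e) (c j)) + 2)"
    by (rule sum.swap)
  also have "\<dots> = (\<Sum>j\<in>J. \<rho> (c j) + 2 * (int d + 2))"
    unfolding \<rho>_def by (simp add: case_prod_beta sum.distrib card_B)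
  finally show ?thesis
    using h by (simp add: \<phi>_def sum.distrib sum_subtractf sum_distrib_left algebra_simps)
qed

section \<open>Closed forms for triangle and square\<close>

definition min_ab :: "nat \<Rightarrow> int" where "min_ab i = min \<bar>int i - int a\<bar> \<bar>int i - int b\<bar>"

lemma bd_path: "i \<le> d \<Longrightarrow> l \<le> d \<Longrightarrow> int (bd i l) = \<bar>int i - int l\<bar>"
  by (simp add: bd_def int_adiff)

lemma bd_x: "i \<le> d \<Longrightarrow> int (bd i (Suc d)) = 1 + min_ab i" "i \<le> d \<Longrightarrow> int (bd (Suc d) i) = 1 + min_ab i"
  by (simp_all add: bd_def min_ab_def flip: int_adiff)

lemma \<tau>_path: "i \<le> d \<Longrightarrow> \<tau> i = path_sum d i + 1 + min_ab i"
  unfolding \<tau>_def path_sum_def by (simp add: bd_x bd_path int_adiff)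

lemma \<rho>_path:
  assumes "i \<le> d"
  shows "\<rho> i = 2 * path_sum d i - int d + \<bar>int i - int a\<bar> + \<bar>int i - int b\<bar> + 2 + 2 * min_ab i"
proof -
  have "\<rho> i = 2 * (\<Sum>u\<le>d. int (bd u i)) - int (bd 0 i) - int (bd d i) + int (bd a i) + int (bd b i)
      + 2 * int (bd (d + 1) i)"
    unfolding \<rho>_def by (rule sum_B)
  moreover have "(\<Sum>u\<le>d. int (bd u i)) = path_sum d i"
    unfolding path_sum_def using assms by (intro sum.cong) (auto simp: bd_path int_adiff)
  ultimately show ?thesis using assms a by (simp add: bd_path bd_x)
qed

lemma \<tau>_x: "\<tau> (Suc d) = (\<Sum>i\<le>d. 1 + min_ab i)"
  unfolding \<tau>_def by (simp add: bd_x cong: sum.cong_simp)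

lemma \<rho>_x: "\<rho> (Suc d) = 2 * \<tau> (Suc d) - int a - int d + int b"
proof -
  have "\<rho> (Suc d) = 2 * (\<Sum>u\<le>d. int (bd u (Suc d))) - int (bd 0 (Suc d)) - int (bd d (Suc d))
      + int (bd a (Suc d)) + int (bd b (Suc d)) + 2 * int (bd (d + 1) (Suc d))"
    unfolding \<rho>_def by (rule sum_B)
  moreover have "(\<Sum>u\<le>d. int (bd u (Suc d))) = \<tau> (Suc d)"
    unfolding \<tau>_x by (intro sum.cong) (auto simp: bd_x)
  ultimately show ?thesis using a by (simp add: bd_x min_ab_def)
qed

text \<open>Exchanging the two sums turns \<open>K\<close> into the sum of \<open>\<rho>\<close>
  over the base vertices, for which closed forms are at hand.\<close>

lemma K_eq: "K = 2 * (\<Sum>i\<le>d. path_sum d i) - int d * (int d + 1) + path_sum d a + path_sum d b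
    + 4 * \<tau> (Suc d) - int a - int d + int b"
proof -
  have "K = (\<Sum>e\<in>B. \<Sum>k\<le>d + 1. int (bd (fst e) k) + int (bd (snd e) k))"
    unfolding K_def \<tau>_def by (simp add: case_prod_beta sum.distrib)
  also have "\<dots> = (\<Sum>k\<le>d + 1. \<Sum>e\<in>B. int (bd (fst e) k) + int (bd (snd e) k))"
    by (rule sum.swap)
  also have "\<dots> = (\<Sum>k\<le>d + 1. \<rho> k)"
    unfolding \<rho>_def by (simp add: case_prod_beta)
  also have "\<dots> = (\<Sum>i\<le>d. \<rho> i) + \<rho> (Suc d)" by simp
  also have "(\<Sum>i\<le>d. \<rho> i) = (\<Sum>i\<le>d. 2 * path_sum d i - int d + \<bar>int i - int a\<bar> + \<bar>int i - int b\<bar> + 2 + 2 * min_ab i)"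
    by (intro sum.cong) (auto simp: \<rho>_path)
  also have "\<dots> = 2 * (\<Sum>i\<le>d. path_sum d i) - int d * (int d + 1) + path_sum d a + path_sum d b + 2 * \<tau> (Suc d)"
    unfolding \<tau>_x path_sum_def[of d a] path_sum_def[of d b] int_adiff
    by (simp add: sum.distrib sum_subtractf abs_minus_commute algebra_simps flip: sum_distrib_left)
  finally show ?thesis by (simp add: \<rho>_x)
qed

text \<open>With a and b adjacent, 2 \<open>min_ab i\<close> + 1 is the sum of the distances from i
  to a and to b, so sums over the ear reduce to two path sums.\<close>

lemma triangle:
  assumes "b = a + 1"
  shows "2 * \<tau> (Suc d) = path_sum d a + path_sum d b + int d + 1"
    and "i \<le> d \<Longrightarrow> \<phi> i = 4 * path_sum d i + 5 - int d + 6 * min_ab i"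
    and "\<phi> (Suc d) = 2 * (path_sum d a + path_sum d b) + int d + 3"
    and "K = 2 * (\<Sum>i\<le>d. path_sum d i) - int d * (int d + 2) + 3 * (path_sum d a + path_sum d b) + 2 * int d + 3"
proof -
  have ib: "int b = int a + 1" using assms by simp
  have e: "2 * min_ab i + 1 = \<bar>int a - int i\<bar> + \<bar>int b - int i\<bar>" for i
    unfolding min_ab_def using assms by (cases "i \<le> a") (auto simp: min_def)
  have "2 * \<tau> (Suc d) = (\<Sum>i\<le>d. (2 * min_ab i + 1) + 1)"
    unfolding \<tau>_x by (simp add: sum_distrib_left algebra_simps)
  then show x: "2 * \<tau> (Suc d) = path_sum d a + path_sum d b + int d + 1"
    unfolding e path_sum_def int_adiff by (simp add: sum.distrib)
  show "\<phi> i = 4 * path_sum d i + 5 - int d + 6 * min_ab i" if "i \<le> d"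
    using e[of i] that by (simp add: \<phi>_def \<tau>_path \<rho>_path abs_minus_commute)
  show "\<phi> (Suc d) = 2 * (path_sum d a + path_sum d b) + int d + 3"
    using x ib unfolding \<phi>_def \<rho>_x by simp
  show "K = 2 * (\<Sum>i\<le>d. path_sum d i) - int d * (int d + 2) + 3 * (path_sum d a + path_sum d b) + 2 * int d + 3"
    using x ib unfolding K_eq by (simp add: algebra_simps)
qed

text \<open>In a square the ear vertex is a twin of a + 1: both have the same distance to every
  other base vertex, and their mutual distance is 2. This accounts for the corrections at
  \<open>Suc a\<close>.\<close>

lemma square:
  assumes "b = a + 2"
  shows "\<tau> (Suc d) = path_sum d (Suc a) + 2"
    and "i \<le> d \<Longrightarrow> i \<noteq> Suc a \<Longrightarrow> \<phi> i = 4 * path_sum d i + 6 * \<bar>int i - int (Suc a)\<bar> - int d"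
    and "\<phi> (Suc a) = 4 * path_sum d (Suc a) + 10 - int d"
    and "\<phi> (Suc d) = 4 * path_sum d (Suc a) + 10 - int d"
    and "K = 2 * (\<Sum>i\<le>d. path_sum d i) - int d * (int d + 2) + 6 * path_sum d (Suc a) + 12"
proof -
  have ib: "int b = int a + 2" using assms by simp
  have e: "1 + min_ab i = \<bar>int (Suc a) - int i\<bar>" if "i \<noteq> Suc a" for i
    using that unfolding min_ab_def using assms by auto
  have e': "min_ab (Suc a) = 1" unfolding min_ab_def using assms by auto
  have "\<tau> (Suc d) = (\<Sum>i\<in>{..d} - {Suc a}. 1 + min_ab i) + 2"
    unfolding \<tau>_x using a by (subst sum.remove[of _ "Suc a"]) (auto simp: e')
  also have "(\<Sum>i\<in>{..d} - {Suc a}. 1 + min_ab i) = (\<Sum>i\<in>{..d} - {Suc a}. \<bar>int (Suc a) - int i\<bar>)"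
    by (intro sum.cong) (auto simp: e)
  also have "\<dots> = path_sum d (Suc a)"
    unfolding path_sum_def int_adiff using a by (subst (2) sum.remove[of _ "Suc a"]) auto
  finally show x: "\<tau> (Suc d) = path_sum d (Suc a) + 2" .
  show "\<phi> i = 4 * path_sum d i + 6 * \<bar>int i - int (Suc a)\<bar> - int d" if "i \<le> d" "i \<noteq> Suc a"
  proof -
    have "\<bar>int i - int a\<bar> + \<bar>int i - int b\<bar> = 2 * \<bar>int i - int (Suc a)\<bar>"
      using assms that(2) by (cases "i \<le> a") auto
    then show ?thesis
      using e[OF that(2)] abs_minus_commute[of "int (Suc a)" "int i"]
      unfolding \<phi>_def \<tau>_path[OF that(1)] \<rho>_path[OF that(1)] by (simp del: of_nat_Suc)
  qed
  have le: "Suc a \<le> d" using a by simp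
  show "\<phi> (Suc a) = 4 * path_sum d (Suc a) + 10 - int d"
    using ib e' unfolding \<phi>_def \<tau>_path[OF le] \<rho>_path[OF le] by simp
  show "\<phi> (Suc d) = 4 * path_sum d (Suc a) + 10 - int d"
    using x ib unfolding \<phi>_def \<rho>_x by simp
  \<comment> \<open>Path sums are quadratic in the position, with second difference 2.\<close>
  have "path_sum d a + path_sum d b = 2 * path_sum d (Suc a) + 2"
    using path_sum_eq[of a d] path_sum_eq[of b d] path_sum_eq[of "Suc a" d] a assms
    by (simp add: power2_eq_square algebra_simps)
  then show "K = 2 * (\<Sum>i\<le>d. path_sum d i) - int d * (int d + 2) + 6 * path_sum d (Suc a) + 12"
    using x ib unfolding K_eq by (simp add: algebra_simps)
qed

end

section \<open>Graphs of diameter \<open>n - p\<close>\<close>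

context connected_graph begin

text \<open>Prescribing all mutual distances, not just consecutive arcs, gives injectivity and the
  absence of chords at once.\<close>

definition geodesic :: "(nat \<Rightarrow> 'a) \<Rightarrow> nat \<Rightarrow> bool" where
  "geodesic u d \<longleftrightarrow> (\<forall>i\<le>d. u i \<in> pverts G) \<and> (\<forall>i\<le>d. \<forall>j\<le>d. gdist G (u i) (u j) = adiff i j)"

lemma geodesic_ex:
  assumes "x \<in> pverts G" "y \<in> pverts G"
  shows "\<exists>u. geodesic u (gdist G x y)"
proof -
  have "\<exists>u. (\<forall>i\<le>k. u i \<in> pverts G \<and> gdist G x (u i) = i) \<and> (\<forall>i<k. (u i, u (Suc i)) \<in> parcs G)"
    if "y \<in> pverts G" "gdist G x y = k" for y k
  proof -
    have "\<exists>u. u k = y \<and> (\<forall>i\<le>k. u i \<in> pverts G \<and> gdist G x (u i) = i) \<and> (\<forall>i<k. (u i, u (Suc i)) \<in> parcs G)"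
      using that
    proof (induction k arbitrary: y)
      case 0
      then show ?case by (intro exI[of _ "\<lambda>_. y"]) auto
    next
      case (Suc k)
      then have "x \<noteq> y" using assms(1) by auto
      then obtain w where w: "(w, y) \<in> parcs G" "gdist G x w = k"
        using gdist_pred[OF assms(1) Suc.prems(1)] Suc.prems(2) by auto
      then obtain u where u: "u k = w" "\<forall>i\<le>k. u i \<in> pverts G \<and> gdist G x (u i) = i"
          "\<forall>i<k. (u i, u (Suc i)) \<in> parcs G"
        using Suc.IH[of w] arc_ends(1)[OF w(1)] by blast
      then show ?case using w Suc.prems
        by (intro exI[of _ "u(Suc k := y)"]) (auto simp: le_Suc_eq less_Suc_eq)
    qed
    then show ?thesis by blast
  qed
  then obtain u where u: "\<And>i. i \<le> gdist G x y \<Longrightarrow> u i \<in> pverts G \<and> gdist G x (u i) = i"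
      "\<And>i. i < gdist G x y \<Longrightarrow> (u i, u (Suc i)) \<in> parcs G"
    using assms(2) by blast
  \<comment> \<open>Consecutive arcs bound the distance from above; the levels, that is the
    distances from \<open>x\<close>, bound it from below.\<close>
  have up: "gdist G (u i) (u (i + k)) \<le> k" if "i + k \<le> gdist G x y" for i k
    using that
  proof (induction k)
    case (Suc k)
    then show ?case using gdist_step[OF u(2)[of "i + k"], of "u i"] u(1)[of i] by simp
  qed (use u(1) in auto)
 have *: "gdist G (u i) (u j) = j - i" if "i \<le> j" "j \<le> gdist G x y" for i j
  proof (rule antisym)
    show "gdist G (u i) (u j) \<le> j - i" using up[of i "j - i"] that by simp
    show "j - i \<le> gdist G (u i) (u j)"
      using gdist_triangle[of x "u i" "u j"] u(1)[of i] u(1)[of j] assms(1) that by simp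
  qed
  have "gdist G (u i) (u j) = adiff i j" if "i \<le> gdist G x y" "j \<le> gdist G x y" for i j
  proof (cases "i \<le> j")
    case False
    then have "gdist G (u i) (u j) = gdist G (u j) (u i)" using that u(1) by (intro gdist_sym) auto
    then show ?thesis using *[of j i] False that by (simp add: adiff_def)
  qed (use * that in \<open>simp add: adiff_def\<close>)
  then show ?thesis using u(1) unfolding geodesic_def by blast
qed

lemma geodesic_inj: "geodesic u d \<Longrightarrow> inj_on u {..d}"
  unfolding geodesic_def inj_on_def
  by (metis adiff_def add_is_0 atMost_iff diff_is_0_eq gdist_self order_antisym)

lemma geodesic_arc_iff:
  assumes "geodesic u d" "i \<le> d" "j \<le> d"
  shows "(u i, u j) \<in> parcs G \<longleftrightarrow> adiff i j = 1"
  using assms gdist_arc gdist_1_arc unfolding geodesic_def by metis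

lemma card_geodesic_arcs:
  assumes "geodesic u d"
  shows "card {a \<in> parcs G. fst a \<in> u ` {..d} \<and> snd a \<in> u ` {..d}} \<le> 2 * d"
proof -
  have "{a \<in> parcs G. fst a \<in> u ` {..d} \<and> snd a \<in> u ` {..d}}
      \<subseteq> (\<lambda>i. (u i, u (Suc i))) ` {..<d} \<union> (\<lambda>i. (u (Suc i), u i)) ` {..<d}"
  proof
    fix a assume "a \<in> {a \<in> parcs G. fst a \<in> u ` {..d} \<and> snd a \<in> u ` {..d}}"
    then obtain i j where ij: "a = (u i, u j)" "i \<le> d" "j \<le> d" "adiff i j = 1"
      using geodesic_arc_iff[OF assms] by (cases a) auto
    then have "j = Suc i \<and> i < d \<or> i = Suc j \<and> j < d" unfolding adiff_def by linarith
    then show "a \<in> (\<lambda>i. (u i, u (Suc i))) ` {..<d} \<union> (\<lambda>i. (u (Suc i), u i)) ` {..<d}"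
      using ij(1) by auto
  qed
  then have "card {a \<in> parcs G. fst a \<in> u ` {..d} \<and> snd a \<in> u ` {..d}}
      \<le> card ((\<lambda>i. (u i, u (Suc i))) ` {..<d} \<union> (\<lambda>i. (u (Suc i), u i)) ` {..<d})"
    by (intro card_mono) auto
  also have "\<dots> \<le> card {..<d} + card {..<d}"
    by (rule order_trans[OF card_Un_le]) (intro add_mono card_image_le, auto)
  finally show ?thesis by simp
qed

lemma pendant_neighbour:
  assumes "w \<in> pendant_vertices G"
  obtains v where "(w, v) \<in> parcs G" "\<And>y. (w, y) \<in> parcs G \<Longrightarrow> y = v"
proof -
  have "card {y. (w, y) \<in> parcs G} = 1"
    using assms by (simp add: pendant_vertices_def degree_card_neighbours)
  then obtain v where "{y. (w, y) \<in> parcs G} = {v}" by (auto simp: card_1_singleton_iff)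
  then show ?thesis using that by blast
qed

text \<open>From a third vertex each of the two could be entered only through the other, so each
  would have to be farther away than the other.\<close>

lemma pendants_not_adjacent:
  assumes "(w, v) \<in> parcs G" "w \<in> pendant_vertices G" "card (pverts G) \<ge> 3"
  shows "v \<notin> pendant_vertices G"
proof
  assume v: "v \<in> pendant_vertices G"
  have "pverts G \<noteq> {w, v}"
    using assms(3) by (auto simp: card_insert_if split: if_splits)
  then obtain z where z: "z \<in> pverts G" "z \<noteq> w" "z \<noteq> v"
    using arc_ends[OF assms(1)] by blast
  have *: "gdist G z x = gdist G z y + 1"
    if xy: "(x, y) \<in> parcs G" "x \<in> pendant_vertices G" "z \<noteq> x" for x y
  proof -
    obtain y' where "(y', x) \<in> parcs G" "gdist G z x = gdist G z y' + 1"
      using gdist_pred[OF z(1) arc_ends(1)[OF xy(1)] xy(3)] by blast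
    then show ?thesis using pendant_neighbour[OF xy(2)] xy(1) arc_sym by metis
  qed
  show False using *[OF assms(1,2) z(2)] *[OF arc_sym[OF assms(1)] v z(3)] by simp
qed

lemma card_arcs_touching_pendants:
  assumes "W \<subseteq> pendant_vertices G"
  shows "card {a \<in> parcs G. fst a \<in> W \<or> snd a \<in> W} \<le> 2 * card W"
proof -
  have finW: "finite W"
    by (rule finite_subset[OF _ pair_finite_verts]) (use assms in \<open>auto simp: pendant_vertices_def\<close>)
  have "{a \<in> parcs G. fst a \<in> W} = (\<Union>w\<in>W. {a \<in> parcs G. fst a = w})" by auto
  also have "card \<dots> \<le> (\<Sum>w\<in>W. card {a \<in> parcs G. fst a = w})" by (rule card_UN_le[OF finW])
  also have "\<dots> = (\<Sum>w\<in>W. 1)"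
    by (intro sum.cong) (use assms in \<open>auto simp: pendant_vertices_def degree_card\<close>)
  finally have 1: "card {a \<in> parcs G. fst a \<in> W} \<le> card W" by simp
  have "{a \<in> parcs G. snd a \<in> W} \<subseteq> prod.swap ` {a \<in> parcs G. fst a \<in> W}"
  proof
    fix a assume "a \<in> {a \<in> parcs G. snd a \<in> W}"
    then show "a \<in> prod.swap ` {a \<in> parcs G. fst a \<in> W}"
      using arc_sym by (cases a) (auto intro!: image_eqI[of _ _ "prod.swap a"])
  qed
  then have "card {a \<in> parcs G. snd a \<in> W} \<le> card {a \<in> parcs G. fst a \<in> W}"
    using pair_finite_arcs by (intro surj_card_le) auto
  moreover have "{a \<in> parcs G. fst a \<in> W \<or> snd a \<in> W} = {a \<in> parcs G. fst a \<in> W} \<union> {a \<in> parcs G. snd a \<in> W}"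
    by auto
  ultimately show ?thesis using 1 card_Un_le[of "{a \<in> parcs G. fst a \<in> W}" "{a \<in> parcs G. snd a \<in> W}"]
    by simp
qed

lemma geodesic_interior_not_pendant:
  assumes "geodesic u d" "0 < i" "i < d" shows "u i \<notin> pendant_vertices G"
proof
  assume p: "u i \<in> pendant_vertices G"
  have "(u i, u (i - 1)) \<in> parcs G" "(u i, u (i + 1)) \<in> parcs G"
    using geodesic_arc_iff[OF assms(1)] assms by (auto simp: adiff_def)
  then have "u (i - 1) = u (i + 1)" using pendant_neighbour[OF p] by metis
  then have "i - 1 = i + 1" by (rule inj_onD[OF geodesic_inj[OF assms(1)]]) (use assms in auto)
  then show False by simp
qed

context
  fixes u :: "nat \<Rightarrow> 'a" and d :: nat
  assumes arcs: "card (parcs G) = 2 * card (pverts G)"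
    and u: "geodesic u d"
begin

lemma off_path_card: "card (pverts G - u ` {..d}) + d + 1 = card (pverts G)"
proof -
  have "u ` {..d} \<subseteq> pverts G" using u by (auto simp: geodesic_def)
  then have "card (pverts G - u ` {..d}) = card (pverts G) - (d + 1)" "d + 1 \<le> card (pverts G)"
    using card_image[OF geodesic_inj[OF u]] pair_finite_verts card_mono[of "pverts G" "u ` {..d}"]
    by (auto simp: card_Diff_subset)
  then show ?thesis by simp
qed

text \<open>Otherwise the path would have at most 2 d arcs and the n - d - 1 other vertices at most
  two each, 2 n - 2 in all, against the 2 n arcs of a unicyclic graph.\<close>

lemma off_path_non_pendant: "\<exists>x\<in>pverts G - u ` {..d}. x \<notin> pendant_vertices G"
proof (rule ccontr)
  let ?W = "pverts G - u ` {..d}"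
  assume "\<not> ?thesis"
  then have W: "?W \<subseteq> pendant_vertices G" by blast
  have "parcs G \<subseteq> {a \<in> parcs G. fst a \<in> u ` {..d} \<and> snd a \<in> u ` {..d}} \<union> {a \<in> parcs G. fst a \<in> ?W \<or> snd a \<in> ?W}"
    using arc_fst_in_verts arc_snd_in_verts by blast
  then have "card (parcs G) \<le> 2 * d + 2 * card ?W"
    using card_geodesic_arcs[OF u] card_arcs_touching_pendants[OF W] pair_finite_arcs
      card_mono[of "{a \<in> parcs G. fst a \<in> u ` {..d} \<and> snd a \<in> u ` {..d}} \<union> {a \<in> parcs G. fst a \<in> ?W \<or> snd a \<in> ?W}" "parcs G"]
      card_Un_le[of "{a \<in> parcs G. fst a \<in> u ` {..d} \<and> snd a \<in> u ` {..d}}" "{a \<in> parcs G. fst a \<in> ?W \<or> snd a \<in> ?W}"]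
    by simp
  then show False using arcs off_path_card by simp
qed

lemma pendants_split:
  "pendant_vertices G \<subseteq> {u 0, u d} \<union> (pendant_vertices G - u ` {..d})"
proof
  fix x assume x: "x \<in> pendant_vertices G"
  show "x \<in> {u 0, u d} \<union> (pendant_vertices G - u ` {..d})"
  proof (cases "x \<in> u ` {..d}")
    case True
    then obtain i where "i \<le> d" "x = u i" by auto
    then show ?thesis using geodesic_interior_not_pendant[OF u, of i] x by (cases "0 < i \<and> i < d") auto
  qed (use x in auto)
qed

text \<open>At most two pendant vertices lie on the path, at its ends, and at most n - d - 2 off it,
  because some vertex there is not pendant.\<close>

lemma length_plus_pendants_le: "d + card (pendant_vertices G) \<le> card (pverts G)"
proof -
  let ?W = "pendant_vertices G - u ` {..d}"
  obtain x where x: "x \<in> pverts G - u ` {..d}" "x \<notin> pendant_vertices G"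
    using off_path_non_pendant by blast
  have "card ?W \<le> card (pverts G - u ` {..d} - {x})"
    using x pair_finite_verts by (intro card_mono) (auto simp: pendant_vertices_def)
  then have W: "card ?W + d + 2 \<le> card (pverts G)"
    using x off_path_card card_Suc_Diff1[of "pverts G - u ` {..d}" x] pair_finite_verts by simp
  have "card (pendant_vertices G) \<le> card ({u 0, u d} \<union> ?W)"
    using pair_finite_verts by (intro card_mono pendants_split) (auto simp: pendant_vertices_def)
  also have "\<dots> \<le> 2 + card ?W"
    using card_Un_le[of "{u 0, u d}" ?W] card_insert_le_m1[of 2 "{u d}" "u 0"] by simp
  finally show ?thesis using W by simp
qed

text \<open>Equality in the previous count leaves exactly one non-pendant vertex x off the path and
  makes both path ends pendant. The numbering lists the path, then x, then the pendant vertices off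
  the path.\<close>

lemma ear_layout_ex:
  assumes n: "card (pverts G) = n" "3 \<le> n" and p: "d + card (pendant_vertices G) = n"
  shows "\<exists>f a b c. ear n d a b c \<and> layout f n (ear_edges n d a b c) G"
proof -
  define W where "W = pendant_vertices G - u ` {..d}"
  have finW: "finite W" and WV: "W \<subseteq> pverts G" using pair_finite_verts by (auto simp: W_def pendant_vertices_def)
  obtain x where x: "x \<in> pverts G - u ` {..d}" "x \<notin> pendant_vertices G"
    using off_path_non_pendant by blast
  have uV: "u i \<in> pverts G" if "i \<le> d" for i using u that by (simp add: geodesic_def)
  have off: "card (pverts G - u ` {..d} - {x}) + d + 2 = n"
    using off_path_card x n card_Suc_Diff1[of "pverts G - u ` {..d}" x] pair_finite_verts by simp
  have Wsub: "W \<subseteq> pverts G - u ` {..d} - {x}" using WV x by (auto simp: W_def)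
  have Wle: "card W + d + 2 \<le> n"
    using card_mono[OF _ Wsub] pair_finite_verts off by simp
  have split: "card (pendant_vertices G) \<le> card (pendant_vertices G \<inter> {u 0, u d}) + card W"
  proof -
    have "pendant_vertices G \<subseteq> (pendant_vertices G \<inter> {u 0, u d}) \<union> W"
      using pendants_split unfolding W_def by auto
    then have "card (pendant_vertices G) \<le> card ((pendant_vertices G \<inter> {u 0, u d}) \<union> W)"
      using finW by (intro card_mono) auto
    then show ?thesis using card_Un_le[of "pendant_vertices G \<inter> {u 0, u d}" W] by linarith
  qed
  have "card (pendant_vertices G \<inter> {u 0, u d}) \<le> card {u 0, u d}" by (intro card_mono) auto
  moreover have "card {u 0, u d} \<le> 2" by (simp add: card_insert_if)
  ultimately have cardW: "card W + d + 2 = n" and "card (pendant_vertices G \<inter> {u 0, u d}) = 2"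
    and c2: "card {u 0, u d} = 2"
    using split Wle p by linarith+
  then have ends: "u 0 \<in> pendant_vertices G" "u d \<in> pendant_vertices G"
    using card_subset_eq[of "{u 0, u d}" "pendant_vertices G \<inter> {u 0, u d}"] by auto
  have d: "0 < d" using c2 by (cases d) auto
  have Weq: "W = pverts G - u ` {..d} - {x}"
    using card_subset_eq[OF _ Wsub] off cardW pair_finite_verts by simp
  define X where "X = {i. i \<le> d \<and> (x, u i) \<in> parcs G}"
  have finX: "finite X" unfolding X_def by simp
  \<comment> \<open>Arcs within the path and arcs at pendant vertices off it number at most 2 d + 2
    (n - d - 2) = 2 n - 4; the other arcs, at least four, join x to the path.\<close>
  have X2: "2 \<le> card X"
  proof -
    let ?A1 = "{a \<in> parcs G. fst a \<in> u ` {..d} \<and> snd a \<in> u ` {..d}}"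
    let ?A2 = "{a \<in> parcs G. fst a \<in> W \<or> snd a \<in> W}"
    let ?A3 = "(\<lambda>i. (x, u i)) ` X" and ?A4 = "(\<lambda>i. (u i, x)) ` X"
    have "a \<in> ?A1 \<union> ?A2 \<union> ?A3 \<union> ?A4" if a: "a \<in> parcs G" for a
    proof -
      obtain y z where yz: "a = (y, z)" by (cases a)
      have mem: "y \<in> u ` {..d} \<or> y \<in> W \<or> y = x" "z \<in> u ` {..d} \<or> z \<in> W \<or> z = x" "y \<noteq> z"
        using arc_ends[of y z] a yz Weq by auto
      have "a \<in> ?A3" if "y = x" "z \<in> u ` {..d}" using that a yz unfolding X_def by auto
      moreover have "a \<in> ?A4" if "z = x" "y \<in> u ` {..d}"
        using that a yz arc_sym[of y z] unfolding X_def by auto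
      ultimately show ?thesis using mem a yz by auto
    qed
    then have "card (parcs G) \<le> card (?A1 \<union> ?A2 \<union> ?A3 \<union> ?A4)"
      using pair_finite_arcs finX by (intro card_mono) auto
    also have "\<dots> \<le> card ?A1 + card ?A2 + card ?A3 + card ?A4"
      using card_Un_le[of "?A1 \<union> ?A2 \<union> ?A3" ?A4] card_Un_le[of "?A1 \<union> ?A2" ?A3] card_Un_le[of ?A1 ?A2]
      by linarith
    also have "\<dots> \<le> 2 * d + 2 * card W + card X + card X"
      using card_geodesic_arcs[OF u] card_arcs_touching_pendants[of W] card_image_le[OF finX]
      by (intro add_mono) (auto simp: W_def)
    finally show ?thesis using arcs n cardW by simp
  qed
  have X_interior: "1 \<le> i \<and> i < d" if "i \<in> X" for i
  proof -
    have i: "i \<le> d" "(u i, x) \<in> parcs G" using that arc_sym unfolding X_def by auto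
    have "i \<noteq> 0"
    proof
      assume "i = 0"
      moreover have "(u 0, u 1) \<in> parcs G" using geodesic_arc_iff[OF u, of 0 1] d by (simp add: adiff_def)
      ultimately have "x = u 1" using pendant_neighbour[OF ends(1)] i by metis
      then show False using x d by auto
    qed
    moreover have "i \<noteq> d"
    proof
      assume "i = d"
      moreover have "(u d, u (d - 1)) \<in> parcs G"
        using geodesic_arc_iff[OF u, of d "d - 1"] d by (simp add: adiff_def)
      ultimately have "x = u (d - 1)" using pendant_neighbour[OF ends(2)] i by metis
      then show False using x by auto
    qed
    ultimately show ?thesis using i by simp
  qed
  \<comment> \<open>Any two neighbours of x will do as a and b; that there are no others follows
    only from the final count of arcs.\<close>
  obtain a b where ab: "a \<in> X" "b \<in> X" "a < b"
  proof -
    obtain a b where "a \<in> X" "b \<in> X" "a \<noteq> b"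
      using X2 finX by (metis One_nat_def Suc_1 card_le_Suc0_iff_eq not_less_eq_eq)
    then show thesis using that by (metis nat_neq_iff)
  qed
  have "gdist G (u a) (u b) \<le> gdist G (u a) x + gdist G x (u b)"
    using uV ab x unfolding X_def by (intro gdist_triangle) auto
  moreover have "gdist G (u a) x = 1" "gdist G x (u b) = 1"
    using ab gdist_arc arc_sym unfolding X_def by auto
  moreover have "gdist G (u a) (u b) = adiff a b" using u ab unfolding geodesic_def X_def by auto
  ultimately have ba: "b \<le> a + 2" using ab unfolding adiff_def by simp
  have "card {d + 2..<n} = card W" using cardW by simp
  then obtain g where g: "bij_betw g {d + 2..<n} W"
    using finite_same_card_bij[of "{d + 2..<n}" W] finW by auto
  define f where "f i = (if i \<le> d then u i else if i = d + 1 then x else g i)" for i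
  have fW: "f j \<in> W" if "d + 2 \<le> j" "j < n" for j
    using g that unfolding f_def bij_betw_def by auto
  have split_n: "{..<n} = {..d} \<union> {d + 1} \<union> {d + 2..<n}" using cardW by auto
  have "f ` {..d} = u ` {..d}" "f ` {d + 1} = {x}" "f ` {d + 2..<n} = W"
    using g unfolding f_def bij_betw_def by auto
  then have img: "f ` {..<n} = pverts G"
    unfolding split_n image_Un Weq using x uV by auto
  have inj: "inj_on f {..<n}"
    using img n(1) by (intro eq_card_imp_inj_on) auto
  have "\<exists>i. (f i, f j) \<in> parcs G \<and> 1 \<le> i \<and> i \<noteq> d \<and> i \<le> d + 1" if j: "d + 2 \<le> j" "j < n" for j
  proof -
    have fj: "f j \<in> pendant_vertices G" using fW[OF j] unfolding W_def by simp
    obtain v where v: "(f j, v) \<in> parcs G" using pendant_neighbour[OF fj] by blast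
    have "v \<notin> pendant_vertices G" using pendants_not_adjacent[OF v fj] n by simp
    moreover have "v \<in> f ` {..<n}" using arc_ends(2)[OF v] img by simp
    ultimately obtain i where i: "i < n" "v = f i" "f i \<notin> pendant_vertices G" by auto
    have "i \<le> d + 1" using i fW[of i] unfolding W_def by (cases "i \<le> d + 1") auto
    moreover have "f 0 = u 0" "f d = u d" unfolding f_def by auto
    then have "i \<noteq> 0" "i \<noteq> d" using i(3) ends by metis+
    ultimately show ?thesis using arc_sym[OF v] i by (intro exI[of _ i]) auto
  qed
  then obtain c where foot: "\<And>j. d + 2 \<le> j \<Longrightarrow> j < n \<Longrightarrow> (f (c j), f j) \<in> parcs G \<and> 1 \<le> c j \<and> c j \<noteq> d \<and> c j \<le> d + 1"
    by metis
  have ear: "ear n d a b c"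
    by unfold_locales (use X_interior ab ba cardW foot in auto)
  interpret ear n d a b c by (rule ear)
  \<comment> \<open>One inclusion is enough, since both sides have 2 n elements.\<close>
  have sub: "map_prod f f ` symcl E \<subseteq> parcs G"
  proof -
    have "(f i, f j) \<in> parcs G" if "(i, j) \<in> E" for i j
    proof -
      consider "j = Suc i" "i < d" | "i = a \<or> i = b" "j = d + 1" | "j \<in> J" "i = c j"
        using \<open>(i, j) \<in> E\<close> unfolding ear_edges_def base_edges_def by auto
      then show ?thesis
      proof cases
        case 1
        then show ?thesis using geodesic_arc_iff[OF u, of i j] by (simp add: f_def adiff_def)
      next
        case 2
        then show ?thesis using ab unfolding X_def f_def by (auto intro: arc_sym)
      next
        case 3
        then show ?thesis using foot by auto
      qed
    qed
    then have "(f i, f j) \<in> parcs G \<and> (f j, f i) \<in> parcs G" if "(i, j) \<in> E" for i j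
      using that arc_sym by blast
    then show ?thesis by (auto simp: symcl_iff)
  qed
  have cardV: "card (pverts G) = n" using img inj by (metis card_image card_lessThan)
  obtain H where H: "layout f n E H" using layout_exists[OF inj] by blast
  have "card (parcs H) = 2 * n" using layout_card_parcs[OF H ascending_E] card_E by simp
  moreover have "parcs H = map_prod f f ` symcl E" using H by (simp add: layout_def)
  ultimately have "parcs G = map_prod f f ` symcl E"
    using card_subset_eq[OF pair_finite_arcs sub] arcs cardV by simp
  then have "layout f n E G" unfolding layout_def using inj img by simp
  then show ?thesis using ear by blast
qed

end

end

section \<open>A lower bound for the degree distance at given diameter\<close>

text \<open>Removing the two outer terms, each equal to d, leaves the sum for d - 2; hence the
  induction in steps of two. For even d the bound is attained.\<close>

lemma sum_abs_reflect:
  fixes d :: nat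
  shows "2 * (\<Sum>i\<le>d. \<bar>int d - 2 * int i\<bar>) \<ge> int d * int d + 2 * int d"
proof (induction d rule: less_induct)
  case (less d)
  show ?case
  proof (cases "d \<le> 1")
    case True
    then have "d = 0 \<or> d = 1" by auto
    then show ?thesis by auto
  next
    case False
    then obtain e where e: "d = Suc (Suc e)" by (metis One_nat_def Suc_le_D not_less_eq_eq)
    have "(\<Sum>i\<le>d. \<bar>int d - 2 * int i\<bar>)
        = \<bar>int d\<bar> + (\<Sum>i\<le>Suc e. \<bar>int d - 2 * int (Suc i)\<bar>)"
      unfolding e by (subst sum.atMost_Suc_shift) simp
    also have "(\<Sum>i\<le>Suc e. \<bar>int d - 2 * int (Suc i)\<bar>) = (\<Sum>i\<le>e. \<bar>int e - 2 * int i\<bar>) + int d"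
      unfolding e by simp
    finally have "(\<Sum>i\<le>d. \<bar>int d - 2 * int i\<bar>) = (\<Sum>i\<le>e. \<bar>int e - 2 * int i\<bar>) + 2 * int d"
      by simp
    then show ?thesis using less[of e] unfolding e by (simp add: algebra_simps)
  qed
qed

context connected_graph begin

text \<open>The triangle inequality through \<open>x\<close> is applied to the mirror pairs u i, u
  (d - i), whose distance does not depend on \<open>x\<close>.\<close>

lemma sum_gdist_geodesic_ge:
  assumes u: "geodesic u d" and x: "x \<in> pverts G"
  shows "4 * (\<Sum>i\<le>d. int (gdist G x (u i))) \<ge> int d * int d + 2 * int d"
proof -
  have "(\<Sum>i\<le>d. int (gdist G x (u i))) = (\<Sum>i\<le>d. int (gdist G x (u (d - i))))"
    by (rule sum.reindex_bij_witness[of _ "\<lambda>i. d - i" "\<lambda>i. d - i"]) auto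
  then have "2 * (\<Sum>i\<le>d. int (gdist G x (u i)))
      = (\<Sum>i\<le>d. int (gdist G x (u i)) + int (gdist G x (u (d - i))))"
    by (simp add: sum.distrib)
  also have "\<dots> \<ge> (\<Sum>i\<le>d. \<bar>int d - 2 * int i\<bar>)"
  proof (rule sum_mono)
    fix i assume "i \<in> {..d}"
    then have i: "i \<le> d" by simp
    have uV: "u i \<in> pverts G" "u (d - i) \<in> pverts G" using u by (auto simp: geodesic_def i)
    have "gdist G (u i) (u (d - i)) \<le> gdist G (u i) x + gdist G x (u (d - i))"
      using uV x by (intro gdist_triangle)
    moreover have "gdist G (u i) x = gdist G x (u i)" using uV x by (intro gdist_sym)
    moreover have "int (gdist G (u i) (u (d - i))) = \<bar>int d - 2 * int i\<bar>"
      using u i by (simp add: geodesic_def int_adiff)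
    ultimately show "\<bar>int d - 2 * int i\<bar> \<le> int (gdist G x (u i)) + int (gdist G x (u (d - i)))"
      by linarith
  qed
  finally show ?thesis using sum_abs_reflect[of d] by linarith
qed

text \<open>A vertex of \<open>Q\<close> nearest to \<open>r\<close> has its predecessor on a
  shortest path from \<open>r\<close> outside \<open>Q\<close>.\<close>

lemma boundary_arc_ex:
  assumes "Q \<subseteq> pverts G" "Q \<noteq> {}" "r \<in> pverts G - Q"
  shows "\<exists>x\<in>Q. \<exists>w\<in>pverts G - Q. (w, x) \<in> parcs G"
proof -
  obtain x where x: "x \<in> Q" "\<And>y. y \<in> Q \<Longrightarrow> gdist G r x \<le> gdist G r y"
    using assms(2) ex_has_least_nat[of "\<lambda>x. x \<in> Q" _ "gdist G r"] by blast
  obtain w where w: "(w, x) \<in> parcs G" "gdist G r x = gdist G r w + 1"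
    using gdist_pred[of r x] assms x(1) by blast
  then have "w \<notin> Q" using x(2)[of w] by auto
  then show ?thesis using w x(1) arc_ends(1)[OF w(1)] by blast
qed

text \<open>Distinct non-adjacent vertices are at distance at least 2, and at most 2 card Q arcs run
  inside \<open>Q\<close>: of the 2 n arcs, 2 d lie on the path and two more join \<open>Q\<close>
  to it, where n = card Q + d + 1.\<close>

lemma sum_gdist_off_path_ge:
  assumes arcs: "card (parcs G) = 2 * card (pverts G)" and u: "geodesic u d"
    and ne: "pverts G - u ` {..d} \<noteq> {}"
  defines "Q \<equiv> pverts G - u ` {..d}"
  shows "int (\<Sum>x\<in>Q. \<Sum>y\<in>Q. gdist G x y) \<ge> 2 * int (card Q) * (int (card Q) - 1) - 2 * int (card Q)"
proof -
  define R where "R = {a \<in> parcs G. fst a \<in> Q \<and> snd a \<in> Q}"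
  define P where "P = (\<lambda>i. (u i, u (Suc i))) ` {..<d} \<union> (\<lambda>i. (u (Suc i), u i)) ` {..<d}"
  have fin: "finite Q" "finite R" "finite P"
    using pair_finite_verts pair_finite_arcs by (auto simp: Q_def R_def P_def)
  have cardP: "card P = 2 * d"
  proof -
    have inj: "inj_on u {..d}" by (rule geodesic_inj[OF u])
    have "inj_on (\<lambda>i. (u i, u (Suc i))) {..<d}" "inj_on (\<lambda>i. (u (Suc i), u i)) {..<d}"
      using inj by (auto simp: inj_on_def)
    moreover have "(\<lambda>i. (u i, u (Suc i))) ` {..<d} \<inter> (\<lambda>i. (u (Suc i), u i)) ` {..<d} = {}"
    proof (rule equals0I, elim IntE imageE)
      fix a i j
      assume ij: "i \<in> {..<d}" "j \<in> {..<d}" and a: "a = (u i, u (Suc i))" "a = (u (Suc j), u j)"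
      then have "i = Suc j" by (intro inj_onD[OF inj]) auto
      moreover have "Suc i = j" using ij a by (intro inj_onD[OF inj]) auto
      ultimately show False by simp
    qed
    ultimately show ?thesis unfolding P_def by (simp add: card_Un_disjoint card_image)
  qed
  have PA: "P \<subseteq> parcs G"
    using geodesic_arc_iff[OF u] by (auto simp: P_def adiff_def)
  have "u 0 \<in> pverts G - Q" using u by (auto simp: geodesic_def Q_def)
  then obtain x w where xw: "x \<in> Q" "w \<in> pverts G - Q" "(w, x) \<in> parcs G"
    using boundary_arc_ex[of Q "u 0"] ne unfolding Q_def by blast
  have "w \<noteq> x" using arc_ends(3)[OF xw(3)] .
  then have cardxw: "card {(w, x), (x, w)} = 2" by simp
  have "fst a \<notin> Q \<and> snd a \<notin> Q" if "a \<in> P" for a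
    using that unfolding P_def Q_def by auto
  then have "R \<inter> P = {}" "(R \<union> P) \<inter> {(w, x), (x, w)} = {}"
    using xw unfolding R_def by fastforce+
  then have "card (R \<union> P \<union> {(w, x), (x, w)}) = card R + 2 * d + 2"
    using fin cardP cardxw by (subst card_Un_disjoint) (auto simp: card_Un_disjoint)
  moreover have "card (R \<union> P \<union> {(w, x), (x, w)}) \<le> card (parcs G)"
    using PA xw arc_sym[OF xw(3)] pair_finite_arcs by (intro card_mono) (auto simp: R_def)
  ultimately have R: "card R \<le> 2 * card Q"
    using arcs off_path_card[OF arcs u] unfolding Q_def by simp
  let ?D = "{(x, y). x \<in> Q \<and> y \<in> Q \<and> x \<noteq> y}"
  have D: "card ?D + card Q = card Q * card Q"
  proof -
    have "Q \<times> Q = ?D \<union> (\<lambda>x. (x, x)) ` Q" by auto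
    moreover have "?D \<inter> (\<lambda>x. (x, x)) ` Q = {}" by auto
    moreover have "finite ?D" by (rule finite_subset[of _ "Q \<times> Q"]) (use fin in auto)
    ultimately have "card (Q \<times> Q) = card ?D + card ((\<lambda>x. (x, x)) ` Q)"
      using fin by (metis (lifting) card_Un_disjoint finite_imageI)
    then show ?thesis by (simp add: card_image inj_on_def card_cartesian_product)
  qed
  have RD: "R \<subseteq> ?D" unfolding R_def using arc_ends(3) by auto
  have finD: "finite ?D" by (rule finite_subset[of _ "Q \<times> Q"]) (use fin in auto)
  have QV: "Q \<subseteq> pverts G" unfolding Q_def by auto
  have "2 * card ?D \<le> (\<Sum>a\<in>?D. gdist G (fst a) (snd a)) + card R"
  proof -
    have "(\<Sum>a\<in>?D. gdist G (fst a) (snd a))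
        = (\<Sum>a\<in>?D - R. gdist G (fst a) (snd a)) + (\<Sum>a\<in>R. gdist G (fst a) (snd a))"
      by (rule sum.subset_diff[OF RD finD])
    moreover have "(\<Sum>a\<in>R. gdist G (fst a) (snd a)) = (\<Sum>a\<in>R. 1)"
      unfolding R_def by (intro sum.cong) (auto simp: gdist_arc)
    moreover have "(\<Sum>a\<in>?D - R. 2) \<le> (\<Sum>a\<in>?D - R. gdist G (fst a) (snd a))"
    proof (rule sum_mono)
      fix a assume a: "a \<in> ?D - R"
      then have V: "fst a \<in> pverts G" "snd a \<in> pverts G" "fst a \<noteq> snd a" using QV by auto
      have "gdist G (fst a) (snd a) \<noteq> 0" using gdist_eq_0_iff[OF V(1,2)] V(3) by simp
      moreover have "gdist G (fst a) (snd a) \<noteq> 1"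
        using gdist_1_arc[OF V(1,2)] a unfolding R_def by auto
      ultimately show "2 \<le> gdist G (fst a) (snd a)" by linarith
    qed
    moreover have "card (?D - R) + card R = card ?D"
      using RD finD fin card_mono[OF finD RD] by (simp add: card_Diff_subset)
    ultimately show ?thesis by simp
  qed
  moreover have "(\<Sum>a\<in>?D. gdist G (fst a) (snd a)) \<le> (\<Sum>x\<in>Q. \<Sum>y\<in>Q. gdist G x y)"
    unfolding sum.cartesian_product case_prod_beta
    using fin by (intro sum_mono2) auto
  ultimately have "2 * card ?D \<le> (\<Sum>x\<in>Q. \<Sum>y\<in>Q. gdist G x y) + 2 * card Q" using R by linarith
  then have "2 * (card Q * card Q) \<le> (\<Sum>x\<in>Q. \<Sum>y\<in>Q. gdist G x y) + 4 * card Q"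
    using D by linarith
  then have "int (2 * (card Q * card Q)) \<le> int ((\<Sum>x\<in>Q. \<Sum>y\<in>Q. gdist G x y) + 4 * card Q)"
    by (simp only: of_nat_le_iff)
  then show ?thesis by (simp add: algebra_simps)
qed

text \<open>The distances are grouped into path to path, which is exact, path to the rest, which
  counts twice, and the rest among itself. The factor 3 clears the denominator of the path
  sums.\<close>

lemma degree_distance_crude_ge:
  assumes arcs: "card (parcs G) = 2 * card (pverts G)"
  defines "n \<equiv> int (card (pverts G))" and "d \<equiv> int (diameter G)"
  defines "N \<equiv> n - d - 1"
  shows "3 * int (degree_distance G)
    \<ge> 2 * d * (d + 1) * (d + 2) + 3 * N * (d * d + 2 * d) + 12 * N * (N - 1) - 12 * N + 9 * n - 3 * n * n"
proof -
  obtain y z where yz: "y \<in> pverts G" "z \<in> pverts G" "gdist G y z = diameter G"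
    using diameter_attained by blast
  define \<delta> where "\<delta> = diameter G"
  obtain u where u: "geodesic u \<delta>" using geodesic_ex[OF yz(1,2)] yz(3) \<delta>_def by auto
  define Q where "Q = pverts G - u ` {..\<delta>}"
  define P where "P = u ` {..\<delta>}"
  let ?g = "\<lambda>x y. int (gdist G x y)"
  have N: "int (card Q) = N"
    using off_path_card[OF arcs u] unfolding Q_def N_def n_def d_def \<delta>_def by linarith
  have Qne: "Q \<noteq> {}" using off_path_non_pendant[OF arcs u] unfolding Q_def by auto
  have PV: "P \<subseteq> pverts G" using u by (auto simp: P_def geodesic_def)
  have V: "pverts G = P \<union> Q" "P \<inter> Q = {}" "finite P" "finite Q"
    using PV pair_finite_verts by (auto simp: P_def Q_def)
  have split: "(\<Sum>x\<in>pverts G. f x) = (\<Sum>x\<in>P. f x) + (\<Sum>x\<in>Q. f x)" for f :: "'a \<Rightarrow> int"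
    unfolding V(1) using V by (intro sum.union_disjoint)
  have sumP: "(\<Sum>x\<in>P. f x) = (\<Sum>i\<le>\<delta>. f (u i))" for f :: "'a \<Rightarrow> int"
    unfolding P_def using geodesic_inj[OF u] by (simp add: sum.reindex)
  have PP: "3 * (\<Sum>x\<in>P. \<Sum>y\<in>P. ?g x y) = d * (d + 1) * (d + 2)"
  proof -
    have "(\<Sum>x\<in>P. \<Sum>y\<in>P. ?g x y) = (\<Sum>i\<le>\<delta>. path_sum \<delta> i)"
      unfolding sumP path_sum_def using u by (intro sum.cong refl) (auto simp: geodesic_def)
    then show ?thesis using sum_path_sum[of \<delta>] unfolding d_def \<delta>_def by simp
  qed
  have QP: "4 * (\<Sum>x\<in>Q. \<Sum>y\<in>P. ?g x y) \<ge> N * (d * d + 2 * d)"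
  proof -
    have "(\<Sum>x\<in>Q. d * d + 2 * d) \<le> (\<Sum>x\<in>Q. 4 * (\<Sum>y\<in>P. ?g x y))"
      unfolding sumP d_def using sum_gdist_geodesic_ge[OF u] unfolding \<delta>_def Q_def
      by (intro sum_mono) auto
    then show ?thesis using N by (simp add: sum_distrib_left)
  qed
  have PQ: "(\<Sum>x\<in>P. \<Sum>y\<in>Q. ?g x y) = (\<Sum>x\<in>Q. \<Sum>y\<in>P. ?g x y)"
    by (subst sum.swap) (intro sum.cong refl arg_cong[of _ _ int] gdist_sym, use V in auto)
  have QQ: "(\<Sum>x\<in>Q. \<Sum>y\<in>Q. ?g x y) \<ge> 2 * N * (N - 1) - 2 * N"
    using sum_gdist_off_path_ge[OF arcs u] Qne N unfolding Q_def by simp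
  have "(\<Sum>x\<in>pverts G. \<Sum>y\<in>pverts G. ?g x y)
      = (\<Sum>x\<in>P. \<Sum>y\<in>P. ?g x y) + 2 * (\<Sum>x\<in>Q. \<Sum>y\<in>P. ?g x y) + (\<Sum>x\<in>Q. \<Sum>y\<in>Q. ?g x y)"
    unfolding split sum.distrib PQ by simp
  moreover have "2 * (\<Sum>x\<in>pverts G. \<Sum>y\<in>pverts G. ?g x y) + 3 * n \<le> int (degree_distance G) + n * n"
    using degree_distance_ge[OF arcs, THEN of_nat_mono, where 'a=int] unfolding n_def by simp
  ultimately show ?thesis using PP QP QQ by (simp add: algebra_simps)
qed

end

section \<open>One pendant vertex\<close>

text \<open>0, ..., n - 1 is the maximal path starting at the pendant vertex 0; the extra edge
  closes the cycle l, ..., n - 1 of length n - l.\<close>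

definition lollipop_edges :: "nat \<Rightarrow> nat \<Rightarrow> (nat \<times> nat) set" where
  "lollipop_edges n l = (\<lambda>i. (i, Suc i)) ` {..<n - 1} \<union> {(l, n - 1)}"

lemma ascending_lollipop:
  assumes "l + 3 \<le> n" shows "ascending n (lollipop_edges n l)"
proof -
  have "(j - 1, j) \<in> lollipop_edges n l" if "0 < j" "j < n" for j
    using that unfolding lollipop_edges_def by (auto intro!: image_eqI[of _ _ "j - 1"])
  moreover have "i < j \<and> j < n" if "(i, j) \<in> lollipop_edges n l" for i j
    using that assms unfolding lollipop_edges_def by auto
  ultimately show ?thesis using assms unfolding ascending_def by auto
qed

lemma sum_lollipop_edges:
  fixes g :: "nat \<times> nat \<Rightarrow> 'b::comm_monoid_add"
  assumes "l + 3 \<le> n"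
  shows "sum g (lollipop_edges n l) = (\<Sum>i<n - 1. g (i, Suc i)) + g (l, n - 1)"
proof -
  have "sum g (lollipop_edges n l) = sum g ((\<lambda>i. (i, Suc i)) ` {..<n - 1}) + sum g {(l, n - 1)}"
    unfolding lollipop_edges_def using assms by (intro sum.union_disjoint) auto
  then show ?thesis by (simp add: sum.reindex inj_on_def)
qed

lemma card_lollipop_edges: "l + 3 \<le> n \<Longrightarrow> card (lollipop_edges n l) = n"
  using sum_lollipop_edges[of l n "\<lambda>_. 1 :: nat"] by simp

lemma (in connected_graph) degree_ge_2:
  assumes "v \<in> pverts G" "v \<notin> pendant_vertices G" "2 \<le> card (pverts G)"
  shows "2 \<le> degree G v"
proof -
  have "degree G v \<noteq> 1" using assms by (simp add: pendant_vertices_def)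
  moreover have "degree G v \<noteq> 0"
  proof -
    have "pverts G \<noteq> {v}" using assms(3) by auto
    then obtain w where "w \<in> pverts G" "w \<noteq> v" using assms(1) by blast
    then obtain y where "(y, v) \<in> parcs G" using gdist_pred[of w v] assms(1) by blast
    then have "y \<in> {y. (v, y) \<in> parcs G}" using arc_sym by blast
    moreover have "finite {y. (v, y) \<in> parcs G}"
      by (rule finite_subset[OF _ pair_finite_verts]) (use arc_ends in auto)
    ultimately show ?thesis unfolding degree_card_neighbours by auto
  qed
  ultimately show ?thesis by linarith
qed

text \<open>The last vertex of a maximal path from the pendant vertex has all its neighbours on the
  path and at least two of them; the second one closes a cycle. Vertices off the path would have
  degree at least 2, which makes too many arcs.\<close>

lemma (in connected_graph) lollipop_layout_ex:
  assumes arcs: "card (parcs G) = 2 * card (pverts G)" and p: "card (pendant_vertices G) = 1"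
    and n: "card (pverts G) = n" "3 \<le> n"
  shows "\<exists>f l. 1 \<le> l \<and> l + 3 \<le> n \<and> layout f n (lollipop_edges n l) G"
proof -
  obtain z where z: "pendant_vertices G = {z}" using p by (auto simp: card_1_singleton_iff)
  then have zp: "z \<in> pendant_vertices G" by simp
  then have zV: "z \<in> pverts G" by (simp add: pendant_vertices_def)
  define path where "path f k \<longleftrightarrow> f 0 = z \<and> inj_on f {..k} \<and> f ` {..k} \<subseteq> pverts G
    \<and> (\<forall>i<k. (f i, f (Suc i)) \<in> parcs G)" for f k
  have bound: "k < n" if "path f k" for f k
  proof -
    have "card (f ` {..k}) = Suc k" using that unfolding path_def by (simp add: card_image)
    moreover have "card (f ` {..k}) \<le> n"
      using that n pair_finite_verts unfolding path_def by (metis card_mono)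
    ultimately show ?thesis by simp
  qed
  have "\<exists>f. path f 0" using zV unfolding path_def by (intro exI[of _ "\<lambda>_. z"]) auto
  then obtain k where k: "\<exists>f. path f k" "\<And>k'. \<exists>f. path f k' \<Longrightarrow> k' \<le> k"
    using ex_has_greatest_nat[of "\<lambda>k. \<exists>f. path f k" 0 id n] bound by (auto simp: less_imp_le)
  obtain f where f: "path f k" using k(1) by blast
  have f0: "f 0 = z" and inj: "inj_on f {..k}" and fV: "\<And>i. i \<le> k \<Longrightarrow> f i \<in> pverts G"
    and fA: "\<And>i. i < k \<Longrightarrow> (f i, f (Suc i)) \<in> parcs G"
    using f unfolding path_def by auto
  have ext: "y \<in> f ` {..k}" if y: "(f k, y) \<in> parcs G" for y
  proof (rule ccontr)
    assume nin: "y \<notin> f ` {..k}"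
    have "path (f(Suc k := y)) (Suc k)"
      unfolding path_def
    proof (intro conjI allI impI)
      show "inj_on (f(Suc k := y)) {..Suc k}"
        using inj nin by (auto simp: inj_on_def le_Suc_eq)
      show "(f(Suc k := y)) ` {..Suc k} \<subseteq> pverts G"
        using fV arc_ends(2)[OF y] by (auto simp: le_Suc_eq)
      show "((f(Suc k := y)) i, (f(Suc k := y)) (Suc i)) \<in> parcs G" if "i < Suc k" for i
        using that fA y by (auto simp: less_Suc_eq)
    qed (use f0 in simp)
    then show False using k(2)[of "Suc k"] by auto
  qed
  obtain z' where z': "(z, z') \<in> parcs G" "\<And>y. (z, y) \<in> parcs G \<Longrightarrow> y = z'"
    using pendant_neighbour[OF zp] by blast
  have k0: "0 < k"
  proof (rule ccontr)
    assume "\<not> 0 < k"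
    then have "z' \<in> {z}" using ext[of z'] z'(1) f0 by simp
    then show False using arc_ends(3)[OF z'(1)] by simp
  qed
  have "f k \<noteq> z" using inj f0 k0 by (metis atMost_iff inj_onD le0 less_irrefl order_refl)
  then have "2 \<le> card {y. (f k, y) \<in> parcs G}"
    using degree_ge_2[of "f k"] fV n z unfolding degree_card_neighbours by auto
  then have "\<not> {y. (f k, y) \<in> parcs G} \<subseteq> {f (k - 1)}"
    using card_mono[of "{f (k - 1)}" "{y. (f k, y) \<in> parcs G}"] by auto
  then obtain y where y: "(f k, y) \<in> parcs G" "y \<noteq> f (k - 1)" by blast
  then obtain l where l: "l \<le> k" "y = f l" using ext by blast
  have "l \<noteq> k" using arc_ends(3)[OF y(1)] l by auto
  moreover have "l \<noteq> k - 1" using y l by auto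
  ultimately have l2: "l + 2 \<le> k" using l by simp
  have l1: "1 \<le> l"
  proof (rule ccontr)
    assume "\<not> 1 \<le> l"
    then have "(z, f k) \<in> parcs G" "(z, f 1) \<in> parcs G"
      using arc_sym[OF y(1)] l f0 fA[of 0] k0 by (auto simp: not_le)
    then have "f k = f 1" using z'(2) by metis
    then have "k = 1" using inj k0 by (auto simp: inj_on_def)
    then show False using l2 by simp
  qed
  define E where "E = lollipop_edges (Suc k) l"
  have lk: "l + 3 \<le> Suc k" using l2 by simp
  have E_arcs: "(f i, f j) \<in> parcs G" if "(i, j) \<in> E" for i j
    using that fA arc_sym[OF y(1)] l unfolding E_def lollipop_edges_def by auto
  have sub: "map_prod f f ` symcl E \<subseteq> parcs G"
    using E_arcs arc_sym by (auto simp: symcl_iff)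
  have inj': "inj_on f {..<Suc k}" using inj by (simp add: lessThan_Suc_atMost)
  obtain H where H: "layout f (Suc k) E H" using layout_exists[OF inj'] by blast
  have cardE: "card (map_prod f f ` symcl E) = 2 * Suc k"
    using layout_card_parcs[OF H] ascending_lollipop[OF lk] card_lollipop_edges[OF lk] H
    unfolding E_def by (simp add: layout_def)
  define Q where "Q = pverts G - f ` {..k}"
  have finQ: "finite Q" using pair_finite_verts by (simp add: Q_def)
  have cardQ: "card Q + Suc k = n"
    using card_image[OF inj] n fV card_Diff_subset[of "f ` {..k}" "pverts G"] bound[OF f]
    unfolding Q_def by (simp add: image_subset_iff)
  have Q0: "Q = {}"
  proof (rule ccontr)
    assume ne: "Q \<noteq> {}"
    have "f 0 \<in> pverts G - Q" using fV[of 0] by (simp add: Q_def)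
    then obtain x w where xw: "x \<in> Q" "w \<in> pverts G - Q" "(w, x) \<in> parcs G"
      using boundary_arc_ex[of Q "f 0"] ne unfolding Q_def by blast
    \<comment> \<open>At least 2 card Q arcs have their tail in \<open>Q\<close>, the lollipop has 2
      (k + 1), and (w, x) is one more: too many for 2 n.\<close>
    let ?R = "{a \<in> parcs G. fst a \<in> Q}"
    have finR: "finite ?R" "finite (map_prod f f ` symcl E)"
      using pair_finite_arcs finite_subset[OF sub pair_finite_arcs] by auto
    have "card ?R = (\<Sum>v\<in>Q. card {a \<in> ?R. fst a = v})"
      using sum.group[OF finR(1) finQ, of fst "\<lambda>_. 1 :: nat"] by (simp add: image_subset_iff)
    also have "\<dots> = (\<Sum>v\<in>Q. degree G v)"
      by (intro sum.cong refl) (auto simp: degree_card intro!: arg_cong[of _ _ card])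
    also have "\<dots> \<ge> (\<Sum>v\<in>Q. 2)"
    proof (rule sum_mono)
      fix v assume "v \<in> Q"
      then have "v \<in> pverts G" "v \<noteq> z" using f0 unfolding Q_def by auto
      then show "2 \<le> degree G v" using degree_ge_2[of v] z n by simp
    qed
    finally have R: "2 * card Q \<le> card ?R" by simp
    have D: "fst a \<notin> Q \<and> snd a \<notin> Q" if a: "a \<in> map_prod f f ` symcl E" for a
    proof -
      obtain i j where ij: "(i, j) \<in> symcl E" "a = (f i, f j)" using a by auto
      then have "i \<le> k" "j \<le> k"
        using ascending_bounds(1,2)[OF ascending_lollipop[OF lk]] unfolding E_def by (meson less_Suc_eq_le)+
      then show ?thesis using ij by (auto simp: Q_def)
    qed
    then have d1: "map_prod f f ` symcl E \<inter> ?R = {}" and d2: "(w, x) \<notin> map_prod f f ` symcl E \<union> ?R"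
      using xw by fastforce+
    have "card (insert (w, x) (map_prod f f ` symcl E \<union> ?R)) = Suc (2 * Suc k + card ?R)"
      using d1 d2 finR cardE by (simp add: card_Un_disjoint)
    moreover have "card (insert (w, x) (map_prod f f ` symcl E \<union> ?R)) \<le> card (parcs G)"
      using sub xw pair_finite_arcs by (intro card_mono) auto
    ultimately show False using arcs n R cardQ by simp
  qed
  then have k: "Suc k = n" using cardQ by simp
  have "pverts G = f ` {..<n}"
    using Q0 fV k unfolding Q_def by (auto simp: lessThan_Suc_atMost)
  moreover have "parcs G = map_prod f f ` symcl E"
    using card_subset_eq[OF pair_finite_arcs sub] cardE arcs n k by simp
  ultimately have "layout f n (lollipop_edges n l) G"
    using inj' k unfolding layout_def E_def by simp
  then show ?thesis using l1 lk k by blast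
qed

text \<open>The transmission of a vertex of the m-cycle. Its closed form, m^2 / 4 rounded down, is
  avoided: a recurrence in steps of two and an upper bound spare the parity split.\<close>

definition cycle_sum :: "nat \<Rightarrow> nat" where
  "cycle_sum m = (\<Sum>t<m. min t (m - t))"

lemma cycle_sum_Suc_Suc: "cycle_sum (Suc (Suc m)) = cycle_sum m + m + 1"
proof -
  have "cycle_sum (Suc (Suc m)) = (\<Sum>t<Suc m. min (Suc t) (Suc m - t))"
    unfolding cycle_sum_def by (subst sum.lessThan_Suc_shift) simp
  also have "\<dots> = (\<Sum>t<m. min (Suc t) (Suc m - t)) + 1" by simp
  also have "(\<Sum>t<m. min (Suc t) (Suc m - t)) = (\<Sum>t<m. min t (m - t) + 1)"
    by (intro sum.cong) (auto simp: Suc_diff_le)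
  finally show ?thesis by (simp add: cycle_sum_def[of m] sum_Suc)
qed

lemma cycle_sum_le: "4 * cycle_sum m \<le> m * m"
proof (induction m rule: less_induct)
  case (less m)
  consider "m = 0" | "m = 1" | k where "m = Suc (Suc k)" by (metis One_nat_def not0_implies_Suc)
  then show ?case
  proof cases
    case (3 k)
    then show ?thesis using less[of k] by (simp add: cycle_sum_Suc_Suc algebra_simps)
  qed (simp_all add: cycle_sum_def)
qed

text \<open>All vertices of a cycle have the same transmission. Indices up to i are reflected by j
  to i - j, the others sent to m + i - j, which exchanges t and m - t.\<close>

lemma sum_cycle_dist:
  assumes "i < m"
  shows "(\<Sum>j<m. min (adiff i j) (m - adiff i j)) = cycle_sum m"
proof -
  let ?c = "\<lambda>t. min t (m - t)"
  have split: "{..<m} = {..i} \<union> {i<..<m}" using assms by auto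
  have "(\<Sum>j<m. ?c (adiff i j)) = (\<Sum>j\<le>i. ?c (adiff i j)) + (\<Sum>j\<in>{i<..<m}. ?c (adiff i j))"
    unfolding split by (intro sum.union_disjoint) auto
  moreover have "(\<Sum>j\<le>i. ?c (adiff i j)) = (\<Sum>t\<le>i. ?c t)"
    by (rule sum.reindex_bij_witness[of _ "\<lambda>t. i - t" "\<lambda>t. i - t"]) (auto simp: adiff_def)
  moreover have "(\<Sum>j\<in>{i<..<m}. ?c (adiff i j)) = (\<Sum>t\<in>{i<..<m}. ?c t)"
    by (rule sum.reindex_bij_witness[of _ "\<lambda>t. m + i - t" "\<lambda>t. m + i - t"])
      (auto simp: adiff_def min_def)
  moreover have "cycle_sum m = (\<Sum>t\<le>i. ?c t) + (\<Sum>t\<in>{i<..<m}. ?c t)"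
    unfolding cycle_sum_def split by (intro sum.union_disjoint) auto
  ultimately show ?thesis by simp
qed

section \<open>Distances and degree distance of a lollipop\<close>

locale lollipop =
  fixes n l m :: nat
  assumes l: "1 \<le> l" and m: "3 \<le> m" and n: "n = l + m"
begin

abbreviation "E \<equiv> lollipop_edges n l"

definition cyc :: "nat \<Rightarrow> nat \<Rightarrow> nat" where
  "cyc i j = min (adiff i j) (m - adiff i j)"

text \<open>The vertices below l form the tail, those from l on the cycle; every path between the
  two passes through the cut vertex l.\<close>

definition ld :: "nat \<Rightarrow> nat \<Rightarrow> nat" where
  "ld i j = (if i < l then if j < l then adiff i j else (l - i) + cyc l j
             else if j < l then (l - j) + cyc l i else cyc i j)"

lemma l3: "l + 3 \<le> n" using m n by simp

lemma edge_cases: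
  assumes "(u, w) \<in> E"
  obtains "w = Suc u" "u < n - 1" | "u = l" "w = n - 1"
  using assms unfolding lollipop_edges_def by auto

lemma cyc_lip: "cyc p (Suc u) \<le> cyc p u + 1" "cyc p u \<le> cyc p (Suc u) + 1"
  using adiff_Suc(3,4)[of p u] unfolding cyc_def by linarith+

lemma cyc_sym: "cyc i j = cyc j i"
  unfolding cyc_def adiff_def by (simp add: add.commute)

lemma cyc_self [simp]: "cyc i i = 0"
  unfolding cyc_def adiff_def by simp

lemma cyc_wrap: "l \<le> p \<Longrightarrow> p < n \<Longrightarrow> cyc p (n - 1) \<le> cyc p l + 1 \<and> cyc p l \<le> cyc p (n - 1) + 1"
  using m n unfolding cyc_def adiff_def min_def by auto

lemma ld_lip:
  assumes "(u, w) \<in> E" "p < n"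
  shows "ld p w \<le> ld p u + 1 \<and> ld p u \<le> ld p w + 1"
  using assms(1)
proof (cases rule: edge_cases)
  case 1
  consider "Suc u < l" | "Suc u = l" | "l \<le> u" by linarith
  then show ?thesis
  proof cases
    case 1
    then show ?thesis
      using \<open>w = Suc u\<close> adiff_Suc(3,4)[of p u] by (cases "p < l") (simp_all add: ld_def, arith+)
  next
    case 2
    then show ?thesis
      using \<open>w = Suc u\<close> by (auto simp: ld_def adiff_def cyc_sym[of p l])
  next
    case 3
    then show ?thesis
      using \<open>w = Suc u\<close> cyc_lip[of p u] cyc_lip[of l u] by (cases "p < l") (simp_all add: ld_def, arith+)
  qed
next
  case 2
  have "l < n" "\<not> n - 1 < l" using n m by auto
  then show ?thesis
    using 2 cyc_wrap[of p] cyc_wrap[of l] assms(2) by (cases "p < l") (simp_all add: ld_def, arith)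
qed

lemma cyc_stepI:
  "adiff p u = Suc (adiff p w) \<Longrightarrow> adiff p u \<le> m - adiff p u \<Longrightarrow> cyc p u = cyc p w + 1"
  "adiff p w = Suc (adiff p u) \<Longrightarrow> m - adiff p u < adiff p u \<Longrightarrow> adiff p u < m \<Longrightarrow> cyc p u = cyc p w + 1"
  "adiff p u + Suc (adiff p w) = m \<Longrightarrow> m - adiff p u < adiff p u \<Longrightarrow> cyc p u = cyc p w + 1"
  unfolding cyc_def by linarith+

text \<open>If the shorter way round follows the numbering (\<open>near\<close>), the closer
  neighbour lies towards p; otherwise (\<open>far\<close>) it lies away from p in the numbering,
  across the closing edge between l and n - 1 at the extremes.\<close>

lemma cyc_pred:
  assumes "l \<le> p" "p < n" "l \<le> u" "u < n" "u \<noteq> p"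
  shows "\<exists>w. l \<le> w \<and> ((w, u) \<in> E \<or> (u, w) \<in> E) \<and> cyc p u = cyc p w + 1"
proof -
  have e: "(i, Suc i) \<in> E" if "i < n - 1" for i using that unfolding lollipop_edges_def by auto
  have wrap: "(l, n - 1) \<in> E" unfolding lollipop_edges_def by auto
  have down: "(u - 1, u) \<in> E" if "0 < u" using e[of "u - 1"] that assms by simp
  consider (near_down) "adiff p u \<le> m - adiff p u" "p < u"
    | (near_up) "adiff p u \<le> m - adiff p u" "u < p"
    | (far_up) "m - adiff p u < adiff p u" "p < u" "u < n - 1"
    | (far_wrap) "m - adiff p u < adiff p u" "p < u" "u = n - 1"
    | (far_down) "m - adiff p u < adiff p u" "u < p" "l < u"
    | (far_wrap') "m - adiff p u < adiff p u" "u < p" "u = l"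
    using assms by linarith
  then show ?thesis
  proof cases
    case near_down
    then have "adiff p u = Suc (adiff p (u - 1))" unfolding adiff_def by auto
    from cyc_stepI(1)[OF this near_down(1)] show ?thesis
      using near_down(2) down assms by (intro exI[of _ "u - 1"]) simp
  next
    case near_up
    then have "adiff p u = Suc (adiff p (Suc u))" unfolding adiff_def by auto
    from cyc_stepI(1)[OF this near_up(1)] show ?thesis
      using near_up assms e[of u] by (intro exI[of _ "Suc u"]) auto
  next
    case far_up
    then have "adiff p (Suc u) = Suc (adiff p u)" "adiff p u < m" unfolding adiff_def using assms n by auto
    from cyc_stepI(2)[OF this(1) far_up(1) this(2)] show ?thesis
      using far_up assms e[of u] by (intro exI[of _ "Suc u"]) auto
  next
    case far_wrap
    then have "adiff p u + Suc (adiff p l) = m" unfolding adiff_def using assms n by auto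
    from cyc_stepI(3)[OF this far_wrap(1)] show ?thesis
      using far_wrap(3) wrap by (intro exI[of _ l]) simp
  next
    case far_down
    then have "adiff p (u - 1) = Suc (adiff p u)" "adiff p u < m" unfolding adiff_def using assms n by auto
    from cyc_stepI(2)[OF this(1) far_down(1) this(2)]
    have "cyc p u = cyc p (u - 1) + 1" .
    moreover have "l \<le> u - 1" "(u - 1, u) \<in> E" using far_down(3) down by simp_all
    ultimately show ?thesis by blast
  next
    case far_wrap'
    then have "adiff p u + Suc (adiff p (n - 1)) = m" unfolding adiff_def using assms n by auto
    from cyc_stepI(3)[OF this far_wrap'(1)] show ?thesis
      using far_wrap'(3) wrap n m by (intro exI[of _ "n - 1"]) simp
  qed
qed

lemma ld_pred:
  assumes "p < n" "u < n" "u \<noteq> p"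
  shows "\<exists>w. ((w, u) \<in> E \<or> (u, w) \<in> E) \<and> ld p u = ld p w + 1"
proof -
  have e: "(i, Suc i) \<in> E" if "i < n - 1" for i using that unfolding lollipop_edges_def by auto
  consider "u < l" "p < u" | "u < l" "u < p" | "u = l" "p < l" | "l < u" "p < l" | "l \<le> u" "l \<le> p"
    using assms by linarith
  then show ?thesis
  proof cases
    case 1
    then show ?thesis using e[of "u - 1"] n by (intro exI[of _ "u - 1"]) (auto simp: ld_def adiff_def)
  next
    case 2
    have "ld p u = ld p (Suc u) + 1"
    proof (cases "Suc u = l")
      case True
      then have "l - u = 1" by simp
      moreover have "\<not> p < l" using 2 True by simp
      ultimately show ?thesis using 2 by (simp add: ld_def True cyc_sym[of p l])
    next
      case False
      then show ?thesis using 2 unfolding ld_def by (auto simp: adiff_def)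
    qed
    then show ?thesis using e[of u] 2 assms by (intro exI[of _ "Suc u"]) auto
  next
    case 3
    then show ?thesis using e[of "u - 1"] n m by (intro exI[of _ "u - 1"]) (auto simp: ld_def adiff_def)
  next
    case 4
    then obtain w where "l \<le> w" "(w, u) \<in> E \<or> (u, w) \<in> E" "cyc l u = cyc l w + 1"
      using cyc_pred[of l u] assms n m by auto
    then show ?thesis using 4 by (intro exI[of _ w]) (simp add: ld_def)
  next
    case 5
    then obtain w where "l \<le> w" "(w, u) \<in> E \<or> (u, w) \<in> E" "cyc p u = cyc p w + 1"
      using cyc_pred[of p u] assms by auto
    then show ?thesis using 5 by (intro exI[of _ w]) (simp add: ld_def)
  qed
qed

lemma gdist_lollipop:
  assumes "layout f n E G" "i < n" "j < n"
  shows "gdist G (f i) (f j) = ld i j"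
  by (rule layout_gdist[OF assms(1) ascending_lollipop[OF l3] assms(2,3)])
    (use ld_lip ld_pred assms(2) in \<open>auto simp: ld_def adiff_def\<close>)

lemma sum_cyc: "l \<le> i \<Longrightarrow> i < n \<Longrightarrow> (\<Sum>j\<in>{l..<n}. cyc i j) = cycle_sum m"
proof -
  assume i: "l \<le> i" "i < n"
  have "(\<Sum>j\<in>{l..<n}. cyc i j) = (\<Sum>j<m. min (adiff (i - l) j) (m - adiff (i - l) j))"
    by (rule sum.reindex_bij_witness[of _ "\<lambda>j. j + l" "\<lambda>j. j - l"])
      (use i n in \<open>auto simp: cyc_def adiff_def\<close>)
  then show ?thesis using sum_cycle_dist[of "i - l" m] i n by simp
qed

lemma sum_split: "(\<Sum>j<n. g j) = (\<Sum>j<l. g j) + (\<Sum>j\<in>{l..<n}. g j)" for g :: "nat \<Rightarrow> int"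
proof -
  have split: "{..<n} = {..<l} \<union> {l..<n}" using n by auto
  show ?thesis unfolding split by (intro sum.union_disjoint) auto
qed

lemma sum_to_l: "2 * (\<Sum>j<l. int (l - j)) = int l * (int l + 1)"
proof -
  have "2 * (\<Sum>j<k. int (k - j)) = int k * (int k + 1)" for k
  proof (induction k)
    case (Suc k)
    have "(\<Sum>j<Suc k. int (Suc k - j)) = int (Suc k) + (\<Sum>j<k. int (k - j))"
      by (subst sum.lessThan_Suc_shift) simp
    then show ?case using Suc by (simp add: algebra_simps)
  qed simp
  then show ?thesis .
qed

lemma transmission_cycle:
  assumes "l \<le> i" "i < n"
  shows "2 * (\<Sum>j<n. int (ld i j)) = int l * (int l + 1) + 2 * int l * int (cyc l i) + 2 * int (cycle_sum m)"
proof -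
  have "(\<Sum>j<l. int (ld i j)) = (\<Sum>j<l. int (l - j) + int (cyc l i))"
    using assms by (intro sum.cong) (auto simp: ld_def)
  then have "(\<Sum>j<l. int (ld i j)) = (\<Sum>j<l. int (l - j)) + int l * int (cyc l i)"
    by (simp only: sum.distrib sum_constant card_lessThan)
  moreover have "(\<Sum>j\<in>{l..<n}. int (ld i j)) = int (cycle_sum m)"
    using assms sum_cyc[OF assms] by (simp add: ld_def flip: of_nat_sum)
  ultimately show ?thesis using sum_to_l sum_split[of "\<lambda>j. int (ld i j)"] by (simp add: algebra_simps)
qed

lemma transmission_tail:
  assumes "i < l"
  shows "(\<Sum>j<n. int (ld i j)) = path_sum (l - 1) i + int m * int (l - i) + int (cycle_sum m)"
proof -
  have atMost: "{..l - 1} = {..<l}" using l by auto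
  have "(\<Sum>j<l. int (ld i j)) = path_sum (l - 1) i"
    unfolding path_sum_def atMost using assms by (intro sum.cong) (auto simp: ld_def)
  moreover have "(\<Sum>j\<in>{l..<n}. int (ld i j)) = int m * int (l - i) + int (cycle_sum m)"
  proof -
    have "(\<Sum>j\<in>{l..<n}. int (ld i j)) = (\<Sum>j\<in>{l..<n}. int (l - i) + int (cyc l j))"
      using assms by (intro sum.cong) (auto simp: ld_def)
    also have "\<dots> = int m * int (l - i) + int (\<Sum>j\<in>{l..<n}. cyc l j)"
      using n by (simp add: sum.distrib)
    also have "(\<Sum>j\<in>{l..<n}. cyc l j) = cycle_sum m" using sum_cyc[of l] n m by simp
    finally show ?thesis .
  qed
  ultimately show ?thesis using sum_split[of "\<lambda>j. int (ld i j)"] by simp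
qed

lemma degree_distance_lollipop:
  assumes f: "layout f n E G"
  defines "L \<equiv> int l" and "M \<equiv> int m" and "q \<equiv> int (cycle_sum m)"
  shows "3 * int (degree_distance G)
    = 2 * (L - 1) * L * (L + 1) + 6 * M * L * (L + 1) + 12 * L * q + 6 * M * q - 3 * (M - 1) * L"
proof -
  let ?D = "\<lambda>i. \<Sum>k<n. int (ld i k)"
  have "degree_distance G = (\<Sum>(i, j)\<in>E. (\<Sum>k<n. ld i k) + (\<Sum>k<n. ld j k))"
    by (rule layout_degree_distance[OF f ascending_lollipop[OF l3]]) (rule gdist_lollipop[OF f])
  then have "int (degree_distance G) = (\<Sum>(i, j)\<in>E. ?D i + ?D j)"
    by (simp add: case_prod_beta)
  also have "\<dots> = (\<Sum>i<n - 1. ?D i + ?D (Suc i)) + (?D l + ?D (n - 1))"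
    using sum_lollipop_edges[OF l3, of "\<lambda>(i, j). ?D i + ?D j"] by simp
  \<comment> \<open>Degree 1 at 0, degree 3 at l, degree 2 elsewhere.\<close>
  also have "\<dots> = 2 * (\<Sum>i\<le>n - 1. ?D i) - ?D 0 + ?D l"
    using sum_path_edges[of ?D "n - 1"] by (simp only:)
  also have "{..n - 1} = {..<n}" using n l by auto
  finally have D: "int (degree_distance G) = 2 * (\<Sum>i<n. ?D i) - ?D 0 + ?D l" .
  have tail: "6 * (\<Sum>i<l. ?D i) = 2 * (L - 1) * L * (L + 1) + 3 * M * L * (L + 1) + 6 * L * q"
  proof -
    have "(\<Sum>i<l. ?D i) = (\<Sum>i<l. path_sum (l - 1) i + M * int (l - i) + q)"
      unfolding M_def q_def by (intro sum.cong) (auto simp: transmission_tail)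
    also have "\<dots> = (\<Sum>i<l. path_sum (l - 1) i) + M * (\<Sum>i<l. int (l - i)) + L * q"
      unfolding L_def by (simp add: sum.distrib sum_distrib_left)
    finally have "6 * (\<Sum>i<l. ?D i) = 2 * (3 * (\<Sum>i<l. path_sum (l - 1) i)) + 3 * M * (2 * (\<Sum>i<l. int (l - i))) + 6 * L * q"
      by simp
    moreover have "{..<l} = {..l - 1}" using l by auto
    then have "3 * (\<Sum>i<l. path_sum (l - 1) i) = (L - 1) * L * (L + 1)"
      using sum_path_sum[of "l - 1"] l unfolding L_def by (simp add: of_nat_diff)
    ultimately show ?thesis unfolding sum_to_l L_def by (simp add: algebra_simps)
  qed
  have cyc: "2 * (\<Sum>i\<in>{l..<n}. ?D i) = M * L * (L + 1) + 2 * L * q + 2 * M * q"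
  proof -
    have "2 * (\<Sum>i\<in>{l..<n}. ?D i) = (\<Sum>i\<in>{l..<n}. 2 * ?D i)" by (rule sum_distrib_left)
    also have "\<dots> = (\<Sum>i\<in>{l..<n}. L * (L + 1) + 2 * L * int (cyc l i) + 2 * q)"
      unfolding L_def q_def by (intro sum.cong refl transmission_cycle) auto
    also have "\<dots> = M * (L * (L + 1)) + 2 * L * int (\<Sum>i\<in>{l..<n}. cyc l i) + 2 * M * q"
      unfolding M_def using n by (simp add: sum.distrib sum_distrib_left)
    also have "(\<Sum>i\<in>{l..<n}. cyc l i) = cycle_sum m" using sum_cyc[of l] n m by simp
    finally show ?thesis unfolding q_def by (simp add: algebra_simps)
  qed
  have "2 * path_sum (l - 1) 0 = (L - 1) * L"
    using path_sum_eq[of 0 "l - 1"] l unfolding L_def by (simp add: power2_eq_square of_nat_diff algebra_simps)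
  then have D0: "2 * ?D 0 = (L - 1) * L + 2 * M * L + 2 * q"
    using transmission_tail[of 0] l unfolding L_def M_def q_def by simp
  have Dl: "2 * ?D l = L * (L + 1) + 2 * q"
    using transmission_cycle[of l] n m unfolding L_def q_def by simp
  have "(\<Sum>i<n. ?D i) = (\<Sum>i<l. ?D i) + (\<Sum>i\<in>{l..<n}. ?D i)" by (rule sum_split)
  then have "2 * (3 * int (degree_distance G))
      = 2 * (6 * (\<Sum>i<l. ?D i)) + 6 * (2 * (\<Sum>i\<in>{l..<n}. ?D i)) - 3 * (2 * ?D 0) + 3 * (2 * ?D l)"
    using D by linarith
  then show ?thesis unfolding tail cyc D0 Dl by (simp add: algebra_simps)
qed

lemma diameter_lollipop:
  assumes f: "layout f n E G" shows "diameter G = l + m div 2"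
proof -
  interpret G: connected_graph G using layout_connected_graph[OF f ascending_lollipop[OF l3]] .
  have V: "pverts G = f ` {..<n}" using f by (simp add: layout_def)
  have cyc: "cyc i j \<le> m div 2" for i j unfolding cyc_def by linarith
  obtain x y where "x \<in> pverts G" "y \<in> pverts G" "gdist G x y = diameter G"
    using G.diameter_attained by blast
  then obtain i j where ij: "i < n" "j < n" "diameter G = ld i j"
    using gdist_lollipop[OF f] V by auto
  have "ld i j \<le> l + m div 2"
    using cyc[of i j] cyc[of l i] cyc[of l j] unfolding ld_def adiff_def by auto
  \<comment> \<open>The pendant vertex and the cycle vertex opposite to l realise the
    diameter.\<close>
  moreover have "ld 0 (l + m div 2) = l + m div 2"
    using l m by (auto simp: ld_def cyc_def adiff_def)
  then have "l + m div 2 \<le> diameter G"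
    using G.gdist_le_diameter[of "f 0" "f (l + m div 2)"] gdist_lollipop[OF f, of 0 "l + m div 2"] V n m
    by auto
  ultimately show ?thesis using ij by simp
qed

lemma pendants_lollipop:
  assumes f: "layout f n E G" shows "card (pendant_vertices G) = 1"
proof -
  interpret G: connected_graph G using layout_connected_graph[OF f ascending_lollipop[OF l3]] .
  note asc = ascending_lollipop[OF l3]
  have inj: "inj_on f {..<n}" and V: "pverts G = f ` {..<n}" using f by (auto simp: layout_def)
  have e: "(i, Suc i) \<in> E" if "i < n - 1" for i using that unfolding lollipop_edges_def by auto
  have deg: "degree G (f i) = 1 \<longleftrightarrow> i = 0" if i: "i < n" for i
  proof
    assume "i = 0"
    then have "{j. (i, j) \<in> symcl E} = {1}"
      using l n m unfolding symcl_iff lollipop_edges_def by auto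
    then show "degree G (f i) = 1" using layout_degree[OF f asc i] by simp
  next
    assume d: "degree G (f i) = 1"
    show "i = 0"
    proof (rule ccontr)
      assume "i \<noteq> 0"
      then have 1: "(i, i - 1) \<in> symcl E" using e[of "i - 1"] i by (simp add: symcl_iff)
      obtain j where 2: "(i, j) \<in> symcl E" "j \<noteq> i - 1"
      proof (cases "i = n - 1")
        case True
        then show thesis using that[of l] l3 unfolding symcl_iff lollipop_edges_def by auto
      next
        case False
        then show thesis using that[of "Suc i"] e[of i] i by (auto simp: symcl_iff)
      qed
      have "card {j. (i, j) \<in> symcl E} = 1" using d layout_degree[OF f asc i] by simp
      then obtain x where "{j. (i, j) \<in> symcl E} = {x}" by (auto simp: card_1_singleton_iff)
      then have "i - 1 = x" "j = x" using 1 2 by blast+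
      then show False using 2 by simp
    qed
  qed
  have "pendant_vertices G = {f 0}"
    using deg n l unfolding pendant_vertices_def V by auto
  then show ?thesis by simp
qed

lemma reverse_degree_distance_lollipop:
  assumes f: "layout f n E G"
  shows "reverse_degree_distance G
    = 2 * (int n - 1) * int n * (int l + int (m div 2)) - int (degree_distance G)"
proof -
  interpret G: connected_graph G using layout_connected_graph[OF f ascending_lollipop[OF l3]] .
  have "card (undirected_edges (parcs G)) = n"
    using G.card_undirected_edges layout_card_parcs[OF f ascending_lollipop[OF l3]]
      card_lollipop_edges[OF l3] by simp
  then show ?thesis
    unfolding reverse_degree_distance_def layout_card_pverts[OF f] diameter_lollipop[OF f] by simp
qed

end

text \<open>Three times the reverse degree distance, with n and the cycle length m as the only
  parameters.\<close>

definition lollipop_rdd :: "nat \<Rightarrow> nat \<Rightarrow> int" where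
  "lollipop_rdd n m = (let N = int n; M = int m; L = N - M; q = int (cycle_sum m) in
     6 * (N - 1) * N * (L + int (m div 2))
     - (2 * (L - 1) * L * (L + 1) + 6 * M * L * (L + 1) + 12 * L * q + 6 * M * q - 3 * (M - 1) * L))"

lemma (in lollipop) rdd_eq:
  assumes "layout f n (lollipop_edges n l) G"
  shows "3 * reverse_degree_distance G = lollipop_rdd n m"
  using reverse_degree_distance_lollipop[OF assms] degree_distance_lollipop[OF assms] n
  unfolding lollipop_rdd_def Let_def by (simp add: algebra_simps)

text \<open>Adding 2 to m raises m div 2 by exactly one, whatever the parity. With L = n - m - 2 and
  q the cycle sum, the difference is 12 m^2 + 6 m + 6 (L + 1)^2 - 12 q, positive because 4 q \<le>
  m^2.\<close>

lemma lollipop_rdd_step: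
  assumes "1 \<le> m" shows "lollipop_rdd n (Suc (Suc m)) < lollipop_rdd n m"
proof -
  define M q L h where "M = int m" and "q = int (cycle_sum m)" and "L = int n - int m - 2"
    and "h = int (m div 2)"
  have N: "int n = L + M + 2" unfolding L_def M_def by simp
  have q: "4 * q \<le> M * M" unfolding q_def M_def using cycle_sum_le[of m]
    by (metis of_nat_le_iff of_nat_mult of_nat_numeral)
  have s: "int (cycle_sum (Suc (Suc m))) = q + M + 1" "int (Suc (Suc m) div 2) = h + 1"
      "int (Suc (Suc m)) = M + 2"
    unfolding q_def M_def h_def by (simp_all add: cycle_sum_Suc_Suc)
  have "lollipop_rdd n m - lollipop_rdd n (Suc (Suc m))
      = 12 * (M * M) + 6 * M + 6 * ((L + 1) * (L + 1)) - 12 * q"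
    unfolding lollipop_rdd_def Let_def s
    unfolding N M_def[symmetric] h_def[symmetric] q_def[symmetric] by (simp add: algebra_simps)
  moreover have "0 \<le> (L + 1) * (L + 1)" "0 \<le> M * M" "1 \<le> M" using assms by (auto simp: M_def)
  ultimately show ?thesis using q by linarith
qed

text \<open>Shortening by two ends at length 3 or 4. These two are compared directly, using n \<ge>
  6.\<close>

lemma lollipop_rdd_less:
  assumes "3 \<le> m" "m \<noteq> 4" "6 \<le> n"
  shows "lollipop_rdd n m < lollipop_rdd n 4"
  using assms(1,2)
proof (induction m rule: less_induct)
  case (less m)
  have c: "cycle_sum 3 = 2" "cycle_sum 4 = 4"
    unfolding cycle_sum_def by (simp_all add: numeral_3_eq_3 numeral_eq_Suc)
  have three: "lollipop_rdd n 3 < lollipop_rdd n 4"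
    using assms(3) unfolding lollipop_rdd_def Let_def c by (simp add: algebra_simps)
  show ?case
  proof (cases "m \<le> 4")
    case True
    then have "m = 3" using less.prems by simp
    then show ?thesis using three by simp
  next
    case False
    then obtain k where k: "m = Suc (Suc k)" "3 \<le> k"
      using that[of "m - 2"] less.prems by simp
    have "lollipop_rdd n m < lollipop_rdd n k" using lollipop_rdd_step[of k n] k by simp
    moreover have "lollipop_rdd n k \<le> lollipop_rdd n 4"
      using less.IH[of k] k by (cases "k = 4") auto
    ultimately show ?thesis by simp
  qed
qed

section \<open>Optimal positions of the cycle and the pendant vertices\<close>

context ear begin

lemma diameter_ear:
  assumes l: "layout f n E G" and path: "\<And>j. j \<in> J \<Longrightarrow> c j < d"
  shows "diameter G = d"
proof -
  interpret G: connected_graph G using layout_connected_graph[OF l ascending_E] .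
  have V: "pverts G = f ` {..<n}" using l by (simp add: layout_def)
  have x: "bd i (d + 1) + 2 \<le> d" if "1 \<le> i" "i < d" for i
    using a that unfolding bd_def adiff_def min_def by auto
  have x': "bd i (d + 1) \<le> d" if "i \<le> d" for i
  proof -
    have "adiff i a + 1 \<le> d" using a that unfolding adiff_def by linarith
    then show ?thesis using that by (simp add: bd_def)
  qed
  \<comment> \<open>A foot inside the path is one step short of each end, which pays for its pendant
    edge: \<open>ad\<close>, \<open>ad1\<close>, \<open>ad2\<close> treat none, one and two pendant
    vertices.\<close>
  have ad: "adiff i j \<le> d" if "i \<le> d" "j \<le> d" for i j
    using that unfolding adiff_def by linarith
  have ad1: "adiff i j + 1 \<le> d" if "i \<le> d" "1 \<le> j" "j < d" for i j
    using that unfolding adiff_def by linarith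
  have ad2: "adiff i j + 2 \<le> d" if "1 \<le> i" "i < d" "1 \<le> j" "j < d" for i j
    using that unfolding adiff_def by linarith
  have le: "ed i j \<le> d" if "i < n" "j < n" for i j
  proof -
    have c': "1 \<le> c j \<and> c j < d" if "d + 1 < j" "j < n" for j
      using c[of j] path[of j] that by auto
    have "bd (foot i) (foot j) + (if i \<le> d + 1 then 0 else 1) + (if j \<le> d + 1 then 0 else 1) \<le> d"
    proof (cases "i \<le> d + 1")
      case i: True
      show ?thesis
      proof (cases "j \<le> d + 1")
        case True
        consider "i \<le> d" "j \<le> d" | "i \<le> d" "j = d + 1" | "i = d + 1" "j \<le> d" | "i = d + 1" "j = d + 1"
          using i True by linarith
        then show ?thesis
        proof cases
          case 1
          then show ?thesis using ad[of i j] by (simp add: foot_def bd_def)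
        next
          case 2
          then show ?thesis using x'[of i] by (simp add: foot_def)
        next
          case 3
          then show ?thesis using x'[of j] bd_sym[of "d + 1" j] by (simp add: foot_def)
        next
          case 4
          then show ?thesis by (simp add: foot_def)
        qed
      next
        case False
        note cj = c'[of j]
        show ?thesis
        proof (cases "i = d + 1")
          case True
          then show ?thesis using cj x[of "c j"] bd_sym[of "d + 1" "c j"] False that by (simp add: foot_def)
        next
          case i': False
          then show ?thesis using cj ad1[of i "c j"] False i that by (simp add: foot_def bd_def)
        qed
      qed
    next
      case i: False
      note ci = c'[of i]
      show ?thesis
      proof (cases "j \<le> d + 1")
        case True
        show ?thesis
        proof (cases "j = d + 1")
          case True
          then show ?thesis using ci x[of "c i"] i that by (simp add: foot_def)
        next
          case False
          moreover have "adiff (c i) j = adiff j (c i)" by (simp add: adiff_def add.commute)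
          ultimately show ?thesis using ci ad1[of j "c i"] True i that by (simp add: foot_def bd_def)
        qed
      next
        case False
        then show ?thesis using ci c'[of j] ad2[of "c i" "c j"] i that by (simp add: foot_def bd_def)
      qed
    qed
    then show ?thesis unfolding ed_def by auto
  qed
  obtain x y where "x \<in> pverts G" "y \<in> pverts G" "gdist G x y = diameter G"
    using G.diameter_attained by blast
  then obtain i j where "i < n" "j < n" "ed i j = diameter G" using gdist_ear[OF l] V by auto
  then have "diameter G \<le> d" using le[of i j] by simp
  moreover have "ed 0 d = d" by (simp add: ed_def foot_def bd_def adiff_def)
  then have "d \<le> diameter G"
    using G.gdist_le_diameter[of "f 0" "f d"] gdist_ear[OF l, of 0 d] V n by auto
  ultimately show ?thesis by simp
qed

lemma pendants_ear:
  assumes l: "layout f n E G" shows "card (pendant_vertices G) = n - d"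
proof -
  have e: "(i, Suc i) \<in> E" if "i < d" for i using that unfolding ear_edges_def base_edges_def by auto
  have inj: "inj_on f {..<n}" and V: "pverts G = f ` {..<n}" using l by (auto simp: layout_def)
  have mult: "degree G (f i) \<noteq> 1"
    if i: "i < n" and jk: "(i, j) \<in> symcl E" "(i, k) \<in> symcl E" "j \<noteq> k" for i j k
  proof
    assume "degree G (f i) = 1"
    then obtain y where "{j. (i, j) \<in> symcl E} = {y}"
      using layout_degree[OF l ascending_E i] by (auto simp: card_1_singleton_iff)
    then have "j = y" "k = y" using jk by blast+
    then show False using jk by simp
  qed
  have single: "degree G (f i) = 1" if i: "i < n" and j: "{j. (i, j) \<in> symcl E} = {j}" for i j
    using layout_degree[OF l ascending_E i] unfolding j by simp
  let ?P = "{0, d} \<union> J"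
  have deg: "degree G (f i) = 1 \<longleftrightarrow> i \<in> ?P" if i: "i < n" for i
  proof
    assume "degree G (f i) = 1"
    show "i \<in> ?P"
    proof (rule ccontr)
      assume "i \<notin> ?P"
      then consider "0 < i" "i < d" | "i = d + 1" using i by fastforce
      then show False
      proof cases
        case 1
        then have "(i, i - 1) \<in> symcl E" "(i, Suc i) \<in> symcl E"
          using e[of i] e[of "i - 1"] by (auto simp: symcl_iff)
        then show False using mult[OF i] \<open>degree G (f i) = 1\<close> by fastforce
      next
        case 2
        then have "(i, a) \<in> symcl E" "(i, b) \<in> symcl E"
          by (auto simp: symcl_iff ear_edges_def base_edges_def)
        then show False using mult[OF i] \<open>degree G (f i) = 1\<close> a by fastforce
      qed
    qed
  next
    assume "i \<in> ?P"
    then consider "i = 0" | "i = d" | "i \<in> J" by auto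
    then show "degree G (f i) = 1"
    proof cases
      case 1
      have "{j. (0, j) \<in> symcl E} = {1}"
        using a c by (fastforce simp: symcl_iff ear_edges_def base_edges_def)
      then show ?thesis using single[OF i] 1 by simp
    next
      case 2
      have "j = d - 1" if "(d, j) \<in> symcl E" for j
        using that a c by (fastforce simp: symcl_iff ear_edges_def base_edges_def)
      moreover have "(d, d - 1) \<in> symcl E" using e[of "d - 1"] a by (simp add: symcl_iff)
      ultimately have "{j. (d, j) \<in> symcl E} = {d - 1}" by blast
      then show ?thesis using single[OF i] 2 by simp
    next
      case 3
      have "j = c i" if "(i, j) \<in> symcl E" for j
        using that a c 3 by (fastforce simp: symcl_iff ear_edges_def base_edges_def)
      moreover have "(i, c i) \<in> symcl E" using 3 by (auto simp: symcl_iff ear_edges_def)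
      ultimately have "{j. (i, j) \<in> symcl E} = {c i}" by blast
      then show ?thesis using single[OF i] by simp
    qed
  qed
  have sub: "?P \<subseteq> {..<n}" using n by auto
  have "pendant_vertices G = f ` ?P"
    using deg sub unfolding pendant_vertices_def V by auto
  then have "card (pendant_vertices G) = card ?P"
    by (simp only: card_image[OF inj_on_subset[OF inj sub]])
  also have "\<dots> = n - d" using a n by (subst card_Un_disjoint) auto
  finally show ?thesis .
qed

lemma reverse_degree_distance_ear:
  assumes l: "layout f n E G" and "diameter G = d"
  shows "reverse_degree_distance G = 2 * (int n - 1) * int n * int d - int (degree_distance G)"
proof -
  interpret G: connected_graph G using layout_connected_graph[OF l ascending_E] .
  have "card (undirected_edges (parcs G)) = n"
    using G.card_undirected_edges layout_card_parcs[OF l ascending_E] card_E by simp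
  then show ?thesis
    unfolding reverse_degree_distance_def layout_card_pverts[OF l] assms(2) by simp
qed

definition h :: int where "h = int n - int d - 2"

text \<open>Everything that depends on n and d alone. It includes the terms of \<open>K\<close>
  common to triangles and squares, so that \<open>\<kappa>\<close> carries the type and position of
  the cycle.\<close>

definition C :: int where
  "C = 2 * (\<Sum>i\<le>d. path_sum d i) - int d * (int d + 2) + h * (2 * int d + int n + 2) + 2 * h * h"

definition \<kappa> :: int where
  "\<kappa> = K - 2 * (\<Sum>i\<le>d. path_sum d i) + int d * (int d + 2)"

lemma card_J: "int (card J) = h" using n unfolding h_def by simp

lemma degree_distance_split:
  assumes "layout f n E G"
  shows "int (degree_distance G) - C
    = \<kappa> + (\<Sum>j\<in>J. \<phi> (c j)) + 2 * (\<Sum>j\<in>J. \<Sum>j'\<in>J. int (bd (c j) (c j')))"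
  using degree_distance_ear[OF assms] unfolding C_def \<kappa>_def h_def by (simp add: algebra_simps)

text \<open>The excess of \<open>\<kappa>\<close>, the excess of each \<open>\<phi>\<close> and the
  distances between feet are nonnegative separately, so equality makes all of them vanish. Doubling
  clears the denominators of the path sums.\<close>

lemma degree_distance_lower:
  assumes l: "layout f n E G" and \<kappa>: "\<kappa>0 \<le> 2 * \<kappa>" and \<mu>: "\<And>j. j \<in> J \<Longrightarrow> \<mu> \<le> \<phi> (c j)"
  shows "\<kappa>0 + 2 * h * \<mu> \<le> 2 * (int (degree_distance G) - C)"
    and "2 * (int (degree_distance G) - C) = \<kappa>0 + 2 * h * \<mu> \<Longrightarrow>
      2 * \<kappa> = \<kappa>0 \<and> (\<forall>j\<in>J. \<phi> (c j) = \<mu>) \<and> (\<forall>j\<in>J. \<forall>j'\<in>J. c j = c j')"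
proof -
  let ?S = "\<Sum>j\<in>J. \<Sum>j'\<in>J. int (bd (c j) (c j'))"
  have eq: "2 * (int (degree_distance G) - C) = 2 * \<kappa> + 2 * (\<Sum>j\<in>J. \<phi> (c j)) + 4 * ?S"
    unfolding degree_distance_split[OF l] by simp
  have S: "0 \<le> ?S" by (intro sum_nonneg) auto
  have \<phi>: "(\<Sum>j\<in>J. \<phi> (c j)) - h * \<mu> = (\<Sum>j\<in>J. \<phi> (c j) - \<mu>)"
    unfolding card_J[symmetric] by (simp add: sum_subtractf)
  have \<phi>0: "0 \<le> (\<Sum>j\<in>J. \<phi> (c j) - \<mu>)" by (intro sum_nonneg) (use \<mu> in auto)
  have assoc: "2 * h * \<mu> = 2 * (h * \<mu>)" by simp
  show "\<kappa>0 + 2 * h * \<mu> \<le> 2 * (int (degree_distance G) - C)"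
    unfolding assoc using eq S \<phi> \<phi>0 \<kappa> by linarith
  assume "2 * (int (degree_distance G) - C) = \<kappa>0 + 2 * h * \<mu>"
  then have 1: "2 * \<kappa> = \<kappa>0" "(\<Sum>j\<in>J. \<phi> (c j) - \<mu>) = 0" "?S = 0"
    unfolding assoc using eq S \<phi> \<phi>0 \<kappa> by linarith+
  have "\<phi> (c j) = \<mu>" if "j \<in> J" for j
    using 1(2) \<mu> that by (subst (asm) sum_nonneg_eq_0_iff) auto
  moreover have "c j = c j'" if "j \<in> J" "j' \<in> J" for j j'
  proof -
    have "(\<Sum>j'\<in>J. int (bd (c j) (c j'))) = 0"
      using 1(3) that by (subst (asm) sum_nonneg_eq_0_iff) (auto intro: sum_nonneg)
    then have "int (bd (c j) (c j')) = 0"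
      using that by (subst (asm) sum_nonneg_eq_0_iff) auto
    then show ?thesis using bd_eq_0[of "c j" "c j'"] c that by auto
  qed
  ultimately show "2 * \<kappa> = \<kappa>0 \<and> (\<forall>j\<in>J. \<phi> (c j) = \<mu>) \<and> (\<forall>j\<in>J. \<forall>j'\<in>J. c j = c j')"
    using 1(1) by blast
qed

lemma degree_distance_const:
  assumes l: "layout f n E G" and "\<And>j. j \<in> J \<Longrightarrow> c j = e"
  shows "2 * (int (degree_distance G) - C) = 2 * \<kappa> + 2 * h * \<phi> e"
  unfolding degree_distance_split[OF l] using assms(2) by (simp flip: card_J)

end

definition ear_graphs :: "nat \<Rightarrow> nat \<Rightarrow> nat \<Rightarrow> nat \<Rightarrow> nat \<Rightarrow> 'a pair_pre_digraph set" where
  "ear_graphs n d a b e = {G. \<exists>f. layout f n (ear_edges n d a b (\<lambda>_. e)) G}"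

lemma ear_edges_cong:
  "(\<And>j. d + 2 \<le> j \<Longrightarrow> j < n \<Longrightarrow> c j = c' j) \<Longrightarrow> ear_edges n d a b c = ear_edges n d a b c'"
  unfolding ear_edges_def by (intro arg_cong2[of _ _ _ _ "(\<union>)"] image_cong) auto

lemma layout_permute:
  assumes l: "layout f n E G" and p: "bij_betw \<pi> {..<n} {..<n}"
    and E: "map_prod \<pi> \<pi> ` symcl E' = symcl E"
  shows "layout (f \<circ> \<pi>) n E' G"
proof -
  have "(f \<circ> \<pi>) ` {..<n} = f ` \<pi> ` {..<n}" by (rule image_comp[symmetric])
  then have "inj_on (f \<circ> \<pi>) {..<n}" "(f \<circ> \<pi>) ` {..<n} = pverts G"
    using l p unfolding layout_def bij_betw_def by (simp_all add: comp_inj_on)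
  moreover have "map_prod (f \<circ> \<pi>) (f \<circ> \<pi>) ` symcl E' = map_prod f f ` (map_prod \<pi> \<pi> ` symcl E')"
    by (simp add: image_image prod.map_comp)
  ultimately show ?thesis using l E unfolding layout_def by simp
qed

text \<open>The symmetries needed, reversal of the path and exchange of twins, are their own
  inverses, so one map serves both inclusions.\<close>

lemma involution_layout:
  assumes l: "layout f n E G" and inv: "\<And>i. i < n \<Longrightarrow> \<pi> i < n \<and> \<pi> (\<pi> i) = i"
    and E: "\<And>i j. (i, j) \<in> E \<Longrightarrow> i < n \<and> j < n \<and> (\<pi> i, \<pi> j) \<in> symcl E'"
    and E': "\<And>i j. (i, j) \<in> E' \<Longrightarrow> (\<pi> i, \<pi> j) \<in> symcl E"
  shows "layout (f \<circ> \<pi>) n E' G"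
proof (rule layout_permute[OF l])
  show "bij_betw \<pi> {..<n} {..<n}"
    by (rule bij_betw_byWitness[of _ \<pi>]) (use inv in auto)
  show "map_prod \<pi> \<pi> ` symcl E' = symcl E"
  proof (intro set_eqI iffI)
    fix e assume "e \<in> map_prod \<pi> \<pi> ` symcl E'"
    then obtain i j where "e = (\<pi> i, \<pi> j)" "(i, j) \<in> E' \<or> (j, i) \<in> E'" by (auto simp: symcl_iff)
    then show "e \<in> symcl E" using E'[of i j] E'[of j i] by (auto simp: symcl_iff)
  next
    fix e assume e: "e \<in> symcl E"
    obtain i j where ij: "e = (i, j)" by (cases e)
    then have "(\<pi> i, \<pi> j) \<in> symcl E'" "i < n" "j < n"
      using e E[of i j] E[of j i] by (auto simp: symcl_iff)
    then show "e \<in> map_prod \<pi> \<pi> ` symcl E'"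
      using inv ij by (intro image_eqI[of _ _ "(\<pi> i, \<pi> j)"]) auto
  qed
qed

text \<open>The path is reversed while the ear vertex and the pendant vertices stay. By e < d the
  foot is a path vertex, so d - e is its mirror image.\<close>

lemma ear_reflect:
  assumes "ear n d a b (\<lambda>_. e)" "e < d" and G: "G \<in> ear_graphs n d a b e"
  shows "G \<in> ear_graphs n d (d - b) (d - a) (d - e)"
proof -
  interpret ear n d a b "\<lambda>_. e" by fact
  obtain f where f: "layout f n (ear_edges n d a b (\<lambda>_. e)) G" using G by (auto simp: ear_graphs_def)
  define \<pi> where "\<pi> i = (if i \<le> d then d - i else i)" for i
  have pi: "\<pi> i = d - i" if "i \<le> d" for i using that by (simp add: \<pi>_def)
  have pi': "\<pi> i = i" if "d < i" for i using that by (simp add: \<pi>_def)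
  have path: "(i, Suc i) \<in> ear_edges n d a' b' c'" if "i < d" for i a' b' c'
    using that unfolding ear_edges_def base_edges_def by auto
  have path': "(d - Suc i, d - i) \<in> ear_edges n d a' b' c'" if "i < d" for i a' b' c'
    using path[of "d - Suc i"] that by (simp add: Suc_diff_Suc)
  have cases: "j = Suc i \<and> i < d \<or> (i = a' \<or> i = b') \<and> j = d + 1 \<or> i = e' \<and> j \<in> J"
    if "(i, j) \<in> ear_edges n d a' b' (\<lambda>_. e')" for i j a' b' e'
    using that unfolding ear_edges_def base_edges_def by auto
  have mem: "(a', d + 1) \<in> ear_edges n d a' b' (\<lambda>_. e')" "(b', d + 1) \<in> ear_edges n d a' b' (\<lambda>_. e')"
      "j \<in> J \<Longrightarrow> (e', j) \<in> ear_edges n d a' b' (\<lambda>_. e')" for a' b' e' j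
    unfolding ear_edges_def base_edges_def by auto
  have "layout (f \<circ> \<pi>) n (ear_edges n d (d - b) (d - a) (\<lambda>_. d - e)) G"
  proof (rule involution_layout[OF f])
    fix i assume "i < n"
    then show "\<pi> i < n \<and> \<pi> (\<pi> i) = i" using n by (auto simp: \<pi>_def)
  next
    fix i j assume ij: "(i, j) \<in> ear_edges n d a b (\<lambda>_. e)"
    then have "(\<pi> i, \<pi> j) \<in> symcl (ear_edges n d (d - b) (d - a) (\<lambda>_. d - e))"
      using cases[OF ij] path' mem a assms(2) by (auto simp: symcl_iff pi pi')
    then show "i < n \<and> j < n \<and> (\<pi> i, \<pi> j) \<in> symcl (ear_edges n d (d - b) (d - a) (\<lambda>_. d - e))"
      using ij ascending_bounds[OF ascending_E, of i j] by (auto simp: symcl_iff)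
  next
    fix i j assume ij: "(i, j) \<in> ear_edges n d (d - b) (d - a) (\<lambda>_. d - e)"
    show "(\<pi> i, \<pi> j) \<in> symcl (ear_edges n d a b (\<lambda>_. e))"
      using cases[OF ij] path' mem a assms(2) by (auto simp: symcl_iff pi pi')
  qed
  then show ?thesis unfolding ear_graphs_def by auto
qed

text \<open>The ear vertex of a square and a + 1 are twins; exchanging them moves a foot at the ear
  vertex onto the path.\<close>

lemma ear_swap:
  assumes "ear n d a (a + 2) (\<lambda>_. d + 1)" and G: "G \<in> ear_graphs n d a (a + 2) (d + 1)"
  shows "G \<in> ear_graphs n d a (a + 2) (a + 1)"
proof -
  interpret ear n d a "a + 2" "\<lambda>_. d + 1" by fact
  obtain f where f: "layout f n (ear_edges n d a (a + 2) (\<lambda>_. d + 1)) G"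
    using G by (auto simp: ear_graphs_def)
  define \<pi> where "\<pi> i = (if i = a + 1 then d + 1 else if i = d + 1 then a + 1 else i)" for i
  have cases: "j = Suc i \<and> i < d \<or> (i = a \<or> i = a + 2) \<and> j = d + 1 \<or> i = e' \<and> j \<in> J"
    if "(i, j) \<in> ear_edges n d a (a + 2) (\<lambda>_. e')" for i j e'
    using that unfolding ear_edges_def base_edges_def by auto
  have path: "(i, Suc i) \<in> ear_edges n d a (a + 2) (\<lambda>_. e')" if "i < d" for i e'
    using that unfolding ear_edges_def base_edges_def by auto
  have mem: "(a, d + 1) \<in> ear_edges n d a (a + 2) (\<lambda>_. e')"
      "(Suc (Suc a), d + 1) \<in> ear_edges n d a (a + 2) (\<lambda>_. e')"
      "j \<in> J \<Longrightarrow> (e', j) \<in> ear_edges n d a (a + 2) (\<lambda>_. e')" for e' j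
    unfolding ear_edges_def base_edges_def by auto
  have image: "(\<pi> i, \<pi> j) \<in> symcl (ear_edges n d a (a + 2) (\<lambda>_. \<pi> e'))"
    if ij: "(i, j) \<in> ear_edges n d a (a + 2) (\<lambda>_. e')" for i j e'
  proof -
    consider "j = Suc i" "i < d" "i \<noteq> a" "i \<noteq> a + 1" | "i = a" "j = Suc a" | "i = Suc a" "j = Suc (Suc a)"
      | "i = a" "j = d + 1" | "i = a + 2" "j = d + 1" | "i = e'" "j \<in> J"
      using cases[OF ij] by force
    then show ?thesis
    proof cases
      case 1
      then show ?thesis using path[of i] a by (simp add: \<pi>_def symcl_iff)
    next
      case 2
      then show ?thesis using mem(1) a by (simp add: \<pi>_def symcl_iff)
    next
      case 3
      then show ?thesis using mem(2) a by (simp add: \<pi>_def symcl_iff)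
    next
      case 4
      then show ?thesis using path[of a] a by (simp add: \<pi>_def symcl_iff)
    next
      case 5
      then show ?thesis using path[of "Suc a"] a by (simp add: \<pi>_def symcl_iff)
    next
      case 6
      then have "\<pi> j = j" using a by (simp add: \<pi>_def)
      then show ?thesis using mem(3)[OF 6(2)] 6 by (simp add: symcl_iff)
    qed
  qed
  have pi: "\<pi> (a + 1) = d + 1" "\<pi> (d + 1) = a + 1" using a by (auto simp: \<pi>_def)
  have "layout (f \<circ> \<pi>) n (ear_edges n d a (a + 2) (\<lambda>_. a + 1)) G"
  proof (rule involution_layout[OF f])
    fix i assume "i < n"
    then show "\<pi> i < n \<and> \<pi> (\<pi> i) = i" using n a by (auto simp: \<pi>_def)
  next
    fix i j assume ij: "(i, j) \<in> ear_edges n d a (a + 2) (\<lambda>_. d + 1)"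
    show "i < n \<and> j < n \<and> (\<pi> i, \<pi> j) \<in> symcl (ear_edges n d a (a + 2) (\<lambda>_. a + 1))"
      using image[OF ij] ij ascending_bounds[OF ascending_E, of i j] unfolding pi by (auto simp: symcl_iff)
  next
    fix i j assume ij: "(i, j) \<in> ear_edges n d a (a + 2) (\<lambda>_. a + 1)"
    show "(\<pi> i, \<pi> j) \<in> symcl (ear_edges n d a (a + 2) (\<lambda>_. d + 1))"
      using image[OF ij] unfolding pi .
  qed
  then show ?thesis unfolding ear_graphs_def by auto
qed

text \<open>Twice the minimal degree distance of the graphs of diameter \<open>d\<close> whose cycle is a triangle or a
  square, respectively, minus a constant depending only on \<open>n\<close> and \<open>d\<close>.\<close>

definition triangle_value :: "nat \<Rightarrow> nat \<Rightarrow> int" where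
  "triangle_value n d = (let D = int d; h = int n - D - 2; Z = D * D + 2 * D in
     3 * Z + 4 * D + 6 + 2 * h * (Z + 5 - D) + (if even d then 6 else 3 + 2 * h))"

definition square_value :: "nat \<Rightarrow> nat \<Rightarrow> int" where
  "square_value n d = (let D = int d; h = int n - D - 2; Z = D * D + 2 * D in
     if odd d then 3 * Z + 27 + 2 * h * (Z + 7 - D)
     else if h = 0 then 3 * Z + 24
     else if h = 1 then 3 * Z + 24 + 2 * (Z + 10 - D)
     else 3 * Z + 36 + 2 * h * (Z + 6 - D))"

section \<open>Minimisation over the positions\<close>

context ear begin

definition Z :: int where "Z = int d * int d + 2 * int d"

lemma four_path_sum: "i \<le> d \<Longrightarrow> 4 * path_sum d i = (2 * int i - int d) * (2 * int i - int d) + Z"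
  using path_sum_eq[of i d] unfolding Z_def power2_eq_square by simp

lemma h_nonneg: "0 \<le> h"
  using n unfolding h_def by simp

lemma square_ge_1: "(y::int) \<noteq> 0 \<Longrightarrow> 1 \<le> y * y"
  by (smt (verit, best) mult_le_cancel_left1 mult_minus_left mult_minus_right zmult_zless_mono2)

lemma square_eq_1: "(y::int) * y = 1 \<Longrightarrow> y = 1 \<or> y = -1"
  by (simp add: square_eq_1_iff)

lemma ear_const: "1 \<le> e \<Longrightarrow> e \<noteq> d \<Longrightarrow> e \<le> d + 1 \<Longrightarrow> ear n d a b (\<lambda>_. e)"
  using a n by unfold_locales auto

lemma min_ab_nonneg: "0 \<le> min_ab i"
  unfolding min_ab_def by simp

text \<open>If \<open>J\<close> is empty, any foot describes the graph; \<open>e0\<close> serves as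
  the foot in that case.\<close>

lemma constant_foot:
  assumes l: "layout f n E G" and same: "\<forall>j\<in>J. \<forall>j'\<in>J. c j = c j'"
    and foot: "\<And>j. j \<in> J \<Longrightarrow> P (c j)" and e: "P e0"
  shows "\<exists>e. P e \<and> G \<in> ear_graphs n d a b e"
proof (cases "J = {}")
  case True
  then have "E = ear_edges n d a b (\<lambda>_. e0)" by (intro ear_edges_cong) auto
  then show ?thesis using l e unfolding ear_graphs_def by auto
next
  case False
  then obtain j where j: "j \<in> J" by blast
  have "E = ear_edges n d a b (\<lambda>_. c j)" 
  proof (rule ear_edges_cong)
    fix i assume "d + 2 \<le> i" "i < n"
    then have "i \<in> J" by simp
    then show "c i = c j" using same j by blast
  qed
  then have "G \<in> ear_graphs n d a b (c j)" using l unfolding ear_graphs_def by auto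
  then show ?thesis using foot[OF j] j by blast
qed

text \<open>\<open>y\<close> equals a + b - d, the displacement of the triangle from the centre of
  the path.\<close>

lemma triangle_kappa:
  assumes "b = a + 1"
  defines "y \<equiv> 2 * int a + 1 - int d"
  shows "2 * \<kappa> = 3 * (y * y + 1 + Z) + 4 * int d + 6"
    and "\<phi> (Suc d) = y * y + 1 + Z + int d + 3"
    and "i \<le> d \<Longrightarrow> \<phi> i = (2 * int i - int d) * (2 * int i - int d) + Z + 5 - int d + 6 * min_ab i"
proof -
  have s: "2 * (path_sum d a + path_sum d b) = y * y + 1 + Z"
    using four_path_sum[of a] four_path_sum[of b] a assms(1) unfolding y_def
    by (simp add: algebra_simps)
  show "2 * \<kappa> = 3 * (y * y + 1 + Z) + 4 * int d + 6"
    unfolding s[symmetric] \<kappa>_def triangle(4)[OF assms(1)] by (simp add: algebra_simps)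
  show "\<phi> (Suc d) = y * y + 1 + Z + int d + 3"
    using triangle(3)[OF assms(1)] s by simp
  show "i \<le> d \<Longrightarrow> \<phi> i = (2 * int i - int d) * (2 * int i - int d) + Z + 5 - int d + 6 * min_ab i"
    using triangle(2)[OF assms(1)] four_path_sum by simp
qed

text \<open>Cycle and feet do not compete. For even d the displacement \<open>y\<close> is odd, so
  at best 1 in absolute value, and a foot can be central; for odd d it is the triangle that can be
  central. Up to reflection the foot d div 2, an end of the triangle edge on the path, attains both
  minima.\<close>

lemma triangle_optimal:
  assumes l: "layout f n E G" and b: "b = a + 1"
  shows "triangle_value n d \<le> 2 * (int (degree_distance G) - C)"
    and "2 * (int (degree_distance G) - C) = triangle_value n d \<Longrightarrow>
      G \<in> ear_graphs n d (d div 2) (d div 2 + 1) (d div 2)"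
proof -
  define y where "y = 2 * int a + 1 - int d"
  define \<epsilon> where "\<epsilon> = (if even d then 0 else 1 :: int)"
  note k = triangle_kappa[OF b, folded y_def]
  have sq: "\<epsilon> \<le> (2 * int i - int d) * (2 * int i - int d)" for i
  proof (cases "even d")
    case False
    then have "2 * int i - int d \<noteq> 0" by presburger
    then show ?thesis using square_ge_1 False by (simp add: \<epsilon>_def)
  qed (simp add: \<epsilon>_def)
  have y2: "1 - \<epsilon> \<le> y * y"
  proof (cases "even d")
    case True
    then have "y \<noteq> 0" unfolding y_def by presburger
    then show ?thesis using square_ge_1 True by (simp add: \<epsilon>_def)
  qed (simp add: \<epsilon>_def)
  have d3: "3 \<le> int d" using a b by simp
  define \<kappa>0 where "\<kappa>0 = 3 * (2 - \<epsilon> + Z) + 4 * int d + 6"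
  define \<mu> where "\<mu> = \<epsilon> + Z + 5 - int d"
  have \<kappa>: "\<kappa>0 \<le> 2 * \<kappa>" using y2 unfolding k(1) \<kappa>0_def by simp
  \<comment> \<open>A foot at the ear vertex loses at least 2 d - 2.\<close>
  have \<phi>x: "\<mu> < \<phi> (Suc d)" using zero_le_square[of y] d3 unfolding k(2) \<mu>_def \<epsilon>_def by (auto simp del: zero_le_square)
  have \<phi>: "\<mu> \<le> \<phi> i" if "i \<le> d" for i
    using sq[of i] min_ab_nonneg[of i] unfolding k(3)[OF that] \<mu>_def by linarith
  have foot: "\<mu> \<le> \<phi> (c j)" if "j \<in> J" for j
    using c[of j] that \<phi>[of "c j"] \<phi>x by (cases "c j = Suc d") auto
  have val: "triangle_value n d = \<kappa>0 + 2 * h * \<mu>"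
    unfolding triangle_value_def Let_def \<kappa>0_def \<mu>_def \<epsilon>_def Z_def h_def by (simp add: algebra_simps)
  show "triangle_value n d \<le> 2 * (int (degree_distance G) - C)"
    unfolding val by (rule degree_distance_lower(1)[OF l \<kappa> foot])
  assume "2 * (int (degree_distance G) - C) = triangle_value n d"
  then have eq: "2 * \<kappa> = \<kappa>0" "\<And>j. j \<in> J \<Longrightarrow> \<phi> (c j) = \<mu>" "\<forall>j\<in>J. \<forall>j'\<in>J. c j = c j'"
    using degree_distance_lower(2)[OF l \<kappa> foot] unfolding val by blast+
  have y: "y * y = 1 - \<epsilon>" using eq(1) unfolding k(1) \<kappa>0_def by simp
  define P where "P e \<longleftrightarrow> 1 \<le> e \<and> e < d \<and> (2 * int e - int d) * (2 * int e - int d) = \<epsilon> \<and> min_ab e = 0" for e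
  have Pc: "P (c j)" if j: "j \<in> J" for j
  proof -
    have "c j \<noteq> Suc d" using eq(2)[OF j] \<phi>x by auto
    then have cj: "1 \<le> c j" "c j < d" using c[of j] j by auto
    then show ?thesis
      using eq(2)[OF j] sq[of "c j"] min_ab_nonneg[of "c j"] k(3)[of "c j"] unfolding P_def \<mu>_def by auto
  qed
  have mid: "2 * int (d div 2) = int d - \<epsilon>" unfolding \<epsilon>_def by (auto simp: zdiv_int) presburger+
  have Pab: "e = a \<or> e = b" if "P e" for e
    using that unfolding P_def min_ab_def by (auto simp: min_def split: if_splits)
  show "G \<in> ear_graphs n d (d div 2) (d div 2 + 1) (d div 2)"
  proof (cases "even d")
    case True
    then have "y = 1 \<or> y = -1" using y square_eq_1 by (simp add: \<epsilon>_def)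
    \<comment> \<open>The triangle has two mirror positions; reflection carries the second to the
      first.\<close>
    then have ab: "a = d div 2 \<or> b = d div 2" using mid True b unfolding y_def \<epsilon>_def by auto
    then have "P (d div 2)" using a mid True unfolding P_def min_ab_def \<epsilon>_def by auto
    then obtain e where e: "P e" "G \<in> ear_graphs n d a b e"
      using constant_foot[where P = P, OF l eq(3) Pc] by blast
    have "e = d div 2" using e(1) mid True unfolding P_def \<epsilon>_def by auto
    from ab show ?thesis
    proof
      assume "a = d div 2"
      then show ?thesis using e b \<open>e = d div 2\<close> by simp
    next
      assume bd: "b = d div 2"
      have "d - b = d div 2" "d - a = d div 2 + 1" "d - e = d div 2"
        using True bd b a \<open>e = d div 2\<close> by presburger+
      moreover have "ear n d a b (\<lambda>_. e)" using e(1) unfolding P_def by (intro ear_const) auto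
      ultimately show ?thesis using ear_reflect[OF _ _ e(2)] e(1) unfolding P_def by metis
    qed
  next
    case False
    then have ad: "a = d div 2" using y mid unfolding y_def \<epsilon>_def by auto
    then have "P a" using a mid False unfolding P_def min_ab_def \<epsilon>_def by auto
    then obtain e where e: "P e" "G \<in> ear_graphs n d a b e"
      using constant_foot[where P = P, OF l eq(3) Pc] by blast
    from Pab[OF e(1)] show ?thesis
    proof
      assume "e = a"
      then show ?thesis using e b ad by simp
    next
      assume eb: "e = b"
      have "d - b = d div 2" "d - a = d div 2 + 1" "d - e = d div 2"
        using False ad b eb by presburger+
      moreover have "ear n d a b (\<lambda>_. e)" using e(1) unfolding P_def by (intro ear_const) auto
      ultimately show ?thesis using ear_reflect[OF _ _ e(2)] e(1) unfolding P_def by metis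
    qed
  qed
qed

lemma square_kappa:
  assumes "b = a + 2"
  defines "k \<equiv> Suc a" and "y \<equiv> 2 * int (Suc a) - int d"
  shows "2 * \<kappa> = 3 * (y * y + Z) + 24"
    and "\<phi> (Suc d) = y * y + Z + 10 - int d"
    and "\<phi> k = y * y + Z + 10 - int d"
    and "i \<le> d \<Longrightarrow> i \<noteq> k \<Longrightarrow> \<phi> i = (2 * int i - int d) * (2 * int i - int d) + Z + 6 * \<bar>int i - int k\<bar> - int d"
proof -
  have s: "4 * path_sum d k = y * y + Z"
    using four_path_sum[of k] a assms(1) unfolding y_def k_def by simp
  show "2 * \<kappa> = 3 * (y * y + Z) + 24"
    unfolding s[symmetric] \<kappa>_def square(5)[OF assms(1)] k_def by (simp add: algebra_simps)
  show "\<phi> (Suc d) = y * y + Z + 10 - int d"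
    using square(4)[OF assms(1)] s unfolding k_def by simp
  show "\<phi> k = y * y + Z + 10 - int d"
    using square(3)[OF assms(1)] s unfolding k_def by simp
  show "i \<le> d \<Longrightarrow> i \<noteq> k \<Longrightarrow> \<phi> i = (2 * int i - int d) * (2 * int i - int d) + Z + 6 * \<bar>int i - int k\<bar> - int d"
    using square(2)[OF assms(1)] four_path_sum unfolding k_def by simp
qed

lemma square_ge_4:
  assumes "2 \<le> \<bar>y :: int\<bar>" shows "4 \<le> y * y"
  using mult_mono[of 2 "\<bar>y\<bar>" 2 "\<bar>y\<bar>"] assms by simp

text \<open>The path has two central vertices. Placing \<open>Suc a\<close> at one and all feet at
  the other minimises both terms, as feet at distance 1 from \<open>Suc a\<close> are the cheapest
  allowed. A foot at \<open>Suc a\<close> or at its twin costs at least 4 more.\<close>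

lemma square_optimal_odd:
  assumes l: "layout f n E G" and b: "b = a + 2" and d: "odd d"
  shows "square_value n d \<le> 2 * (int (degree_distance G) - C)"
    and "2 * (int (degree_distance G) - C) = square_value n d \<Longrightarrow>
      G \<in> ear_graphs n d (d div 2) (d div 2 + 2) (d div 2)"
proof -
  define y where "y = 2 * int (Suc a) - int d"
  note k = square_kappa[OF b, folded y_def]
  define \<kappa>0 where "\<kappa>0 = 3 * (1 + Z) + 24"
  define \<mu> where "\<mu> = Z + 7 - int d"
  have y1: "1 \<le> y * y" unfolding y_def by (rule square_ge_1) (use d in presburger)
  have z1: "1 \<le> (2 * int i - int d) * (2 * int i - int d)" for i
    by (rule square_ge_1) (use d in presburger)
  have \<kappa>: "\<kappa>0 \<le> 2 * \<kappa>" using y1 unfolding k(1) \<kappa>0_def by simp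
  have big: "\<mu> < \<phi> (Suc d)" "\<mu> < \<phi> (Suc a)" using y1 unfolding k(2,3) \<mu>_def by linarith+
  have \<phi>: "\<mu> \<le> \<phi> i" if "i \<le> d" "i \<noteq> Suc a" for i
  proof -
    have "1 \<le> \<bar>int i - int (Suc a)\<bar>" using that(2) by linarith
    then show ?thesis using z1[of i] unfolding k(4)[OF that] \<mu>_def by simp
  qed
  have foot: "\<mu> \<le> \<phi> (c j)" if "j \<in> J" for j
    using c[of j] that \<phi>[of "c j"] big by (cases "c j = Suc d \<or> c j = Suc a") auto
  have val: "square_value n d = \<kappa>0 + 2 * h * \<mu>"
    using d unfolding square_value_def Let_def \<kappa>0_def \<mu>_def Z_def h_def by simp
  show "square_value n d \<le> 2 * (int (degree_distance G) - C)"
    unfolding val by (rule degree_distance_lower(1)[OF l \<kappa> foot])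
  assume "2 * (int (degree_distance G) - C) = square_value n d"
  then have eq: "2 * \<kappa> = \<kappa>0" "\<And>j. j \<in> J \<Longrightarrow> \<phi> (c j) = \<mu>" "\<forall>j\<in>J. \<forall>j'\<in>J. c j = c j'"
    using degree_distance_lower(2)[OF l \<kappa> foot] unfolding val by blast+
  have "y * y = 1" using eq(1) unfolding k(1) \<kappa>0_def by simp
  then have y: "y = 1 \<or> y = -1" by (rule square_eq_1)
  define P where "P e \<longleftrightarrow> 1 \<le> e \<and> e < d \<and> e \<noteq> Suc a \<and> \<bar>2 * int e - int d\<bar> = 1" for e
  have Pc: "P (c j)" if j: "j \<in> J" for j
  proof -
    have ne: "c j \<noteq> Suc d" "c j \<noteq> Suc a" using eq(2)[OF j] big by auto
    then have cj: "1 \<le> c j" "c j < d" using c[of j] j by auto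
    then have "(2 * int (c j) - int d) * (2 * int (c j) - int d) + 6 * \<bar>int (c j) - int (Suc a)\<bar> = 7"
      using eq(2)[OF j] k(4)[of "c j"] ne unfolding \<mu>_def by simp
    moreover have "1 \<le> \<bar>int (c j) - int (Suc a)\<bar>" using ne by linarith
    moreover have "S = 1" if "S + 6 * t = 7" "1 \<le> S" "1 \<le> t" for S t :: int using that by linarith
    ultimately have "(2 * int (c j) - int d) * (2 * int (c j) - int d) = 1" using z1[of "c j"] by blast
    then show ?thesis using square_eq_1[of "2 * int (c j) - int d"] cj ne unfolding P_def by auto
  qed
  have mid: "int d = 2 * int (d div 2) + 1" using d by presburger
  from y show "G \<in> ear_graphs n d (d div 2) (d div 2 + 2) (d div 2)"
  proof
    assume "y = 1"
    then have ad: "a = d div 2" unfolding y_def using mid by simp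
    have "P a" using a b mid unfolding P_def ad by simp
    then obtain e where e: "P e" "G \<in> ear_graphs n d a b e"
      using constant_foot[where P = P, OF l eq(3) Pc] by blast
    have "e = a" using e(1) mid unfolding P_def ad by (auto simp: abs_if split: if_splits)
    then show ?thesis using e(2) b ad by simp
  next
    assume "y = -1"
    then have ad: "Suc a = d div 2" unfolding y_def using mid by simp
    have "P b" using a b mid unfolding P_def ad[symmetric] by simp
    then obtain e where e: "P e" "G \<in> ear_graphs n d a b e"
      using constant_foot[where P = P, OF l eq(3) Pc] by blast
    have eb: "e = b" using e(1) mid b unfolding P_def ad[symmetric] by (auto simp: abs_if split: if_splits)
    have "d - b = d div 2" "d - a = d div 2 + 2" "d - e = d div 2"
      using eb b ad mid by presburger+
    moreover have "ear n d a b (\<lambda>_. e)" using e(1) unfolding P_def by (intro ear_const) auto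
    ultimately show ?thesis using ear_reflect[OF _ _ e(2)] e(1) unfolding P_def by metis
  qed
qed

text \<open>Here cycle and feet compete. With \<open>Suc a\<close> central a foot costs at least Z +
  10 - d; with \<open>Suc a\<close> one step off the centre, a central foot costs Z + 6 - d while
  \<open>2 * \<kappa>\<close> rises from 3 Z + 24 to 3 Z + 36. Shifting costs 12 and saves 8 h. For
  the central square the feet at the centre and next to it tie: the correction at
  \<open>Suc a\<close> offsets the better position.\<close>

lemma square_optimal_even:
  assumes l: "layout f n E G" and b: "b = a + 2" and d: "even d"
  shows "square_value n d \<le> 2 * (int (degree_distance G) - C)"
    and "2 * (int (degree_distance G) - C) = square_value n d \<Longrightarrow>
      if h \<ge> 2 then G \<in> ear_graphs n d (d div 2) (d div 2 + 2) (d div 2)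
      else G \<in> ear_graphs n d (d div 2 - 1) (d div 2 + 1) (d div 2 - 1) \<union>
        ear_graphs n d (d div 2 - 1) (d div 2 + 1) (d div 2)"
proof -
  define y where "y = 2 * int (Suc a) - int d"
  note k = square_kappa[OF b, folded y_def]
  define r where "r = d div 2"
  have r: "d = 2 * r" unfolding r_def using d by simp
  define \<kappa>0 where "\<kappa>0 = (if y = 0 then 3 * Z + 24 else 3 * Z + 36)"
  define \<mu> where "\<mu> = (if y = 0 then Z + 10 - int d else Z + 6 - int d)"
  have y4: "4 \<le> y * y" if "y \<noteq> 0"
    by (rule square_ge_4) (use that r in \<open>unfold y_def, presburger\<close>)
  have z4: "4 \<le> (2 * int i - int d) * (2 * int i - int d)" if "i \<noteq> r" for i
    by (rule square_ge_4) (use that r in presburger)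
  have k0: "y = 0 \<longleftrightarrow> Suc a = r" unfolding y_def r by auto
  have \<kappa>: "\<kappa>0 \<le> 2 * \<kappa>" using y4 unfolding k(1) \<kappa>0_def by auto
  have \<phi>: "\<mu> \<le> \<phi> i" if "i \<le> d" "i \<noteq> Suc a" for i
  proof -
    have i: "1 \<le> \<bar>int i - int (Suc a)\<bar>" using that(2) by linarith
    show ?thesis
    proof (cases "y = 0")
      case True
      then have "4 \<le> (2 * int i - int d) * (2 * int i - int d)" using z4[of i] that(2) k0 by simp
      then show ?thesis using i True unfolding k(4)[OF that] \<mu>_def by simp
    next
      case False
      then show ?thesis using i unfolding k(4)[OF that] \<mu>_def by (simp add: add_increasing)
    qed
  qed
  have \<phi>k: "\<mu> \<le> \<phi> (Suc a)" "\<mu> \<le> \<phi> (Suc d)" using y4 unfolding k(2,3) \<mu>_def by auto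
  have foot: "\<mu> \<le> \<phi> (c j)" if "j \<in> J" for j
    using c[of j] that \<phi>[of "c j"] \<phi>k by (cases "c j = Suc d \<or> c j = Suc a") auto
  have assoc: "2 * h * (Z + 10 - int d) = 2 * h * (Z + 6 - int d) + 8 * h" by (simp add: algebra_simps)
  have val: "square_value n d = (if h = 0 then 3 * Z + 24
     else if h = 1 then 3 * Z + 24 + 2 * (Z + 10 - int d) else 3 * Z + 36 + 2 * h * (Z + 6 - int d))"
    using d unfolding square_value_def Let_def Z_def h_def by simp
  have bound: "square_value n d \<le> \<kappa>0 + 2 * h * \<mu>"
    and tight: "square_value n d = \<kappa>0 + 2 * h * \<mu> \<Longrightarrow> (y = 0 \<longleftrightarrow> h < 2)"
  proof -
    consider "h = 0" | "h = 1" | "2 \<le> h" using h_nonneg by linarith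
    then have "square_value n d \<le> \<kappa>0 + 2 * h * \<mu> \<and>
        (square_value n d = \<kappa>0 + 2 * h * \<mu> \<longrightarrow> (y = 0 \<longleftrightarrow> h < 2))"
    proof cases
      case 3
      then show ?thesis unfolding val \<kappa>0_def \<mu>_def using assoc by auto
    qed (auto simp: val \<kappa>0_def \<mu>_def)
    then show "square_value n d \<le> \<kappa>0 + 2 * h * \<mu>"
      "square_value n d = \<kappa>0 + 2 * h * \<mu> \<Longrightarrow> (y = 0 \<longleftrightarrow> h < 2)" by auto
  qed
  show "square_value n d \<le> 2 * (int (degree_distance G) - C)"
    using bound degree_distance_lower(1)[OF l \<kappa> foot] by linarith
  assume v: "2 * (int (degree_distance G) - C) = square_value n d"
  then have v': "2 * (int (degree_distance G) - C) = \<kappa>0 + 2 * h * \<mu>"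
    using bound degree_distance_lower(1)[OF l \<kappa> foot] by linarith
  then have eq: "2 * \<kappa> = \<kappa>0" "\<And>j. j \<in> J \<Longrightarrow> \<phi> (c j) = \<mu>" "\<forall>j\<in>J. \<forall>j'\<in>J. c j = c j'"
    using degree_distance_lower(2)[OF l \<kappa> foot] by blast+
  have y0: "y = 0 \<longleftrightarrow> h < 2" using tight v v' by simp
  define P where "P e \<longleftrightarrow> 1 \<le> e \<and> e \<noteq> d \<and> e \<le> d + 1 \<and> \<phi> e = \<mu>" for e
  have Pc: "P (c j)" if j: "j \<in> J" for j
    using c[of j] eq(2)[OF j] j unfolding P_def by auto
  show "if h \<ge> 2 then G \<in> ear_graphs n d (d div 2) (d div 2 + 2) (d div 2)
      else G \<in> ear_graphs n d (d div 2 - 1) (d div 2 + 1) (d div 2 - 1) \<union>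
        ear_graphs n d (d div 2 - 1) (d div 2 + 1) (d div 2)"
  proof (cases "h < 2")
    case True
    then have "y = 0" using y0 by simp
    then have ka: "Suc a = r" using k0 by simp
    have "P r" using a b ka \<open>y = 0\<close> k(3) unfolding P_def \<mu>_def by auto
    then obtain e where e: "P e" "G \<in> ear_graphs n d a b e"
      using constant_foot[where P = P, OF l eq(3) Pc] by blast
    have ab: "a = r - 1" "b = r + 1" "d - b = r - 1" "d - a = r + 1" using ka b r by auto
    have ear: "ear n d a b (\<lambda>_. e)" using e(1) unfolding P_def by (intro ear_const) auto
    \<comment> \<open>The minimal feet of the central square are the centre, its twin and the two
      neighbours; symmetry reduces them to r and r - 1.\<close>
    have "e = Suc d \<or> e = r \<or> \<bar>int e - int r\<bar> = 1"
    proof (rule ccontr)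
      assume ne: "\<not> ?thesis"
      then have "e \<le> d" using e(1) unfolding P_def by auto
      then have "(2 * int e - int d) * (2 * int e - int d) + 6 * \<bar>int e - int r\<bar> = 10"
        using e(1) ne ka \<open>y = 0\<close> k(4)[of e] unfolding P_def \<mu>_def by auto
      moreover have "2 \<le> \<bar>int e - int r\<bar>" using ne by auto
      moreover have False if "S + 6 * t = 10" "0 \<le> S" "2 \<le> t" for S t :: int using that by linarith
      ultimately show False using zero_le_square[of "2 * int e - int d"] by blast
    qed
    then consider "e = Suc d" | "e = r" | "e = a" | "e = b" using ka b by linarith
    then have "G \<in> ear_graphs n d (r - 1) (r + 1) (r - 1) \<union> ear_graphs n d (r - 1) (r + 1) r"
    proof cases
      case 1
      then have "G \<in> ear_graphs n d a (a + 2) (a + 1)"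
        using ear_swap[of n d a G] ear e(2) b by simp
      then show ?thesis using ab ka by auto
    next
      case 2
      then show ?thesis using e(2) ab by simp
    next
      case 3
      then show ?thesis using e(2) ab by simp
    next
      case 4
      then have "G \<in> ear_graphs n d (d - b) (d - a) (d - e)" using ear_reflect[OF ear _ e(2)] a by simp
      then show ?thesis using ab 4 by simp
    qed
    then show ?thesis using True unfolding r_def by simp
  next
    case False
    then have "y \<noteq> 0" using y0 by simp
    then have kr: "Suc a \<noteq> r" using k0 by simp
    have "y * y = 4" using eq(1) \<open>y \<noteq> 0\<close> unfolding k(1) \<kappa>0_def by simp
    then have "(y - 2) * (y + 2) = 0" by (simp add: algebra_simps)
    then have y: "y = 2 \<or> y = -2" by auto
    then have ka: "\<bar>int r - int (Suc a)\<bar> = 1" unfolding y_def r by auto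
    have d1: "1 \<le> r" "r < d" using a b r by auto
    have "P r" using k(4)[of r] kr d1 ka \<open>y \<noteq> 0\<close> r unfolding P_def \<mu>_def by auto
    then obtain e where e: "P e" "G \<in> ear_graphs n d a b e"
      using constant_foot[where P = P, OF l eq(3) Pc] by blast
    have "e = r"
    proof (rule ccontr)
      assume ne: "e \<noteq> r"
      have "e \<noteq> Suc d" "e \<noteq> Suc a"
        using e(1) \<open>y * y = 4\<close> \<open>y \<noteq> 0\<close> k(2,3) unfolding P_def \<mu>_def by auto
      moreover have "e \<le> d" using e(1) calculation unfolding P_def by auto
      ultimately have "(2 * int e - int d) * (2 * int e - int d) + 6 * \<bar>int e - int (Suc a)\<bar> = 6"
          "1 \<le> \<bar>int e - int (Suc a)\<bar>"
        using e(1) \<open>y \<noteq> 0\<close> k(4)[of e] unfolding P_def \<mu>_def by auto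
      moreover have False if "S + 6 * t = 6" "4 \<le> S" "1 \<le> t" for S t :: int using that by linarith
      ultimately show False using z4[OF ne] by blast
    qed
    then have er: "G \<in> ear_graphs n d a b r" using e(2) by simp
    from y have "G \<in> ear_graphs n d r (r + 2) r"
    proof
      assume "y = 2"
      then have "a = r" unfolding y_def r by auto
      then show ?thesis using er b by simp
    next
      assume "y = -2"
      then have "a + 2 = r" unfolding y_def r by auto
      then have "d - b = r" "d - a = r + 2" "d - r = r" using b r by auto
      moreover have "ear n d a b (\<lambda>_. r)" using d1 by (intro ear_const) auto
      ultimately show ?thesis using ear_reflect[OF _ _ er] d1 by metis
    qed
    then show ?thesis using False unfolding r_def by simp
  qed
qed

lemma triangle_attained:
  assumes l: "layout f n E G" and ab: "a = d div 2" "b = a + 1" and c: "\<And>j. j \<in> J \<Longrightarrow> c j = a"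
  shows "2 * (int (degree_distance G) - C) = triangle_value n d"
proof -
  have m: "min_ab a = 0" unfolding min_ab_def by simp
  have "even d \<Longrightarrow> int d = 2 * int a" "odd d \<Longrightarrow> int d = 2 * int a + 1" using ab by presburger+
  moreover have "2 * (int (degree_distance G) - C) = 2 * \<kappa> + 2 * h * \<phi> a"
    by (rule degree_distance_const[OF l]) (rule c)
  ultimately show ?thesis
    using a unfolding triangle_kappa(1)[OF ab(2)]
    by (cases "even d") (simp_all add: triangle_kappa(3)[OF ab(2)] m triangle_value_def Let_def Z_def h_def algebra_simps)
qed

lemma square_attained:
  assumes l: "layout f n E G" and ab: "a = d div 2" "b = a + 2" and c: "\<And>j. j \<in> J \<Longrightarrow> c j = a"
    and d: "odd d \<or> 2 \<le> h"
  shows "2 * (int (degree_distance G) - C) = square_value n d"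
proof -
  have "even d \<Longrightarrow> int d = 2 * int a" "odd d \<Longrightarrow> int d = 2 * int a + 1" using ab by presburger+
  moreover have "2 * (int (degree_distance G) - C) = 2 * \<kappa> + 2 * h * \<phi> a"
    by (rule degree_distance_const[OF l]) (rule c)
  ultimately show ?thesis
    using a d unfolding square_kappa(1)[OF ab(2)]
    by (cases "even d") (simp_all add: square_kappa(4)[OF ab(2)] square_value_def Let_def Z_def h_def algebra_simps)
qed

text \<open>Both choices of \<open>e\<close> reach the same value. For h = 1 this tie produces the
  two extremal graphs.\<close>

lemma square_attained_balanced:
  assumes l: "layout f n E G" and ab: "Suc a = d div 2" "b = a + 2"
    and c: "\<And>j. j \<in> J \<Longrightarrow> c j = e" and e: "e = a \<or> e = Suc a" and d: "even d" "h < 2"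
  shows "2 * (int (degree_distance G) - C) = square_value n d"
proof -
  have d2: "int d = 2 * int (Suc a)" using ab d by presburger
  have \<phi>: "\<phi> e = Z + 10 - int d"
    using e a d2 square_kappa(4)[OF ab(2), of a] square_kappa(3)[OF ab(2)] by auto
  have "h = 0 \<or> h = 1" using d(2) h_nonneg by auto
  moreover have "2 * (int (degree_distance G) - C) = 2 * \<kappa> + 2 * h * \<phi> e"
    by (rule degree_distance_const[OF l]) (rule c)
  ultimately show ?thesis
    using d(1) d2 unfolding square_kappa(1)[OF ab(2)] \<phi>
    by (auto simp: square_value_def Let_def Z_def h_def algebra_simps)
qed

end

section \<open>The graphs \<open>U\<close>\<close>

text \<open>Inclusions and counting replace equalities, so for the target graph only upper bounds on
  its size are required.\<close>

lemma layoutI_card: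
  assumes inj: "inj_on f {..<n}" and V: "f ` {..<n} \<subseteq> pverts G" "finite (pverts G)" "card (pverts G) \<le> n"
    and E: "ascending n E" "card E = n" and A: "finite (parcs G)" "card (parcs G) \<le> 2 * n"
    and arc: "\<And>i j. (i, j) \<in> E \<Longrightarrow> (f i, f j) \<in> parcs G \<and> (f j, f i) \<in> parcs G"
  shows "layout f n E G"
proof -
  have "card (f ` {..<n}) = n" using inj by (simp add: card_image)
  then have "pverts G = f ` {..<n}" using card_seteq[OF V(2,1)] V(3) by simp
  moreover obtain H where H: "layout f n E H" using layout_exists[OF inj] by blast
  have "card (map_prod f f ` symcl E) = 2 * n"
    using layout_card_parcs[OF H E(1)] E(2) H by (simp add: layout_def)
  moreover have "map_prod f f ` symcl E \<subseteq> parcs G" using arc by (auto simp: symcl_iff)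
  ultimately show ?thesis using card_seteq[OF A(1)] A(2) inj unfolding layout_def by metis
qed

lemma symcl_Un: "symcl (R \<union> S) = symcl R \<union> symcl S"
  unfolding symcl_def by auto

lemma card_symcl_le: "finite R \<Longrightarrow> card (symcl R) \<le> 2 * card R" "finite R \<Longrightarrow> finite (symcl R)"
  using card_Un_le[of R "(\<lambda>(a, b). (b, a)) ` R"] card_image_le[of R "\<lambda>(a, b). (b, a)"]
  unfolding symcl_def by auto

lemma U_graph_pverts:
  "pverts (U_graph n m d k a b) = Cyc ` {..<m} \<union> PathA ` {1..a} \<union> PathB ` {1..b} \<union> Pend ` {1..num_pendants n m d}"
  unfolding U_graph_def attach_pendants_def attach_path_def cycle_graph_def by simp

definition U_edges :: "nat \<Rightarrow> nat \<Rightarrow> nat \<Rightarrow> nat \<Rightarrow> nat \<Rightarrow> nat \<Rightarrow> (uvert \<times> uvert) set" where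
  "U_edges n m d k a b = (\<lambda>i. (Cyc i, Cyc (Suc i mod m))) ` {..<m}
     \<union> (\<lambda>i. (if i = 1 then Cyc 0 else PathA (i - 1), PathA i)) ` {1..a}
     \<union> (\<lambda>i. (if i = 1 then Cyc (m div 2) else PathB (i - 1), PathB i)) ` {1..b}
     \<union> (\<lambda>i. (Cyc k, Pend i)) ` {1..num_pendants n m d}"

lemma U_graph_parcs: "parcs (U_graph n m d k a b) = symcl (U_edges n m d k a b)"
  unfolding U_graph_def attach_pendants_def attach_path_def cycle_graph_def U_edges_def
  by (simp add: symcl_Un)

lemma U_graph_card:
  "finite (pverts (U_graph n m d k a b))" "finite (parcs (U_graph n m d k a b))"
  "card (pverts (U_graph n m d k a b)) \<le> m + a + b + num_pendants n m d"
  "card (parcs (U_graph n m d k a b)) \<le> 2 * (m + a + b + num_pendants n m d)"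
proof -
  have fin: "finite (U_edges n m d k a b)" unfolding U_edges_def by simp
  show "finite (pverts (U_graph n m d k a b))" unfolding U_graph_pverts by simp
  show "finite (parcs (U_graph n m d k a b))" unfolding U_graph_parcs by (rule card_symcl_le(2)[OF fin])
  have un: "card (A \<union> B \<union> C \<union> D) \<le> card A + card B + card C + card D" for A B C D :: "'b set"
    using card_Un_le[of "A \<union> B \<union> C" D] card_Un_le[of "A \<union> B" C] card_Un_le[of A B] by linarith
  have im: "card (f ` {1..k}) \<le> k" "card (g ` {..<k}) \<le> k" for f g :: "nat \<Rightarrow> 'b" and k
    using card_image_le[of "{1..k}" f] card_image_le[of "{..<k}" g] by auto
  show "card (pverts (U_graph n m d k a b)) \<le> m + a + b + num_pendants n m d"
    unfolding U_graph_pverts by (rule order_trans[OF un]) (intro add_mono im)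
  have "card (U_edges n m d k a b) \<le> m + a + b + num_pendants n m d"
    unfolding U_edges_def by (rule order_trans[OF un]) (intro add_mono im)
  then show "card (parcs (U_graph n m d k a b)) \<le> 2 * (m + a + b + num_pendants n m d)"
    unfolding U_graph_parcs by (intro order_trans[OF card_symcl_le(1)[OF fin]]) simp
qed

lemma U_edges_mem:
  "i < m \<Longrightarrow> (Cyc i, Cyc (Suc i mod m)) \<in> U_edges n m d k a b"
  "1 \<le> a \<Longrightarrow> (Cyc 0, PathA 1) \<in> U_edges n m d k a b"
  "1 \<le> i \<Longrightarrow> Suc i \<le> a \<Longrightarrow> (PathA i, PathA (Suc i)) \<in> U_edges n m d k a b"
  "1 \<le> b \<Longrightarrow> (Cyc (m div 2), PathB 1) \<in> U_edges n m d k a b"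
  "1 \<le> i \<Longrightarrow> Suc i \<le> b \<Longrightarrow> (PathB i, PathB (Suc i)) \<in> U_edges n m d k a b"
  "1 \<le> i \<Longrightarrow> i \<le> num_pendants n m d \<Longrightarrow> (Cyc k, Pend i) \<in> U_edges n m d k a b"
proof -
  show "i < m \<Longrightarrow> (Cyc i, Cyc (Suc i mod m)) \<in> U_edges n m d k a b" 
    unfolding U_edges_def by (rule UnI1, rule UnI1, rule UnI1, rule image_eqI[of _ _ i]) auto
  show "1 \<le> a \<Longrightarrow> (Cyc 0, PathA 1) \<in> U_edges n m d k a b"
    unfolding U_edges_def by (rule UnI1, rule UnI1, rule UnI2, rule image_eqI[of _ _ 1]) auto
  show "1 \<le> i \<Longrightarrow> Suc i \<le> a \<Longrightarrow> (PathA i, PathA (Suc i)) \<in> U_edges n m d k a b"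
    unfolding U_edges_def by (rule UnI1, rule UnI1, rule UnI2, rule image_eqI[of _ _ "Suc i"]) auto
  show "1 \<le> b \<Longrightarrow> (Cyc (m div 2), PathB 1) \<in> U_edges n m d k a b"
    unfolding U_edges_def by (rule UnI1, rule UnI2, rule image_eqI[of _ _ 1]) auto
  show "1 \<le> i \<Longrightarrow> Suc i \<le> b \<Longrightarrow> (PathB i, PathB (Suc i)) \<in> U_edges n m d k a b"
    unfolding U_edges_def by (rule UnI1, rule UnI2, rule image_eqI[of _ _ "Suc i"]) auto
  show "1 \<le> i \<Longrightarrow> i \<le> num_pendants n m d \<Longrightarrow> (Cyc k, Pend i) \<in> U_edges n m d k a b"
    unfolding U_edges_def by (rule UnI2, rule image_eqI[of _ _ i]) auto
qed

text \<open>The cycle length is s + 2, with half s. The first attached path, numbered from its free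
  end, the cycle vertices \<open>Cyc 0\<close>, ..., \<open>Cyc s\<close> and the second attached
  path make up 0, ..., d; the remaining cycle vertex \<open>Cyc (s + 1)\<close> is the ear. So the
  length a is also the position of \<open>Cyc 0\<close>.\<close>

lemma U_graph_layout:
  assumes ear: "ear n d a (a + s) (\<lambda>_. a + k)" and s: "s = 1 \<or> s = 2" and d: "a + b + s = d" and k: "k \<le> s"
  shows "\<exists>f. layout f n (ear_edges n d a (a + s) (\<lambda>_. a + k)) (U_graph n (s + 2) d k a b)"
proof -
  interpret ear n d a "a + s" "\<lambda>_. a + k" by fact
  let ?U = "U_graph n (s + 2) d k a b"
  define f where "f i = (if i < a then PathA (a - i) else if i \<le> a + s then Cyc (i - a)
    else if i \<le> d then PathB (i - a - s) else if i = d + 1 then Cyc (s + 1) else Pend (i - d - 1))" for i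
  have np: "num_pendants n (s + 2) d = n - d - 2" and half: "(s + 2) div 2 = s"
    using s unfolding num_pendants_def by auto
  have total: "s + 2 + a + b + (n - d - 2) = n" using d n by simp
  have "layout f n E ?U"
  proof (rule layoutI_card)
    show "inj_on f {..<n}" by (auto simp: inj_on_def f_def split: if_splits)
    show "f ` {..<n} \<subseteq> pverts ?U"
    proof (rule image_subsetI)
      fix i assume i: "i \<in> {..<n}"
      consider "i < a" "a - i \<in> {1..a}" | "\<not> i < a" "i \<le> a + s" "i - a \<in> {..<s + 2}"
        | "a + s < i" "i \<le> d" "i - a - s \<in> {1..b}" | "i = d + 1" | "d + 1 < i" "i - d - 1 \<in> {1..n - d - 2}"
        using i d by force
      then show "f i \<in> pverts ?U"
        unfolding U_graph_pverts np by cases (use d in \<open>auto simp: f_def\<close>)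
    qed
    show "finite (pverts ?U)" "finite (parcs ?U)" by (rule U_graph_card)+
    show "card (pverts ?U) \<le> n" "card (parcs ?U) \<le> 2 * n"
      using U_graph_card(3,4)[of n "s + 2" d k a b] unfolding np total by auto
    show "ascending n E" "card E = n" by (rule ascending_E, rule card_E)
    fix i j assume ij: "(i, j) \<in> E"
    have "(f i, f j) \<in> U_edges n (s + 2) d k a b \<or> (f j, f i) \<in> U_edges n (s + 2) d k a b"
    proof -
      consider "j = Suc i" "i < d" | "i = a" "j = d + 1" | "i = a + s" "j = d + 1" | "i = a + k" "j \<in> J"
        using ij unfolding ear_edges_def base_edges_def by auto
      then show ?thesis
      proof cases
        case 1
        consider "Suc i < a" | "Suc i = a" | "a \<le> i" "i < a + s" | "i = a + s" | "a + s < i" by linarith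
        then show ?thesis
        proof cases
          case 1
          then have "f i = PathA (Suc (a - Suc i))" "f (Suc i) = PathA (a - Suc i)"
            unfolding f_def by (auto simp: Suc_diff_Suc)
          then show ?thesis using U_edges_mem(3)[of "a - Suc i" a] \<open>j = Suc i\<close> 1 by auto
        next
          case 2
          then have "f i = PathA 1" "f (Suc i) = Cyc 0" unfolding f_def by auto
          then show ?thesis using U_edges_mem(2)[of a] \<open>j = Suc i\<close> 2 by auto
        next
          case 3
          then have "f i = Cyc (i - a)" "f (Suc i) = Cyc (Suc (i - a))"
            unfolding f_def by (auto simp: Suc_diff_le)
          moreover have "Suc (i - a) mod (s + 2) = Suc (i - a)" using 3 by simp
          ultimately show ?thesis using U_edges_mem(1)[of "i - a" "s + 2" n d k a b] \<open>j = Suc i\<close> 3 by auto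
        next
          case 4
          then have "f i = Cyc s" "f (Suc i) = PathB 1" using \<open>i < d\<close> unfolding f_def by auto
          then show ?thesis
            using U_edges_mem(4)[of b "s + 2" n d k a] half \<open>j = Suc i\<close> 4 \<open>i < d\<close> d by simp
        next
          case 5
          then have "f i = PathB (i - a - s)" "f (Suc i) = PathB (Suc (i - a - s))"
            using \<open>i < d\<close> unfolding f_def by (auto simp: Suc_diff_le)
          then show ?thesis
            using U_edges_mem(5)[of "i - a - s" b n "s + 2" d k a] \<open>j = Suc i\<close> 5 \<open>i < d\<close> d by simp
        qed
      next
        case 2
        then have "f i = Cyc 0" "f j = Cyc (s + 1)" using d unfolding f_def by auto
        then show ?thesis using U_edges_mem(1)[of "s + 1" "s + 2" n d k a b] by simp
      next
        case 3
        then have "f i = Cyc s" "f j = Cyc (s + 1)" using d unfolding f_def by auto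
        then show ?thesis using U_edges_mem(1)[of s "s + 2" n d k a b] by simp
      next
        case 4
        then have "f i = Cyc k" "f j = Pend (j - d - 1)" using d k unfolding f_def by auto
        then show ?thesis using U_edges_mem(6)[of "j - d - 1" n "s + 2" d k a b] 4 np by auto
      qed
    qed
    then show "(f i, f j) \<in> parcs ?U \<and> (f j, f i) \<in> parcs ?U"
      unfolding U_graph_parcs by (auto simp: symcl_iff)
  qed
  then show ?thesis by blast
qed

lemma iso_copies_U_graph:
  assumes "ear n d a (a + s) (\<lambda>_. a + k)" "s = 1 \<or> s = 2" "a + b + s = d" "k \<le> s"
  shows "iso_copies (U_graph n (s + 2) d k a b) = ear_graphs n d a (a + s) (a + k)"
proof -
  obtain f where "layout f n (ear_edges n d a (a + s) (\<lambda>_. a + k)) (U_graph n (s + 2) d k a b)"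
    using U_graph_layout[OF assms] ..
  then show ?thesis unfolding ear_graphs_def by (rule iso_copies_layout[OF _ ear.ascending_E[OF assms(1)]])
qed

lemma lollipop_U_graph_layout:
  assumes n: "5 \<le> n"
  shows "\<exists>f. layout f n (lollipop_edges n (n - 4)) (U_graph n 4 (n - 2) 0 (n - 4) 0)"
proof -
  let ?U = "U_graph n 4 (n - 2) 0 (n - 4) 0"
  define f where "f i = (if i < n - 4 then PathA (n - 4 - i) else Cyc (i - (n - 4)))" for i
  have np: "num_pendants n 4 (n - 2) = 0" using n unfolding num_pendants_def by simp
  have l3: "n - 4 + 3 \<le> n" using n by simp
  have "layout f n (lollipop_edges n (n - 4)) ?U"
  proof (rule layoutI_card)
    show "inj_on f {..<n}" by (auto simp: inj_on_def f_def split: if_splits)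
    show "f ` {..<n} \<subseteq> pverts ?U"
    proof (rule image_subsetI)
      fix i assume "i \<in> {..<n}"
      then have "i < n - 4 \<and> n - 4 - i \<in> {1..n - 4} \<or> \<not> i < n - 4 \<and> i - (n - 4) \<in> {..<4}" by auto
      then show "f i \<in> pverts ?U" unfolding U_graph_pverts f_def by auto
    qed
    show "finite (pverts ?U)" "finite (parcs ?U)" by (rule U_graph_card)+
    show "card (pverts ?U) \<le> n" "card (parcs ?U) \<le> 2 * n"
      using U_graph_card(3,4)[of n 4 "n - 2" 0 "n - 4" 0] n unfolding np by auto
    show "ascending n (lollipop_edges n (n - 4))" "card (lollipop_edges n (n - 4)) = n"
      by (rule ascending_lollipop[OF l3], rule card_lollipop_edges[OF l3])
    fix i j assume ij: "(i, j) \<in> lollipop_edges n (n - 4)"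
    have "(f i, f j) \<in> U_edges n 4 (n - 2) 0 (n - 4) 0 \<or> (f j, f i) \<in> U_edges n 4 (n - 2) 0 (n - 4) 0"
    proof -
      consider "j = Suc i" "i < n - 1" | "i = n - 4" "j = n - 1"
        using ij unfolding lollipop_edges_def by auto
      then show ?thesis
      proof cases
        case 1
        consider "Suc i < n - 4" | "Suc i = n - 4" | "n - 4 \<le> i" by linarith
        then show ?thesis
        proof cases
          case 1
          then have "f i = PathA (Suc (n - 4 - Suc i))" "f (Suc i) = PathA (n - 4 - Suc i)"
            unfolding f_def by (auto simp: Suc_diff_Suc)
          then show ?thesis using U_edges_mem(3)[of "n - 4 - Suc i" "n - 4"] \<open>j = Suc i\<close> 1 by auto
        next
          case 2
          then have "f i = PathA 1" "f (Suc i) = Cyc 0" unfolding f_def by auto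
          then show ?thesis using U_edges_mem(2)[of "n - 4"] \<open>j = Suc i\<close> 2 by auto
        next
          case 3
          then have "f i = Cyc (i - (n - 4))" "f (Suc i) = Cyc (Suc (i - (n - 4)))"
            unfolding f_def by (auto simp: Suc_diff_le)
          moreover have "i - (n - 4) < 3" using \<open>i < n - 1\<close> 3 n by simp
          then have "Suc (i - (n - 4)) mod 4 = Suc (i - (n - 4))" by simp
          ultimately show ?thesis
            using U_edges_mem(1)[of "i - (n - 4)" 4 n "n - 2" 0 "n - 4" 0] \<open>j = Suc i\<close> \<open>i - (n - 4) < 3\<close> by simp
        qed
      next
        case 2
        then have "f i = Cyc 0" "f j = Cyc 3" using n unfolding f_def by auto
        then show ?thesis using U_edges_mem(1)[of 3 4 n "n - 2" 0 "n - 4" 0] by simp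
      qed
    qed
    then show "(f i, f j) \<in> parcs ?U \<and> (f j, f i) \<in> parcs ?U"
      unfolding U_graph_parcs by (auto simp: symcl_iff)
  qed
  then show ?thesis by blast
qed

text \<open>With the sum fixed, the difference moves in steps of two; it is maximal as soon as the
  next value violates the bound or t = 0.\<close>

lemma gamma_theta_eqI:
  assumes sum: "g + t = d - m div 2" and le: "real g - real t \<le> alpha n m d + 1"
    and max: "t = 0 \<or> alpha n m d + 1 < real g - real t + 2"
  shows "gamma_theta n m d = (g, t)"
proof -
  let ?P = "\<lambda>(\<gamma>, \<theta>). \<gamma> + \<theta> = d - m div 2 \<and> real \<gamma> - real \<theta> \<le> alpha n m d + 1"
  let ?f = "\<lambda>(\<gamma>, \<theta>). int \<gamma> - int \<theta>"
  have P: "?P (g, t)" using sum le by simp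
  have best: "?f x \<le> ?f (g, t)" if "?P x" for x
  proof -
    obtain \<gamma> \<theta> where x: "x = (\<gamma>, \<theta>)" by (cases x)
    have s: "\<gamma> + \<theta> = g + t" "real \<gamma> - real \<theta> \<le> alpha n m d + 1" using that sum x by auto
    show ?thesis
    proof (rule ccontr)
      assume "\<not> ?thesis"
      then have gt: "int g - int t < int \<gamma> - int \<theta>" using x by simp
      then have "int g - int t + 2 \<le> int \<gamma> - int \<theta>" using s(1) by presburger
      then have "real g - real t + 2 \<le> real \<gamma> - real \<theta>" by linarith
      then have "t = 0" using max s(2) by linarith
      then show False using gt s(1) by linarith
    qed
  qed
  have "is_arg_max ?f ?P (g, t)"
    unfolding is_arg_max_def using P best by (meson linorder_not_less)
  moreover have "x = (g, t)" if x: "is_arg_max ?f ?P x" for x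
  proof -
    have "?P x" "?f (g, t) \<le> ?f x" using x P unfolding is_arg_max_def by (auto simp: not_less)
    then have "?f x = ?f (g, t)" using best by (meson antisym)
    with \<open>?P x\<close> show ?thesis using sum by (cases x) auto
  qed
  ultimately show ?thesis unfolding gamma_theta_def arg_max_def by (rule some_equality)
qed

text \<open>With h = n - d - 2, \<alpha> is h / (h + 3/2) < 1. The difference is therefore at most
  1, and parity fixes it.\<close>

lemma U_opt_3:
  assumes "3 \<le> d" "d + 2 \<le> n"
  shows "U_opt n 3 d = U_graph n 3 d 0 (d div 2) (d - 1 - d div 2)"
proof -
  have np: "real (num_pendants n 3 d) = real n - real d - 2"
    using assms unfolding num_pendants_def by simp
  have "0 \<le> alpha n 3 d" "alpha n 3 d < 1"
    using assms unfolding alpha_def np by (simp_all add: divide_simps)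
  moreover have "d div 2 + (d - 1 - d div 2) = d - 3 div 2" using assms by simp
  moreover have "real (d div 2) - real (d - 1 - d div 2) = (if even d then 1 else 0)"
  proof -
    have "int (d div 2) - int (d - 1 - d div 2) = (if even d then 1 else 0)"
      using assms by (cases "even d") (auto elim!: evenE oddE)
    then show ?thesis by (metis of_int_0 of_int_1 of_int_diff of_int_of_nat_eq)
  qed
  ultimately have "gamma_theta n 3 d = (d div 2, d - 1 - d div 2)"
    by (intro gamma_theta_eqI) auto
  then show ?thesis unfolding U_opt_def by simp
qed

text \<open>With h = n - d - 2, \<alpha> is 2 h / (h + 3/2): below 2 always, and at least 1 exactly
  from h = 2 on. So for even d the difference 2 becomes available at the same threshold at which the
  shifted square wins.\<close>

lemma U_opt_4:
  assumes "4 \<le> d" "d + 2 \<le> n" "odd d \<or> d + 4 \<le> n"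
  shows "U_opt n 4 d = U_graph n 4 d 0 (d div 2) (d - 2 - d div 2)"
proof -
  have np: "real (num_pendants n 4 d) = real n - real d - 2"
    using assms unfolding num_pendants_def by simp
  have 0: "0 \<le> alpha n 4 d" "alpha n 4 d < 2"
    using assms unfolding alpha_def np by (simp_all add: divide_simps)
  moreover have "1 \<le> alpha n 4 d" if "d + 4 \<le> n"
    using that unfolding alpha_def np by (simp add: divide_simps)
  moreover have "d div 2 + (d - 2 - d div 2) = d - 4 div 2" using assms by simp
  moreover have "real (d div 2) - real (d - 2 - d div 2) = (if even d then 2 else 1)"
  proof -
    have "int (d div 2) - int (d - 2 - d div 2) = (if even d then 2 else 1)"
      using assms by (cases "even d") (auto elim!: evenE oddE)
    then show ?thesis by (metis of_int_numeral of_int_1 of_int_diff of_int_of_nat_eq)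
  qed
  ultimately have "gamma_theta n 4 d = (d div 2, d - 2 - d div 2)"
    using assms(3) by (intro gamma_theta_eqI) auto
  then show ?thesis unfolding U_opt_def by simp
qed

lemma U_opt_4_balanced:
  assumes "4 \<le> d" "n = d + 2" "even d"
  shows "U_opt n 4 d = U_graph n 4 d 0 (d div 2 - 1) (d div 2 - 1)"
proof -
  have "alpha n 4 d = 0" using assms unfolding alpha_def num_pendants_def by simp
  then have "gamma_theta n 4 d = (d div 2 - 1, d div 2 - 1)"
    using assms by (intro gamma_theta_eqI) (auto elim!: evenE)
  then show ?thesis unfolding U_opt_def by simp
qed

section \<open>Comparison of diameters\<close>

text \<open>Over a vertex type with too few elements the class and \<open>S\<close> are both empty,
  so \<open>S\<close> has to be nonempty only when the class is.\<close>

lemma max_graphs_eqI: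
  fixes S :: "'a pair_pre_digraph set"
  assumes sub: "\<And>G. G \<in> S \<Longrightarrow> G \<in> unicyclic_class n p \<and> reverse_degree_distance G = r"
    and other: "\<And>G. G \<in> unicyclic_class n p \<Longrightarrow> G \<notin> S \<Longrightarrow> reverse_degree_distance G < r"
    and ne: "(unicyclic_class n p :: 'a pair_pre_digraph set) \<noteq> {} \<Longrightarrow> S \<noteq> {}"
  shows "max_graphs n p = S"
proof (intro set_eqI iffI)
  fix G assume "G \<in> (max_graphs n p :: 'a pair_pre_digraph set)"
  then have G: "G \<in> unicyclic_class n p"
    and max: "\<And>H :: 'a pair_pre_digraph. H \<in> unicyclic_class n p \<Longrightarrow> reverse_degree_distance H \<le> reverse_degree_distance G"
    by (auto simp: max_graphs_def)
  obtain H where "H \<in> S" using ne G by auto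
  then have "r \<le> reverse_degree_distance G" using sub max by metis
  then show "G \<in> S" using other[OF G] by force
next
  fix G assume G: "G \<in> S"
  then show "G \<in> max_graphs n p"
    using sub[OF G] sub other unfolding max_graphs_def by (smt (verit, best) mem_Collect_eq)
qed

lemma unicyclic_class_graph:
  assumes "G \<in> unicyclic_class n p"
  shows "connected_graph G" "card (pverts G) = n" "card (parcs G) = 2 * card (pverts G)"
    "card (pendant_vertices G) = p"
proof -
  have G: "unicyclic G" using assms by (simp add: unicyclic_class_def)
  then show c: "connected_graph G"
    unfolding unicyclic_def by (auto intro!: connected_graph.intro connected_graph_axioms.intro)
  show "card (parcs G) = 2 * card (pverts G)" using connected_graph.unicyclic_iff[OF c] G by simp
qed (use assms in \<open>auto simp: unicyclic_class_def\<close>)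

lemma ear_graphs_class:
  assumes ear: "ear n d a b (\<lambda>_. e)" "e < d" and G: "G \<in> ear_graphs n d a b e"
  shows "G \<in> unicyclic_class n (n - d)" "diameter G = d"
    "reverse_degree_distance G = 2 * (int n - 1) * int n * int d - int (degree_distance G)"
proof -
  interpret ear n d a b "\<lambda>_. e" by fact
  obtain f where f: "layout f n E G" using G by (auto simp: ear_graphs_def)
  show "G \<in> unicyclic_class n (n - d)"
    using layout_unicyclic[OF f ascending_E] card_E layout_card_pverts[OF f] pendants_ear[OF f]
    by (simp add: unicyclic_class_def)
  show "diameter G = d" by (rule diameter_ear[OF f]) (rule ear(2))
  from reverse_degree_distance_ear[OF f this]
  show "reverse_degree_distance G = 2 * (int n - 1) * int n * int d - int (degree_distance G)" .
qed

text \<open>A member of the class supplies n distinct vertices, enough to build the extremal graphs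
  over the same type.\<close>

lemma inj_of_class:
  fixes G :: "'a pair_pre_digraph"
  assumes "G \<in> unicyclic_class n p" shows "\<exists>f :: nat \<Rightarrow> 'a. inj_on f {..<n}"
proof -
  interpret connected_graph G using unicyclic_class_graph(1)[OF assms] .
  obtain f where "bij_betw f {0..<card (pverts G)} (pverts G)"
    using ex_bij_betw_nat_finite[OF pair_finite_verts] by blast
  then show ?thesis using unicyclic_class_graph(2)[OF assms]
    by (auto simp: bij_betw_def lessThan_atLeast0)
qed

lemma ear_graphs_nonempty:
  "(unicyclic_class n p :: 'a pair_pre_digraph set) \<noteq> {} \<Longrightarrow> (ear_graphs n d a b e :: 'a pair_pre_digraph set) \<noteq> {}"
  using inj_of_class layout_exists unfolding ear_graphs_def by fast

text \<open>Six times the reverse degree distance of the best graph of diameter \<open>d\<close> with a triangle.\<close>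

definition triangle_bound :: "nat \<Rightarrow> nat \<Rightarrow> int" where
  "triangle_bound n d = (let N = int n; D = int d; h = N - D - 2 in
     12 * N * (N - 1) * D
     - 2 * (2 * D * (D + 1) * (D + 2) - 3 * D * (D + 2) + 3 * h * (2 * D + N + 2) + 6 * h * h)
     - 3 * triangle_value n d)"

text \<open>Written in D = d and H = n - d - 2, the increment has only nonnegative terms and a
  positive constant.\<close>

lemma triangle_bound_step:
  assumes "d + 3 \<le> n" shows "triangle_bound n d < triangle_bound n (Suc d)"
proof -
  define D H where "D = int d" and "H = int n - int d - 2"
  have nn: "0 \<le> D" "1 \<le> H" "int n = D + H + 2" "int (Suc d) = D + 1" using assms by (auto simp: D_def H_def)
  have "triangle_bound n (Suc d) - triangle_bound n d
      = 6 * (D * D) + 12 * (D * H) + 12 * (H * H) + 30 * D + (if even d then 36 * H + 60 else 48 * H + 36)"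
    unfolding triangle_bound_def triangle_value_def Let_def nn(3,4) D_def[symmetric]
    by (simp add: algebra_simps)
  moreover have "0 < 6 * (D * D) + 12 * (D * H) + 12 * (H * H) + 30 * D + (if even d then 36 * H + 60 else 48 * H + 36)"
    using nn(1,2) by (intro add_nonneg_pos add_nonneg_nonneg) auto
  ultimately show ?thesis by simp
qed

lemma triangle_bound_mono:
  assumes "d \<le> d'" "d' + 2 \<le> n" shows "triangle_bound n d \<le> triangle_bound n d'"
  using assms
proof (induction d' rule: dec_induct)
  case (step k)
  then show ?case using triangle_bound_step[of k n] by simp
qed simp

text \<open>On this scale one more unit of diameter is worth 12 n (n - 1). With D = d and H = n - d
  - 2 the margin over the crude bound comes out as 3 (D - 2 H + 2)^2 + 6 D for even d and as 3 (D -
  2 H + 1) (D - 2 H + 2) + 9 (D - 1) for odd d.\<close>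

lemma (in connected_graph) reverse_degree_distance_crude:
  assumes arcs: "card (parcs G) = 2 * card (pverts G)"
    and n: "card (pverts G) = n" "6 \<le> n" and d: "diameter G = d" "d + 3 \<le> n"
  shows "6 * reverse_degree_distance G < triangle_bound n (Suc d)"
proof -
  define D H where "D = int d" and "H = int n - int d - 2"
  have "0 < d"
  proof (rule ccontr)
    assume "\<not> 0 < d"
    then have z: "gdist G x y = 0" if "x \<in> pverts G" "y \<in> pverts G" for x y
      using gdist_le_diameter[OF that] d by simp
    obtain x where "x \<in> pverts G" using pverts_nonempty by blast
    then have "pverts G \<subseteq> {x}" using z gdist_eq_0_iff by blast
    then have "card (pverts G) \<le> 1" using card_mono[of "{x}" "pverts G"] by simp
    then show False using n by simp
  qed
  then have nn: "1 \<le> D" "1 \<le> H" "int n = D + H + 2" "int (Suc d) = D + 1" "4 \<le> D + H"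
    using d n by (auto simp: D_def H_def)
  have e: "int (card (undirected_edges (parcs G))) = int n"
    using card_undirected_edges arcs n by simp
  have rdd: "reverse_degree_distance G = 2 * (int n - 1) * int n * D - int (degree_distance G)"
    unfolding reverse_degree_distance_def e n d D_def by simp
  define Q where "Q = 2 * D * (D + 1) * (D + 2) + 3 * (H + 1) * (D * D + 2 * D) + 12 * (H + 1) * H
    - 12 * (H + 1) + 9 * int n - 3 * int n * int n"
  have "triangle_bound n (Suc d) - (12 * (int n - 1) * int n * D - 2 * Q)
      = (if even d then 3 * ((D - 2 * H + 2) * (D - 2 * H + 2)) + 6 * D
         else 3 * ((D - 2 * H + 1) * (D - 2 * H + 2)) + 9 * (D - 1))"
    unfolding triangle_bound_def triangle_value_def Let_def Q_def nn(3,4) D_def[symmetric]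
    by (simp add: algebra_simps)
  moreover have "0 < (if even d then 3 * ((D - 2 * H + 2) * (D - 2 * H + 2)) + 6 * D
         else 3 * ((D - 2 * H + 1) * (D - 2 * H + 2)) + 9 * (D - 1))"
  proof (cases "even d")
    case True
    then show ?thesis using nn(1) by (auto intro!: add_nonneg_pos)
  next
    case False
    \<comment> \<open>A product of two consecutive integers is nonnegative.\<close>
    have prod: "0 \<le> (D - 2 * H + 1) * (D - 2 * H + 2)"
      by (cases "D - 2 * H + 1 \<ge> 0") (auto intro: mult_nonneg_nonneg mult_nonpos_nonpos)
    show ?thesis
    proof (cases "D = 1")
      case True
      \<comment> \<open>For D = 1 the linear term vanishes, but n \<ge> 6 gives H \<ge> 3, which
        makes the product positive.\<close>
      then have "0 < (2 * H - 2) * (2 * H - 3)" using nn by (intro mult_pos_pos) auto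
      then show ?thesis using False True by (simp add: algebra_simps)
    next
      case 2: False
      then show ?thesis using prod nn(1) False by (auto intro!: add_nonneg_pos)
    qed
  qed
  moreover have "Q \<le> 3 * int (degree_distance G)"
    using degree_distance_crude_ge[OF arcs] unfolding Q_def n d D_def[symmetric] nn(3) by (simp add: algebra_simps)
  ultimately have "12 * (int n - 1) * int n * D - 6 * int (degree_distance G) < triangle_bound n (Suc d)"
    by linarith
  then show ?thesis unfolding rdd by (simp add: algebra_simps)
qed

text \<open>\<open>S\<close> may consist of triangle graphs, of square graphs or of both, with
  common value \<open>v\<close>. Graphs of smaller diameter lose to the triangle graphs of diameter
  d, hence to \<open>S\<close>, because \<open>v\<close> is at most
  \<open>triangle_value n d\<close>.\<close>

lemma max_graphs_ear:
  fixes S :: "'a pair_pre_digraph set"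
  assumes n: "6 \<le> n" and p: "2 \<le> p" "p + 4 \<le> n" and d: "d = n - p" and v: "v \<le> triangle_value n d"
    and S: "\<And>G. G \<in> S \<Longrightarrow> \<exists>a b e. ear n d a b (\<lambda>_. e) \<and> e < d \<and> G \<in> ear_graphs n d a b e
      \<and> 2 * (int (degree_distance G) - ear.C n d) = v"
    and opt: "\<And>G :: 'a pair_pre_digraph. \<And>f a b c. ear n d a b c \<Longrightarrow> layout f n (ear_edges n d a b c) G \<Longrightarrow>
      v \<le> 2 * (int (degree_distance G) - ear.C n d) \<and> (2 * (int (degree_distance G) - ear.C n d) = v \<longrightarrow> G \<in> S)"
    and ne: "(unicyclic_class n p :: 'a pair_pre_digraph set) \<noteq> {} \<Longrightarrow> S \<noteq> {}"
  shows "max_graphs n p = S"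
proof -
  have p': "p = n - d" and dn: "d + 2 \<le> n" "4 \<le> d" using d p by auto
  define C where "C = ear.C n d"
  define M where "M = 2 * (int n - 1) * int n * int d"
  define w where "w = 2 * (M - C) - v"
  have 2: "2 * reverse_degree_distance G = w" if G: "G \<in> S" for G
  proof -
    obtain a b e where 1: "ear n d a b (\<lambda>_. e)" "e < d" "G \<in> ear_graphs n d a b e"
      "2 * (int (degree_distance G) - C) = v"
      using S[OF G] unfolding C_def by blast
    show ?thesis using ear_graphs_class(3)[OF 1(1-3), folded M_def] 1(4) unfolding w_def by simp
  qed
  have less: "2 * reverse_degree_distance G < w" if G: "G \<in> unicyclic_class n p" "G \<notin> S"
    for G :: "'a pair_pre_digraph"
  proof -
    note g = unicyclic_class_graph[OF G(1)]
    interpret G: connected_graph G by (rule g(1))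
    obtain x y where "x \<in> pverts G" "y \<in> pverts G" "gdist G x y = diameter G"
      using G.diameter_attained by blast
    then obtain u where u: "G.geodesic u (diameter G)" using G.geodesic_ex by metis
    have le: "diameter G \<le> d" using G.length_plus_pendants_le[OF g(3) u] g d by simp
    show ?thesis
    proof (cases "diameter G = d")
      case True
      then have "\<exists>f a b c. ear n d a b c \<and> layout f n (ear_edges n d a b c) G"
        using G.ear_layout_ex[OF g(3) u g(2)] n p d g by simp
      then obtain f a b c where ear: "ear n d a b c" "layout f n (ear_edges n d a b c) G" by blast
      have "v \<noteq> 2 * (int (degree_distance G) - C)" "v \<le> 2 * (int (degree_distance G) - C)"
        using opt[OF ear] G(2) unfolding C_def by auto
      then show ?thesis using ear.reverse_degree_distance_ear[OF ear True, folded M_def] unfolding w_def by simp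
    next
      case False
      then have lt: "diameter G + 3 \<le> n" "Suc (diameter G) \<le> d" using le dn by auto
      have "6 * reverse_degree_distance G < triangle_bound n (Suc (diameter G))"
        by (rule G.reverse_degree_distance_crude[OF g(3,2) n refl lt(1)])
      also have "\<dots> \<le> triangle_bound n d" by (rule triangle_bound_mono[OF lt(2) dn(1)])
      also have "\<dots> \<le> 3 * w"
      proof -
        \<comment> \<open>\<open>ear.C\<close> depends on n and d only, so any admissible instance
          serves to unfold it.\<close>
        have ear0: "ear n d 1 2 (\<lambda>_. 1)" using dn by unfold_locales auto
        have "3 * C = 2 * int d * (int d + 1) * (int d + 2) - 3 * int d * (int d + 2)
            + 3 * (int n - int d - 2) * (2 * int d + int n + 2) + 6 * (int n - int d - 2) * (int n - int d - 2)"
          using sum_path_sum[of d] unfolding C_def ear.C_def[OF ear0] ear.h_def[OF ear0]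
          by (simp add: algebra_simps)
        then show ?thesis using v unfolding w_def M_def triangle_bound_def Let_def by (simp add: algebra_simps)
      qed
      finally show ?thesis by linarith
    qed
  qed
  show ?thesis
  proof (rule max_graphs_eqI[where r = "w div 2"])
    fix G assume G: "G \<in> S"
    then obtain a b e where 1: "ear n d a b (\<lambda>_. e)" "e < d" "G \<in> ear_graphs n d a b e" using S by blast
    show "G \<in> unicyclic_class n p \<and> reverse_degree_distance G = w div 2"
      using ear_graphs_class(1)[OF 1] 2[OF G] p' by simp
  next
    fix G :: "'a pair_pre_digraph" assume G: "G \<in> unicyclic_class n p" "G \<notin> S"
    then have "S \<noteq> {}" using ne by blast
    \<comment> \<open>\<open>w\<close> is twice a value attained in \<open>S\<close>, so
      \<open>w div 2\<close> loses nothing.\<close>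
    then have "even w" using 2 by (metis all_not_in_conv dvd_triv_left)
    then show "reverse_degree_distance G < w div 2" using less[OF G] by auto
  qed (rule ne)
qed

section \<open>The extremal graphs\<close>

lemma max_graphs_one_pendant:
  assumes n: "6 \<le> n"
  shows "(max_graphs n 1 :: 'a pair_pre_digraph set) = iso_copies (U_graph n 4 (n - 2) 0 (n - 4) 0)"
proof -
  have n5: "5 \<le> n" using n by simp
  obtain f where "layout f n (lollipop_edges n (n - 4)) (U_graph n 4 (n - 2) 0 (n - 4) 0)"
    using lollipop_U_graph_layout[OF n5] ..
  then have iso: "iso_copies (U_graph n 4 (n - 2) 0 (n - 4) 0)
      = {G :: 'a pair_pre_digraph. \<exists>g. layout g n (lollipop_edges n (n - 4)) G}"
    by (rule iso_copies_layout) (rule ascending_lollipop, use n in simp)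
  interpret four: lollipop n "n - 4" 4 by unfold_locales (use n in auto)
  show ?thesis
    unfolding iso
  proof (rule max_graphs_eqI[where r = "lollipop_rdd n 4 div 3"])
    fix G :: "'a pair_pre_digraph"
    assume "G \<in> {G. \<exists>g. layout g n (lollipop_edges n (n - 4)) G}"
    then obtain g where g: "layout g n (lollipop_edges n (n - 4)) G" by blast
    have "G \<in> unicyclic_class n 1"
      using layout_unicyclic[OF g ascending_lollipop[OF four.l3]] card_lollipop_edges[OF four.l3]
        layout_card_pverts[OF g] four.pendants_lollipop[OF g]
      by (simp add: unicyclic_class_def)
    moreover have "reverse_degree_distance G = lollipop_rdd n 4 div 3"
      using four.rdd_eq[OF g] by simp
    ultimately show "G \<in> unicyclic_class n 1 \<and> reverse_degree_distance G = lollipop_rdd n 4 div 3" ..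
  next
    fix G :: "'a pair_pre_digraph"
    assume G: "G \<in> unicyclic_class n 1" and nin: "G \<notin> {G. \<exists>g. layout g n (lollipop_edges n (n - 4)) G}"
    note g = unicyclic_class_graph[OF G]
    interpret G: connected_graph G by (rule g(1))
    obtain f l where l: "1 \<le> l" "l + 3 \<le> n" and f: "layout f n (lollipop_edges n l) G"
      using G.lollipop_layout_ex[OF g(3,4,2)] n by auto
    define m where "m = n - l"
    interpret tail: lollipop n l m by unfold_locales (use l in \<open>auto simp: m_def\<close>)
    have "m \<noteq> 4"
    proof
      assume "m = 4"
      then have "l = n - 4" using n l(2) by (simp add: m_def)
      then show False using f nin by blast
    qed
    then have "3 * reverse_degree_distance G < lollipop_rdd n 4"
      unfolding tail.rdd_eq[OF f] using lollipop_rdd_less[OF tail.m _ n] by simp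
    \<comment> \<open>A lollipop with cycle length 4 on the same vertices shows that 3 divides
      \<open>lollipop_rdd n 4\<close>.\<close>
    moreover obtain H :: "'a pair_pre_digraph" where "layout f n (lollipop_edges n (n - 4)) H"
      using layout_exists[of f n "lollipop_edges n (n - 4)"] f by (auto simp: layout_def)
    then have "3 dvd lollipop_rdd n 4" using four.rdd_eq by (metis dvd_triv_left)
    ultimately show "reverse_degree_distance G < lollipop_rdd n 4 div 3" by auto
  next
    assume "(unicyclic_class n 1 :: 'a pair_pre_digraph set) \<noteq> {}"
    then show "{G :: 'a pair_pre_digraph. \<exists>g. layout g n (lollipop_edges n (n - 4)) G} \<noteq> {}"
      using inj_of_class layout_exists by fast
  qed
qed

section \<open>The triangle and square families compared\<close>

definition triangle_graphs :: "nat \<Rightarrow> nat \<Rightarrow> 'a pair_pre_digraph set" where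
  "triangle_graphs n d = ear_graphs n d (d div 2) (d div 2 + 1) (d div 2)"

text \<open>d + 4 \<le> n means at least two pendant vertices off the path ends. With fewer and d
  even, the square stays central and both feet are optimal.\<close>

definition square_graphs :: "nat \<Rightarrow> nat \<Rightarrow> 'a pair_pre_digraph set" where
  "square_graphs n d = (if odd d \<or> d + 4 \<le> n then ear_graphs n d (d div 2) (d div 2 + 2) (d div 2)
     else ear_graphs n d (d div 2 - 1) (d div 2 + 1) (d div 2 - 1) \<union>
       ear_graphs n d (d div 2 - 1) (d div 2 + 1) (d div 2))"

lemma ear_triangle: "3 \<le> d \<Longrightarrow> d + 2 \<le> n \<Longrightarrow> ear n d (d div 2) (d div 2 + 1) (\<lambda>_. d div 2)"
  by unfold_locales auto

text \<open>d \<ge> 5 keeps d div 2 + 2, the far end of the ear, away from the path end d.\<close>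

lemma ear_square: "5 \<le> d \<Longrightarrow> d + 2 \<le> n \<Longrightarrow> ear n d (d div 2) (d div 2 + 2) (\<lambda>_. d div 2)"
  by unfold_locales auto

lemma ear_square_balanced:
  "4 \<le> d \<Longrightarrow> d + 2 \<le> n \<Longrightarrow> e = d div 2 - 1 \<or> e = d div 2 \<Longrightarrow> ear n d (d div 2 - 1) (d div 2 + 1) (\<lambda>_. e)"
  by unfold_locales auto

lemma ear_optimal:
  assumes "ear n d a b c" and l: "layout f n (ear_edges n d a b c) G"
  shows "triangle_value n d \<le> 2 * (int (degree_distance G) - ear.C n d)
      \<and> (2 * (int (degree_distance G) - ear.C n d) = triangle_value n d \<longrightarrow> G \<in> triangle_graphs n d)
    \<or> square_value n d \<le> 2 * (int (degree_distance G) - ear.C n d)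
      \<and> (2 * (int (degree_distance G) - ear.C n d) = square_value n d \<longrightarrow> G \<in> square_graphs n d)"
proof -
  interpret ear n d a b c by fact
  have h: "h \<ge> 2 \<longleftrightarrow> d + 4 \<le> n" unfolding h_def by auto
  consider "b = a + 1" | "b = a + 2" "odd d" | "b = a + 2" "even d" using a by linarith
  then show ?thesis
  proof cases
    case 1
    then show ?thesis using triangle_optimal[OF l] unfolding triangle_graphs_def by blast
  next
    case 2
    then show ?thesis using square_optimal_odd[OF l] unfolding square_graphs_def by simp
  next
    case 3
    note opt = square_optimal_even[OF l 3]
    show ?thesis
    proof (rule disjI2, rule conjI[OF opt(1)], rule impI)
      assume "2 * (int (degree_distance G) - C) = square_value n d"
      from opt(2)[OF this] show "G \<in> square_graphs n d"
        using 3(2) unfolding square_graphs_def h by (simp split: if_splits)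
    qed
  qed
qed

lemma triangle_graphs_value:
  assumes "3 \<le> d" "d + 2 \<le> n" "G \<in> triangle_graphs n d"
  shows "\<exists>a b e. ear n d a b (\<lambda>_. e) \<and> e < d \<and> G \<in> ear_graphs n d a b e
    \<and> 2 * (int (degree_distance G) - ear.C n d) = triangle_value n d"
proof -
  interpret ear n d "d div 2" "d div 2 + 1" "\<lambda>_. d div 2" using ear_triangle assms by blast
  obtain f where "layout f n E G" using assms(3) unfolding triangle_graphs_def ear_graphs_def by blast
  from triangle_attained[OF this] show ?thesis
    using assms ear_triangle[of d n] unfolding triangle_graphs_def
    by (intro exI[of _ "d div 2"] exI[of _ "d div 2 + 1"]) auto
qed

lemma square_graphs_value:
  assumes d: "4 \<le> d" "odd d \<or> d + 4 \<le> n \<Longrightarrow> 5 \<le> d" and n: "d + 2 \<le> n" and G: "G \<in> square_graphs n d"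
  shows "\<exists>a b e. ear n d a b (\<lambda>_. e) \<and> e < d \<and> G \<in> ear_graphs n d a b e
    \<and> 2 * (int (degree_distance G) - ear.C n d) = square_value n d"
proof (cases "odd d \<or> d + 4 \<le> n")
  case True
  have ear: "ear n d (d div 2) (d div 2 + 2) (\<lambda>_. d div 2)" using ear_square d(2)[OF True] n by blast
  interpret ear n d "d div 2" "d div 2 + 2" "\<lambda>_. d div 2" by (rule ear)
  have G': "G \<in> ear_graphs n d (d div 2) (d div 2 + 2) (d div 2)" using G True by (simp add: square_graphs_def)
  then obtain f where "layout f n E G" unfolding ear_graphs_def by blast
  from square_attained[OF this] have "2 * (int (degree_distance G) - C) = square_value n d"
    using True by (simp add: h_def) auto
  then show ?thesis using ear G' d by (intro exI[of _ "d div 2"] exI[of _ "d div 2 + 2"]) auto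
next
  case False
  then obtain e where e: "e = d div 2 - 1 \<or> e = d div 2" "G \<in> ear_graphs n d (d div 2 - 1) (d div 2 + 1) e"
    using G unfolding square_graphs_def by auto
  have ear: "ear n d (d div 2 - 1) (d div 2 + 1) (\<lambda>_. e)" using ear_square_balanced[OF d(1) n e(1)] .
  interpret ear n d "d div 2 - 1" "d div 2 + 1" "\<lambda>_. e" by (rule ear)
  obtain f where f: "layout f n E G" using e(2) unfolding ear_graphs_def by blast
  have "2 * (int (degree_distance G) - C) = square_value n d"
    by (rule square_attained_balanced[OF f, of e]) (use e(1) d(1) False in \<open>auto simp: h_def\<close>)
  then show ?thesis using ear e d(1) by (intro exI[of _ "d div 2 - 1"] exI[of _ "d div 2 + 1"] exI[of _ e]) auto
qed

context
  fixes n p d :: nat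
  assumes n: "6 \<le> n" and p: "2 \<le> p" "p + 4 \<le> n" and d: "d = n - p"
begin

lemma d_bounds: "4 \<le> d" "d + 2 \<le> n" "n - p = d"
  using p d by auto

lemma triangle_graphs_nonempty:
  "(unicyclic_class n p :: 'a pair_pre_digraph set) \<noteq> {} \<Longrightarrow> (triangle_graphs n d :: 'a pair_pre_digraph set) \<noteq> {}"
  unfolding triangle_graphs_def by (rule ear_graphs_nonempty)

lemma max_graphs_triangle:
  assumes "triangle_value n d < square_value n d"
  shows "(max_graphs n p :: 'a pair_pre_digraph set) = triangle_graphs n d"
proof (rule max_graphs_ear[OF n p d order_refl _ _ triangle_graphs_nonempty])
  show "\<exists>a b e. ear n d a b (\<lambda>_. e) \<and> e < d \<and> G \<in> ear_graphs n d a b e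
      \<and> 2 * (int (degree_distance G) - ear.C n d) = triangle_value n d"
    if "G \<in> triangle_graphs n d" for G :: "'a pair_pre_digraph"
    using triangle_graphs_value[OF _ _ that] d_bounds by simp
  show "triangle_value n d \<le> 2 * (int (degree_distance G) - ear.C n d)
      \<and> (2 * (int (degree_distance G) - ear.C n d) = triangle_value n d \<longrightarrow> G \<in> triangle_graphs n d)"
    if "ear n d a b c" "layout f n (ear_edges n d a b c) G" for G :: "'a pair_pre_digraph" and f a b c
    using ear_optimal[OF that] assms by linarith
qed

lemma max_graphs_square:
  assumes "square_value n d < triangle_value n d" "odd d \<or> d + 4 \<le> n \<Longrightarrow> 5 \<le> d"
  shows "(max_graphs n p :: 'a pair_pre_digraph set) = square_graphs n d"
proof (rule max_graphs_ear[OF n p d less_imp_le[OF assms(1)]])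
  show "\<exists>a b e. ear n d a b (\<lambda>_. e) \<and> e < d \<and> G \<in> ear_graphs n d a b e
      \<and> 2 * (int (degree_distance G) - ear.C n d) = square_value n d"
    if "G \<in> square_graphs n d" for G :: "'a pair_pre_digraph"
    using square_graphs_value[OF _ assms(2) _ that] d_bounds by simp
  show "square_value n d \<le> 2 * (int (degree_distance G) - ear.C n d)
      \<and> (2 * (int (degree_distance G) - ear.C n d) = square_value n d \<longrightarrow> G \<in> square_graphs n d)"
    if "ear n d a b c" "layout f n (ear_edges n d a b c) G" for G :: "'a pair_pre_digraph" and f a b c
    using ear_optimal[OF that] assms(1) by linarith
  show "square_graphs n d \<noteq> ({} :: 'a pair_pre_digraph set)"
    if "(unicyclic_class n p :: 'a pair_pre_digraph set) \<noteq> {}"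
    using ear_graphs_nonempty[OF that] unfolding square_graphs_def by simp
qed

lemma max_graphs_both:
  assumes "square_value n d = triangle_value n d" "odd d \<or> d + 4 \<le> n \<Longrightarrow> 5 \<le> d"
  shows "(max_graphs n p :: 'a pair_pre_digraph set) = triangle_graphs n d \<union> square_graphs n d"
proof (rule max_graphs_ear[OF n p d order_refl])
  show "\<exists>a b e. ear n d a b (\<lambda>_. e) \<and> e < d \<and> G \<in> ear_graphs n d a b e
      \<and> 2 * (int (degree_distance G) - ear.C n d) = triangle_value n d"
    if "G \<in> triangle_graphs n d \<union> square_graphs n d" for G :: "'a pair_pre_digraph"
    using that
  proof
    assume "G \<in> triangle_graphs n d"
    then show ?thesis using triangle_graphs_value[of d n G] d_bounds by simp
  next
    assume G: "G \<in> square_graphs n d"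
    show ?thesis using square_graphs_value[OF _ assms(2) _ G] d_bounds unfolding assms(1) by simp
  qed
  show "triangle_value n d \<le> 2 * (int (degree_distance G) - ear.C n d)
      \<and> (2 * (int (degree_distance G) - ear.C n d) = triangle_value n d \<longrightarrow> G \<in> triangle_graphs n d \<union> square_graphs n d)"
    if "ear n d a b c" "layout f n (ear_edges n d a b c) G" for G :: "'a pair_pre_digraph" and f a b c
    using ear_optimal[OF that] unfolding assms(1) by blast
  show "triangle_graphs n d \<union> square_graphs n d \<noteq> ({} :: 'a pair_pre_digraph set)"
    if "(unicyclic_class n p :: 'a pair_pre_digraph set) \<noteq> {}"
    using triangle_graphs_nonempty[OF that] by simp
qed

lemma iso_copies_U_opt_3: "(iso_copies (U_opt n 3 d) :: 'a pair_pre_digraph set) = triangle_graphs n d"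
proof -
  have "(iso_copies (U_graph n (1 + 2) d 0 (d div 2) (d - 1 - d div 2)) :: 'a pair_pre_digraph set)
      = ear_graphs n d (d div 2) (d div 2 + 1) (d div 2 + 0)"
    by (rule iso_copies_U_graph) (use d_bounds ear_triangle[of d n] in auto)
  moreover have "1 + 2 = (3 :: nat)" "d div 2 + 0 = d div 2" by simp_all
  moreover have "U_opt n 3 d = U_graph n 3 d 0 (d div 2) (d - 1 - d div 2)"
    using d_bounds by (intro U_opt_3) auto
  ultimately show ?thesis unfolding triangle_graphs_def by (simp only:)
qed

lemma iso_copies_U_opt_4:
  assumes "odd d \<or> d + 4 \<le> n" "5 \<le> d"
  shows "(iso_copies (U_opt n 4 d) :: 'a pair_pre_digraph set) = square_graphs n d"
proof -
  have "(iso_copies (U_graph n (2 + 2) d 0 (d div 2) (d - 2 - d div 2)) :: 'a pair_pre_digraph set)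
      = ear_graphs n d (d div 2) (d div 2 + 2) (d div 2 + 0)"
    by (rule iso_copies_U_graph) (use d_bounds ear_square[of d n] assms(2) in auto)
  moreover have "2 + 2 = (4 :: nat)" "d div 2 + 0 = d div 2" by simp_all
  moreover have "U_opt n 4 d = U_graph n 4 d 0 (d div 2) (d - 2 - d div 2)"
    using d_bounds assms by (intro U_opt_4) auto
  ultimately show ?thesis unfolding square_graphs_def if_P[OF assms(1)] by (simp only:)
qed

text \<open>The origin of the threshold (n + 4) / 6. Rounding in (d - 1) div 2 merges the formulas
  for the two parities.\<close>

lemma square_minus_triangle:
  assumes "odd d \<or> d + 4 \<le> n"
  shows "square_value n d - triangle_value n d = 2 * (int n + 4 - 6 * int ((d - 1) div 2))"
proof (cases "even d")
  case True
  then have "int n - int d - 2 \<ge> 2" using assms by simp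
  moreover have "6 * int ((d - 1) div 2) = 3 * int d - 6"
  proof -
    obtain e where e: "d = 2 * e" using True by (rule evenE)
    then have "(d - 1) div 2 = e - 1" using d_bounds by presburger
    then show ?thesis using e d_bounds by simp
  qed
  ultimately show ?thesis using True unfolding square_value_def triangle_value_def Let_def by (simp add: algebra_simps)
next
  case False
  then have "6 * int ((d - 1) div 2) = 3 * int d - 3" by (auto elim!: oddE)
  then show ?thesis using False unfolding square_value_def triangle_value_def Let_def by (simp add: algebra_simps)
qed

lemma compare_real:
  "real q < (real n + 4) / 6 \<longleftrightarrow> 0 < int n + 4 - 6 * int q"
  "real q > (real n + 4) / 6 \<longleftrightarrow> int n + 4 - 6 * int q < 0"
  "real q = (real n + 4) / 6 \<longleftrightarrow> int n + 4 - 6 * int q = 0"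
proof -
  have *: "real_of_int (int n + 4 - 6 * int q) = 6 * ((real n + 4) / 6 - real q)" by simp
  show "real q < (real n + 4) / 6 \<longleftrightarrow> 0 < int n + 4 - 6 * int q"
    unfolding of_int_0_less_iff[symmetric, where 'a=real] * by auto
  show "real q > (real n + 4) / 6 \<longleftrightarrow> int n + 4 - 6 * int q < 0"
    unfolding of_int_less_0_iff[symmetric, where 'a=real] * by auto
  show "real q = (real n + 4) / 6 \<longleftrightarrow> int n + 4 - 6 * int q = 0"
    unfolding of_int_eq_0_iff[symmetric, where 'a=real] * by auto
qed

lemma max_graphs_general:
  assumes c: "odd d \<or> d + 4 \<le> n"
  shows "real ((n - p - 1) div 2) > (real n + 4) / 6 \<Longrightarrow> (max_graphs n p :: 'a pair_pre_digraph set) = iso_copies (U_opt n 4 d)"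
    and "real ((n - p - 1) div 2) = (real n + 4) / 6 \<Longrightarrow>
      (max_graphs n p :: 'a pair_pre_digraph set) = iso_copies (U_opt n 3 d) \<union> iso_copies (U_opt n 4 d)"
    and "real ((n - p - 1) div 2) < (real n + 4) / 6 \<Longrightarrow> (max_graphs n p :: 'a pair_pre_digraph set) = iso_copies (U_opt n 3 d)"
proof -
  define X where "X = int n + 4 - 6 * int ((d - 1) div 2)"
  \<comment> \<open>For d = 4 the difference is positive, so the square family enters only where its
    positions are admissible.\<close>
  have d5: "5 \<le> d" if "X \<le> 0"
  proof (rule ccontr)
    assume "\<not> 5 \<le> d"
    then have "d = 4" using d_bounds by simp
    then show False using that n by (simp add: X_def)
  qed
  note diff = square_minus_triangle[OF c, folded X_def]
  note compare = compare_real[of "(n - p - 1) div 2", unfolded d_bounds(3), folded X_def]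
  show "(max_graphs n p :: 'a pair_pre_digraph set) = iso_copies (U_opt n 4 d)"
    if "real ((n - p - 1) div 2) > (real n + 4) / 6"
  proof -
    have "square_value n d < triangle_value n d" "5 \<le> d" using that d5 diff unfolding d_bounds(3) compare by linarith+
    then show ?thesis
      using iso_copies_U_opt_4[OF c, where 'a='a] max_graphs_square[where 'a='a] by metis
  qed
  show "(max_graphs n p :: 'a pair_pre_digraph set) = iso_copies (U_opt n 3 d) \<union> iso_copies (U_opt n 4 d)"
    if "real ((n - p - 1) div 2) = (real n + 4) / 6"
  proof -
    have "square_value n d = triangle_value n d" "5 \<le> d" using that d5 diff unfolding d_bounds(3) compare by linarith+
    then show ?thesis
      using iso_copies_U_opt_3[where 'a='a] iso_copies_U_opt_4[OF c, where 'a='a] max_graphs_both[where 'a='a] by metis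
  qed
  show "(max_graphs n p :: 'a pair_pre_digraph set) = iso_copies (U_opt n 3 d)"
    if "real ((n - p - 1) div 2) < (real n + 4) / 6"
  proof -
    have "triangle_value n d < square_value n d" using that diff unfolding d_bounds(3) compare by linarith
    then show ?thesis
      using iso_copies_U_opt_3[where 'a='a] max_graphs_triangle[where 'a='a] by metis
  qed
qed

text \<open>Here h = 0, and the square value minus the triangle value is 18 - 4 d for odd d and 12 -
  4 d for even d, negative for every d that occurs.\<close>

lemma max_graphs_two_pendants:
  assumes p2: "p = 2" shows "(max_graphs n p :: 'a pair_pre_digraph set) = iso_copies (U_opt n 4 d)"
proof (cases "odd d")
  case True
  then have d5: "5 \<le> d" using d_bounds by (cases "d = 4") auto
  have "int n = int d + 2" using d_bounds p2 p by simp
  moreover have "6 * int ((d - 1) div 2) = 3 * int d - 3" using True by (auto elim!: oddE)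
  ultimately have "square_value n d < triangle_value n d"
    using square_minus_triangle True d5 by simp
  then show ?thesis
    using max_graphs_square[where 'a='a] d5 iso_copies_U_opt_4[where 'a='a] True by metis
next
  case False
  have nd: "n = d + 2" using d_bounds p2 p by simp
  have "square_value n d < triangle_value n d"
    using False d_bounds(1) unfolding square_value_def triangle_value_def Let_def nd by simp
  then have "(max_graphs n p :: 'a pair_pre_digraph set) = square_graphs n d"
    using False nd by (intro max_graphs_square) auto
  also have "\<dots> = ear_graphs n d (d div 2 - 1) (d div 2 - 1 + 2) (d div 2 - 1 + 0)"
  proof -
    \<comment> \<open>For n = d + 2 there are no feet, so the two families in
      \<open>square_graphs\<close> coincide.\<close>
    have "ear_edges n d a b (\<lambda>_. e) = ear_edges n d a b (\<lambda>_. e')" for a b e e'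
      by (rule ear_edges_cong) (use nd in auto)
    then have "ear_graphs n d a b e = (ear_graphs n d a b e' :: 'a pair_pre_digraph set)" for a b e e'
      unfolding ear_graphs_def by metis
    moreover have "d div 2 - 1 + 2 = d div 2 + 1" using d_bounds(1) by simp
    ultimately show ?thesis using False nd unfolding square_graphs_def by (metis Un_absorb add_le_cancel_left numeral_le_iff semiring_norm(69) semiring_norm(71))
  qed
  also have "\<dots> = iso_copies (U_graph n (2 + 2) d 0 (d div 2 - 1) (d div 2 - 1))"
    using d_bounds False ear_square_balanced[of d n "d div 2 - 1"]
    by (intro iso_copies_U_graph[symmetric]) (auto elim!: evenE)
  finally show ?thesis using U_opt_4_balanced[OF d_bounds(1) nd] False by (simp add: numeral_eq_Suc)
qed

text \<open>Here h = 1, and the square value minus the triangle value is 22 - 4 d, negative from d =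
  6 on. The left-over d = 4 is the exceptional case n = 7.\<close>

lemma max_graphs_three_pendants:
  assumes p3: "p = 3" and even: "even d" and d6: "6 \<le> d"
  shows "(max_graphs n p :: 'a pair_pre_digraph set)
    = iso_copies (U_graph n 4 d 0 (d div 2 - 1) (d div 2 - 1)) \<union> iso_copies (U_graph n 4 d 1 (d div 2 - 1) (d div 2 - 1))"
proof -
  have nd: "n = d + 3" using d_bounds p3 p by simp
  have "square_value n d < triangle_value n d"
    using even d6 unfolding square_value_def triangle_value_def Let_def nd by simp
  then have "(max_graphs n p :: 'a pair_pre_digraph set) = square_graphs n d"
    using even nd by (intro max_graphs_square) auto
  also have "\<dots> = ear_graphs n d (d div 2 - 1) (d div 2 - 1 + 2) (d div 2 - 1 + 0)
      \<union> ear_graphs n d (d div 2 - 1) (d div 2 - 1 + 2) (d div 2 - 1 + 1)"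
    using even d6 nd unfolding square_graphs_def by (auto elim!: evenE)
  also have "\<dots> = iso_copies (U_graph n (2 + 2) d 0 (d div 2 - 1) (d div 2 - 1))
      \<union> iso_copies (U_graph n (2 + 2) d 1 (d div 2 - 1) (d div 2 - 1))"
    using d_bounds even ear_square_balanced[of d n "d div 2 - 1"] ear_square_balanced[of d n "d div 2"] d6
    by (intro arg_cong2[of _ _ _ _ "(\<union>)"] iso_copies_U_graph[symmetric]) (auto elim!: evenE)
  finally show ?thesis by (simp add: numeral_eq_Suc)
qed

end

theorem theorem3:
  fixes n p :: nat
  assumes "n \<ge> 6" and "1 \<le> p" and "p \<le> n - 4"
  shows
    "(p = 1 \<longrightarrow>
        (max_graphs n p :: 'a pair_pre_digraph set) = iso_copies (U_graph n 4 (n - 2) 0 (n - 4) 0)) \<and>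
     (p = 2 \<longrightarrow>
        (max_graphs n p :: 'a pair_pre_digraph set) = iso_copies (U_opt n 4 (n - 2))) \<and>
     (p = 3 \<and> n = 7 \<longrightarrow>
        (max_graphs n p :: 'a pair_pre_digraph set) = iso_copies (U_opt 7 3 4)) \<and>
     (p = 3 \<and> n > 7 \<and> odd n \<longrightarrow>
        (max_graphs n p :: 'a pair_pre_digraph set) =
          iso_copies (U_graph n 4 (n - 3) 0 ((n - 5) div 2) ((n - 5) div 2)) \<union>
          iso_copies (U_graph n 4 (n - 3) 1 ((n - 5) div 2) ((n - 5) div 2))) \<and>
     (p = 3 \<and> even n \<or> 4 \<le> p \<longrightarrow>
        (real ((n - p - 1) div 2) > (real n + 4) / 6 \<longrightarrow>
           (max_graphs n p :: 'a pair_pre_digraph set) = iso_copies (U_opt n 4 (n - p))) \<and>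
        (real ((n - p - 1) div 2) = (real n + 4) / 6 \<longrightarrow>
           (max_graphs n p :: 'a pair_pre_digraph set) =
             iso_copies (U_opt n 3 (n - p)) \<union> iso_copies (U_opt n 4 (n - p))) \<and>
        (real ((n - p - 1) div 2) < (real n + 4) / 6 \<longrightarrow>
           (max_graphs n p :: 'a pair_pre_digraph set) = iso_copies (U_opt n 3 (n - p))))"
proof (intro conjI impI)
  have p4: "p + 4 \<le> n" using assms by simp
  show "(max_graphs n p :: 'a pair_pre_digraph set) = iso_copies (U_graph n 4 (n - 2) 0 (n - 4) 0)" if "p = 1"
    using max_graphs_one_pendant[OF assms(1)] that by simp
  show "(max_graphs n p :: 'a pair_pre_digraph set) = iso_copies (U_opt n 4 (n - 2))" if "p = 2"
    using max_graphs_two_pendants[OF assms(1) _ p4 refl that] that by simp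
  show "(max_graphs n p :: 'a pair_pre_digraph set) = iso_copies (U_opt 7 3 4)" if "p = 3 \<and> n = 7"
  proof -
    \<comment> \<open>The values are 150 and 156.\<close>
    have "triangle_value 7 4 < square_value 7 4"
      unfolding square_value_def triangle_value_def Let_def by simp
    then have "(max_graphs 7 3 :: 'a pair_pre_digraph set) = triangle_graphs 7 4"
      by (intro max_graphs_triangle) simp_all
    also have "\<dots> = iso_copies (U_opt 7 3 4)"
      by (rule iso_copies_U_opt_3[symmetric, where p = 3]) simp_all
    finally show ?thesis using that by (simp only:)
  qed
  show "(max_graphs n p :: 'a pair_pre_digraph set) =
      iso_copies (U_graph n 4 (n - 3) 0 ((n - 5) div 2) ((n - 5) div 2)) \<union>
      iso_copies (U_graph n 4 (n - 3) 1 ((n - 5) div 2) ((n - 5) div 2))" if c: "p = 3 \<and> n > 7 \<and> odd n"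
  proof -
    have "(n - 3) div 2 - 1 = (n - 5) div 2" "even (n - 3)" "6 \<le> n - 3" using c by presburger+
    then show ?thesis using max_graphs_three_pendants[OF assms(1) _ p4 refl, where 'a='a] c by simp
  qed
  assume "p = 3 \<and> even n \<or> 4 \<le> p"
  \<comment> \<open>For p = 3 an even n makes the diameter n - p odd; for p \<ge> 4 the second
    alternative holds.\<close>
  then have c: "odd (n - p) \<or> n - p + 4 \<le> n" "2 \<le> p" using p4 by auto
  note general = max_graphs_general[OF assms(1) c(2) p4 refl c(1), where 'a='a]
  show "(max_graphs n p :: 'a pair_pre_digraph set) = iso_copies (U_opt n 4 (n - p))"
    if "real ((n - p - 1) div 2) > (real n + 4) / 6" by (rule general(1)[OF that])
  show "(max_graphs n p :: 'a pair_pre_digraph set) = iso_copies (U_opt n 3 (n - p)) \<union> iso_copies (U_opt n 4 (n - p))"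
    if "real ((n - p - 1) div 2) = (real n + 4) / 6" by (rule general(2)[OF that])
  show "(max_graphs n p :: 'a pair_pre_digraph set) = iso_copies (U_opt n 3 (n - p))"
    if "real ((n - p - 1) div 2) < (real n + 4) / 6" by (rule general(3)[OF that])
qed

end
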